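(* Let $F\in\mathrm{Diff}(\mathbb{C}^2,0)$ be a germ with the finite orbits property such that its linear part $D_0F$ does not have the finite orbits property. Let $\lambda$ be the eigenvalue of $D_0F$ that is not a root of unity. Then $\lambda$ is not a Bruno number.
   Context: $\mathrm{Diff}(\mathbb{C}^2,0)$ is the group of germs at $0$ of biholomorphisms of $\mathbb{C}^2$ fixing $0$. For a representative $F:U\to V$ (a biholomorphism between open neighborhoods of $0$ with $F(0)=0$), $A\subset U\cap V$ and $p\in A$, put $O^+_{F,A}(p)=\{F^j(p): j\ge 0,\ F^k(p)\in A\text{ for all }0\le k\le j\}$ and $O_{F,A}(p)=O^+_{F,A}(p)\cup O^+_{F^{-1},A}(p)$. $F$ has the finite orbits property in $A$ if $O_{F,A}(p)$ is finite for all $p\in A$. A germ $F$ has the finite orbits property if there exist a representative $F:U\to V$ and a neighborhood $A\subset U\cap V$ of $0$ such that $F$ has the finite orbits property in $A$. The linear part $D_0F$ is regarded as a linear element of $\mathrm{Diff}(\mathbb{C}^2,0)$. A number $\lambda\in\mathbb{C}$ is a Bruno number if $|\lambda|=1$ and there is a sequence of integers $1<q_1<q_2<\cdots$ such that $\sum_{k=1}^\infty\frac{1}{q_k}\log\frac{1}{\Omega_\lambda(q_{k+1})}<+\infty$, where $\Omega_\lambda(m)=\min_{2\le k\le m}|\lambda^k-\lambda|$ for $m\ge 2$ (with $\log(1/0)=+\infty$). *)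

theory Defs
  imports "HOL-Analysis.Analysis"
begin

definition holomorphic_map_on :: "(complex^'n \<Rightarrow> complex^'m) \<Rightarrow> (complex^'n) set \<Rightarrow> bool" where
  "holomorphic_map_on F U \<longleftrightarrow>
     (\<forall>p\<in>U. \<exists>D. (F has_derivative D) (at p) \<and> Vector_Spaces.linear (*s) (*s) D)"

definition biholomorphism ::
  "(complex^2 \<Rightarrow> complex^2) \<Rightarrow> (complex^2) set \<Rightarrow> (complex^2) set \<Rightarrow> bool" where
  "biholomorphism F U V \<longleftrightarrow>
     open U \<and> open V \<and> bij_betw F U V \<and>
     holomorphic_map_on F U \<and> holomorphic_map_on (inv_into U F) V"

text \<open>
  A germ is given by a total function, of which only the values near 0 matter;
  two functions have the same germ if they agree on a neighbourhood of 0.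
\<close>

definition local_diffeo ::
  "(complex^2 \<Rightarrow> complex^2) \<Rightarrow> (complex^2) set \<Rightarrow> (complex^2) set \<Rightarrow> bool" where
  "local_diffeo F U V \<longleftrightarrow> biholomorphism F U V \<and> 0 \<in> U \<and> 0 \<in> V \<and> F 0 = 0"

definition same_germ :: "(complex^2 \<Rightarrow> complex^2) \<Rightarrow> (complex^2 \<Rightarrow> complex^2) \<Rightarrow> bool" where
  "same_germ F G \<longleftrightarrow> (\<forall>\<^sub>F z in nhds 0. F z = G z)"

definition Diff0 :: "(complex^2 \<Rightarrow> complex^2) set" where
  "Diff0 = {F. \<exists>U V. local_diffeo F U V}"

definition pos_orbit :: "('a \<Rightarrow> 'a) \<Rightarrow> 'a set \<Rightarrow> 'a \<Rightarrow> 'a set" where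
  "pos_orbit F A p = {(F ^^ j) p | j. \<forall>k\<le>j. (F ^^ k) p \<in> A}"

text \<open>
  For \<open>F : U \<rightarrow> V\<close> and \<open>A \<subseteq> U \<inter> V\<close>, the values of \<open>F\<close> outside \<open>U\<close> and
  of \<open>inv_into U F\<close> outside \<open>V\<close> do not influence the orbits.
\<close>

definition local_orbit :: "('a \<Rightarrow> 'a) \<Rightarrow> 'a set \<Rightarrow> 'a set \<Rightarrow> 'a \<Rightarrow> 'a set" where
  "local_orbit F U A p = pos_orbit F A p \<union> pos_orbit (inv_into U F) A p"

definition finite_orbits_in :: "('a \<Rightarrow> 'a) \<Rightarrow> 'a set \<Rightarrow> 'a set \<Rightarrow> bool" where
  "finite_orbits_in F U A \<longleftrightarrow> (\<forall>p\<in>A. finite (local_orbit F U A p))"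

definition finite_orbits_property :: "(complex^2 \<Rightarrow> complex^2) \<Rightarrow> bool" where
  "finite_orbits_property F \<longleftrightarrow>
     (\<exists>G U V A. same_germ F G \<and> local_diffeo G U V \<and>
        0 \<in> interior A \<and> A \<subseteq> U \<inter> V \<and> finite_orbits_in G U A)"

definition linear_part :: "(complex^2 \<Rightarrow> complex^2) \<Rightarrow> complex^2 \<Rightarrow> complex^2" where
  "linear_part F = frechet_derivative F (at 0)"

definition eigenvalue :: "(complex^'n \<Rightarrow> complex^'n) \<Rightarrow> complex \<Rightarrow> bool" where
  "eigenvalue L lam \<longleftrightarrow> (\<exists>v. v \<noteq> 0 \<and> L v = lam *s v)"

definition root_of_unity :: "complex \<Rightarrow> bool" where
  "root_of_unity lam \<longleftrightarrow> (\<exists>n>0. lam ^ n = 1)"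

definition Omega :: "complex \<Rightarrow> nat \<Rightarrow> real" where
  "Omega lam m = Min ((\<lambda>k. norm (lam ^ k - lam)) ` {2..m})"

definition log_recip :: "real \<Rightarrow> ereal" where
  "log_recip x = (if x = 0 then \<infinity> else ereal (ln (1 / x)))"

text \<open>
  The sequence is indexed from 0 instead of 1.  The partial sums always converge in
  \<open>ereal\<close>, since for \<open>norm lam = 1\<close> the values \<open>Omega lam (q k)\<close> tend to 0, so all but finitely many terms
  are nonnegative.
\<close>

definition Bruno_number :: "complex \<Rightarrow> bool" where
  "Bruno_number lam \<longleftrightarrow>
     norm lam = 1 \<and>
     (\<exists>q :: nat \<Rightarrow> nat. 1 < q 0 \<and> strict_mono q \<and>
        (\<exists>s < \<infinity>. (\<lambda>k. ereal (1 / real (q k)) * log_recip (Omega lam (q (Suc k)))) sums s))"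

end

theory Submission
  imports Defs "HOL-Complex_Analysis.Complex_Analysis"
begin

text \<open>
  Suppose that \<open>\<lambda>\<close> is a Bruno number. At a fixed point of an iterate \<open>f\<^sup>n\<close> with eigenvalues \<open>1\<close> and \<open>\<zeta>\<close>, the
  coefficients of an invariant disc on which \<open>f\<^sup>n\<close> acts as \<open>z \<mapsto> \<zeta> z\<close> are determined recursively, with the
  divisors \<open>\<zeta>\<^sup>k - \<zeta>\<close> and \<open>\<zeta>\<^sup>k - 1\<close>. The disc exists if \<open>norm \<zeta> < 1\<close>, and by the majorants of Siegel and Bruno also
  if \<open>\<zeta>\<close> is a positive power of \<open>\<lambda>\<close>. Its points have infinite orbits if \<open>\<zeta>\<close> is not a root of unity, so neither
  case occurs; \<open>norm \<zeta> > 1\<close> is excluded by passing to the inverse map.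

  In particular no iterate of \<open>f\<close> has the eigenvalue \<open>1\<close> at \<open>0\<close>, because the other eigenvalue would be a power of \<open>\<lambda>\<close>.
  On the other hand, comparing the component of \<open>0\<close> in the set of points that stay in a ball for \<open>n\<close> steps with the
  boundary of the ball yields a nondegenerate continuum \<open>K\<close> through \<open>0\<close> with all forward, or all backward, orbits in
  the domain. All points of \<open>K\<close> are periodic. The multiplier \<open>\<zeta>\<close> is constant on connected sets of fixed points of an
  iterate, since the powers of \<open>\<lambda>\<close> are dense in the circle. Hence \<open>K\<close> is a countable union of
  closed sets: the fixed points of \<open>f\<^bsup>k!\<^esup>\<close> in \<open>K\<close> with eigenvalue \<open>1\<close> and a given multiplier, and single points. There
  are only countably many multipliers, because near a limit point with \<open>\<zeta> \<noteq> 1\<close> the fixed points form a curve. A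
  variant of Sierpinski's theorem shows that \<open>K\<close> is contained in one of them, which is impossible at \<open>0\<close>.
\<close>

text \<open>The disc is tangent to the eigenvector of \<zeta>, so its coefficients see only powers
  of \<zeta>: the divisor in the direction of the eigenvalue 1 is \<zeta>^k - 1, and the resonance
  of the eigenvalue 1 with itself does no harm. This is why a condition on one number suffices in
  dimension two. The price is that degree k meets the divisors of k - 1 and of k, so that two
  consecutive degrees may both be bad.

  Rigidity replaces it: a connected set inside one piece that meets another piece lies in that
  piece. For a multiplier that is a nontrivial root of unity this can fail, because a higher iterate
  can have new fixed points nearby; such points are treated at an iterate where the multiplier has
  become 1.\<close>

section \<open>Products of small divisors\<close>

text \<open>The maximal number of inner nodes with a number of leaves in \<open>B\<close>, among all binary trees with \<open>k\<close> leaves.\<close>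

function max_split_count :: "nat set \<Rightarrow> nat \<Rightarrow> nat" where
  "max_split_count B k = (if k \<le> 1 then 0 else
     of_bool (k \<in> B) + Max ((\<lambda>a. max_split_count B a + max_split_count B (k - a)) ` {1..<k}))"
  by auto
termination by (relation "Wellfounded.measure snd") auto

declare max_split_count.simps [simp del]

lemma max_split_count_ge:
  assumes "1 \<le> a" "a < k"
  shows "of_bool (k \<in> B) + (max_split_count B a + max_split_count B (k - a)) \<le> max_split_count B k"
proof -
  have "max_split_count B a + max_split_count B (k - a)
      \<le> Max ((\<lambda>a. max_split_count B a + max_split_count B (k - a)) ` {1..<k})"
    using assms by (intro Max_ge) auto
  thus ?thesis using assms by (subst max_split_count.simps[of B k]) auto
qed

lemma max_split_count_attained:
  assumes "2 \<le> k"
  obtains a where "1 \<le> a" "a < k"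
    "max_split_count B k = of_bool (k \<in> B) + (max_split_count B a + max_split_count B (k - a))"
proof -
  have "Max ((\<lambda>a. max_split_count B a + max_split_count B (k - a)) ` {1..<k})
     \<in> (\<lambda>a. max_split_count B a + max_split_count B (k - a)) ` {1..<k}"
    using assms by (intro Max_in) auto
  then obtain a where "1 \<le> a" "a < k"
    "Max ((\<lambda>a. max_split_count B a + max_split_count B (k - a)) ` {1..<k})
       = max_split_count B a + max_split_count B (k - a)"
    by auto
  thus ?thesis using that assms max_split_count.simps[of B k] by simp
qed

lemma max_split_count_symmetric:
  assumes "2 \<le> k"
  obtains a b where "1 \<le> b" "b \<le> a" "a + b = k"
    "max_split_count B k = of_bool (k \<in> B) + (max_split_count B a + max_split_count B b)"
proof -
  obtain a where a: "1 \<le> a" "a < k"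
    "max_split_count B k = of_bool (k \<in> B) + (max_split_count B a + max_split_count B (k - a))"
    using max_split_count_attained[OF assms] by metis
  show ?thesis
  proof (cases "k - a \<le> a")
    case True
    then show ?thesis using a by (intro that[of "k - a" a]) auto
  next
    case False
    then show ?thesis using a by (intro that[of a "k - a"]) auto
  qed
qed

lemma max_split_count_eq_0:
  assumes "\<And>b. b \<in> B \<Longrightarrow> m < b" "k \<le> m"
  shows "max_split_count B k = 0"
  using assms(2)
proof (induction k rule: less_induct)
  case (less k)
  show ?case
  proof (cases "k \<le> 1")
    case True
    then show ?thesis by (simp add: max_split_count.simps)
  next
    case False
    then obtain a b where "1 \<le> b" "b \<le> a" "a + b = k"
      "max_split_count B k = of_bool (k \<in> B) + (max_split_count B a + max_split_count B b)"
      using max_split_count_symmetric[of k B] by (metis linorder_not_le nat_less_le less_eq_Suc_le one_add_one plus_1_eq_Suc)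
    moreover have "k \<notin> B" using assms(1) less.prems by force
    ultimately show ?thesis using less by simp
  qed
qed

text \<open>Bruno's counting argument. Consecutive elements of \<open>B\<close> have to be allowed, because the
  divisors of degree \<open>k\<close> in the two coordinates are those of \<open>k - 1\<close> and \<open>k\<close>.\<close>

lemma max_split_count_le:
  fixes m :: nat
  assumes m: "1 \<le> m" and Bm: "\<And>b. b \<in> B \<Longrightarrow> m < b"
    and gap: "\<And>a b. a \<in> B \<Longrightarrow> b \<in> B \<Longrightarrow> a < b \<Longrightarrow> b = Suc a \<or> m \<le> b - a"
  shows "m < k \<Longrightarrow> real (max_split_count B k) \<le> 4 * k / m - 2"
proof (induction k rule: less_induct)
  case (less k)
  define n where "n = (\<lambda>k. real (max_split_count B k))"
  define c where "c = (\<lambda>k::nat. 4 * real k / real m)"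
  have cadd: "c (a + b) = c a + c b" for a b unfolding c_def of_nat_add distrib_left add_divide_distrib ..
  have cmono: "a \<le> b \<Longrightarrow> c a \<le> c b" for a b by (simp add: c_def divide_right_mono)
  have c4: "c a \<ge> 4" if "m \<le> a" for a
    using that m by (simp add: c_def field_simps)
  have c0: "c a \<ge> 0" for a by (simp add: c_def)
  have n0: "n a = 0" if "a \<le> m" for a
    using max_split_count_eq_0[OF Bm that] by (simp add: n_def)
  have IH: "n j \<le> c j - 2" if "m < j" "j < k" for j
    using less.IH[OF that(2,1)] by (simp add: n_def c_def)
  have ck: "c k \<ge> 4" using c4 less.prems by auto
  \<comment> \<open>A subtree without sizes from \<open>B\<close> in the last window of length
    \<open>m\<close> stays 2 below the target \<open>c k - 2\<close>. Descending along the larger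
    branches, either the size drops by \<open>m\<close>, which is worth \<open>c m = 4\<close>, or
    the tree splits into two parts larger than \<open>m\<close>, and each part brings its own -2.
    This gain pays for the at most two nodes \<open>k\<close> and \<open>k - 1\<close> in
    \<open>B\<close>.\<close>
  have low: "n j \<le> c k - 4" if "j < k" "B \<inter> {j'. k < j' + m \<and> j' \<le> j} = {}" for j
    using that
  proof (induction j rule: less_induct)
    case (less j)
    show ?case
    proof (cases "j \<le> m")
      case True
      then show ?thesis using n0 ck by simp
    next
      case jm: False
      show ?thesis
      proof (cases "j + m \<le> k")
        case True
        have "c j + c m \<le> c k" using cmono[OF True] by (simp add: cadd)
        then show ?thesis using IH[of j] jm less.prems c4[of m] by auto
      next
        case False
        hence jB: "j \<notin> B" using less.prems by auto
        have "2 \<le> j" using jm m by linarith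
        then obtain a b where "1 \<le> b" "b \<le> a" "a + b = j"
          "max_split_count B j = of_bool (j \<in> B) + (max_split_count B a + max_split_count B b)"
          by (rule max_split_count_symmetric)
        hence ab: "1 \<le> b" "b \<le> a" "a + b = j" "n j = n a + n b"
          using jB by (simp_all add: n_def)
        have la: "n a \<le> c k - 4"
          using ab less.prems by (intro less.IH) auto
        show ?thesis
        proof (cases "b \<le> m")
          case True
          then show ?thesis using n0 ab la by simp
        next
          case False
          then have "n a + n b \<le> c a - 2 + (c b - 2)"
            using IH[of a] IH[of b] ab less.prems by auto
          also have "\<dots> = c j - 4" using cadd[of a b] ab(3) by simp
          finally show ?thesis using cmono[of j k] less.prems ab by auto
        qed
      qed
    qed
  qed
  have "2 \<le> k" using less.prems m by linarith
  then obtain a b where "1 \<le> b" "b \<le> a" "a + b = k"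
    "max_split_count B k = of_bool (k \<in> B) + (max_split_count B a + max_split_count B b)"
    by (rule max_split_count_symmetric)
  hence ab: "1 \<le> b" "b \<le> a" "a + b = k" "n k = of_bool (k \<in> B) + (n a + n b)"
    by (simp_all add: n_def)
  have cab: "c k = c a + c b" using cadd[of a b] ab(3) by simp
  have "n k \<le> c k - 2"
  proof (cases "m < b")
    case True
    then have "n a + n b \<le> c a - 2 + (c b - 2)" using IH[of a] IH[of b] ab by auto
    then show ?thesis using ab cab by (simp add: of_bool_def split: if_splits)
  next
    case bm: False
    hence nb: "n b = 0" using n0 by simp
    show ?thesis
    proof (cases "k \<in> B")
      case kB: False
      show ?thesis
      proof (cases "m < a")
        case True
        then show ?thesis using IH[of a] ab nb kB cab c0[of b] by auto
      next
        case False
        then show ?thesis using n0[of a] nb ab kB ck by auto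
      qed
    next
      case kB: True
      show ?thesis
      proof (cases "B \<inter> {j'. k < j' + m \<and> j' \<le> a} = {}")
        case True
        then show ?thesis using low[of a] ab nb kB by auto
      next
        case False
        then obtain j where j: "j \<in> B" "k < j + m" "j \<le> a" by auto
        \<comment> \<open>The size \<open>j\<close> is less than \<open>m\<close> below
          \<open>k\<close>, so \<open>gap\<close> leaves only \<open>k - 1\<close>. This forces
          \<open>b = 1\<close>, and no further element of \<open>B\<close> can lie in the window
          below \<open>a\<close>, which is what \<open>low\<close> asks for.\<close>
        hence "k = Suc j" using gap[of j k] kB ab by auto
        with j ab have aj: "a = j" "k = Suc a" by auto
        hence aB: "a \<in> B" using j by simp
        hence "m < a" using Bm by auto
        hence "2 \<le> a" using m by linarith
        then obtain a' b' where "1 \<le> b'" "b' \<le> a'" "a' + b' = a"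
          "max_split_count B a = of_bool (a \<in> B) + (max_split_count B a' + max_split_count B b')"
          by (rule max_split_count_symmetric)
        hence ab': "1 \<le> b'" "b' \<le> a'" "a' + b' = a" "n a = 1 + (n a' + n b')"
          using aB by (simp_all add: n_def)
        have e: "B \<inter> {j'. k < j' + m \<and> j' \<le> a'} = {}"
          using gap[of _ k] kB aj ab' by fastforce
        show ?thesis
        proof (cases "m < b'")
          case True
          then have "n a' + n b' \<le> c a' - 2 + (c b' - 2)" using IH[of a'] IH[of b'] ab' aj by auto
          moreover have "c a' + c b' \<le> c k" using cmono[of a k] cadd[of a' b'] ab' aj by simp
          ultimately show ?thesis using ab nb ab' kB by auto
        next
          case False
          then show ?thesis using low[of a'] e n0[of b'] ab nb ab' kB aj by auto
        qed
      qed
    qed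
  qed
  thus ?case by (simp add: n_def c_def)
qed

corollary max_split_count_le':
  fixes m :: nat
  assumes "1 \<le> m" "\<And>b. b \<in> B \<Longrightarrow> m < b"
    "\<And>a b. a \<in> B \<Longrightarrow> b \<in> B \<Longrightarrow> a < b \<Longrightarrow> b = Suc a \<or> m \<le> b - a"
  shows "real (max_split_count B k) \<le> 4 * k / m"
proof (cases "m < k")
  case True
  then show ?thesis using max_split_count_le[of m B k, OF assms True] by linarith
next
  case False
  then show ?thesis using max_split_count_eq_0[OF assms(2)] by simp
qed

text \<open>The maximal product of the \<open>1 / e j\<close> over the inner nodes, with \<open>j\<close> leaves, of a binary tree with \<open>k\<close> leaves.\<close>

function split_product :: "(nat \<Rightarrow> real) \<Rightarrow> nat \<Rightarrow> real" where
  "split_product e k = (if k \<le> 1 then 1 else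
     Max ((\<lambda>a. split_product e a * split_product e (k - a)) ` {1..<k}) / e k)"
  by auto
termination by (relation "Wellfounded.measure snd") auto

declare split_product.simps [simp del]

lemma split_product_1 [simp]: "split_product e (Suc 0) = 1"
  by (simp add: split_product.simps)

lemma split_product_ge:
  assumes "1 \<le> a" "a < k" "0 < e k"
  shows "split_product e a * split_product e (k - a) / e k \<le> split_product e k"
proof -
  have "split_product e a * split_product e (k - a)
      \<le> Max ((\<lambda>a. split_product e a * split_product e (k - a)) ` {1..<k})"
    using assms by (intro Max_ge) auto
  thus ?thesis using assms
    by (subst split_product.simps[of e k]) (auto intro: divide_right_mono)
qed

lemma split_product_attained:
  assumes "2 \<le> k"
  obtains a where "1 \<le> a" "a < k"
    "split_product e k = split_product e a * split_product e (k - a) / e k"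
proof -
  have "Max ((\<lambda>a. split_product e a * split_product e (k - a)) ` {1..<k})
     \<in> (\<lambda>a. split_product e a * split_product e (k - a)) ` {1..<k}"
    using assms by (intro Max_in) auto
  then obtain a where "1 \<le> a" "a < k"
    "Max ((\<lambda>a. split_product e a * split_product e (k - a)) ` {1..<k})
       = split_product e a * split_product e (k - a)"
    by auto
  thus ?thesis using that assms split_product.simps[of e k] by simp
qed

lemma split_product_pos:
  assumes "\<And>k. k \<ge> 2 \<Longrightarrow> 0 < e k"
  shows "split_product e k > 0"
proof (induction k rule: less_induct)
  case (less k)
  show ?case
  proof (cases "k \<le> 1")
    case True
    then show ?thesis by (simp add: split_product.simps)
  next
    case False
    then obtain a where "1 \<le> a" "a < k"
      "split_product e k = split_product e a * split_product e (k - a) / e k"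
      using split_product_attained[of k e] by (metis linorder_not_le less_eq_Suc_le one_add_one plus_1_eq_Suc)
    then show ?thesis using less.IH[of a] less.IH[of "k - a"] assms[of k] False by auto
  qed
qed

text \<open>The factor \<open>e (a + b)\<close> in the first inequality compensates the one division
  by a small divisor in each step of the recursion for the curve.\<close>

lemma split_product_superadditive:
  assumes "\<And>k. k \<ge> 2 \<Longrightarrow> 0 < e k" "\<And>k. k \<ge> 2 \<Longrightarrow> e k \<le> 1" "1 \<le> a" "1 \<le> b"
  shows "split_product e a * split_product e b \<le> e (a + b) * split_product e (a + b)"
    and "split_product e a * split_product e b \<le> split_product e (a + b)"
proof -
  have e: "0 < e (a + b)" "e (a + b) \<le> 1" using assms by auto
  show *: "split_product e a * split_product e b \<le> e (a + b) * split_product e (a + b)"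
    using split_product_ge[of a "a + b" e] e assms by (simp add: field_simps)
  have "e (a + b) * split_product e (a + b) \<le> 1 * split_product e (a + b)"
    using e split_product_pos[of e "a + b"] assms(1) by (intro mult_right_mono) auto
  thus "split_product e a * split_product e b \<le> split_product e (a + b)" using * by simp
qed

text \<open>A binary tree with \<open>k\<close> leaves has \<open>k - 1\<close> inner nodes. Each of
  them is charged \<open>w0\<close>, and in addition \<open>w s\<close> whenever its number of
  leaves lies in \<open>B s\<close>. The logarithm of the product thus reduces to one counting
  problem for each level \<open>s\<close>.\<close>

lemma split_product_le_exp:
  fixes w :: "nat \<Rightarrow> real" and K :: nat
  assumes e0: "\<And>k. k \<ge> 2 \<Longrightarrow> 0 < e k" and w0: "0 \<le> w0" and w: "\<And>s. 0 \<le> w s"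
    and e: "\<And>k. 2 \<le> k \<Longrightarrow> k \<le> K \<Longrightarrow> ln (1 / e k) \<le> w0 + (\<Sum>s<S. w s * of_bool (k \<in> B s))"
    and "1 \<le> k" "k \<le> K"
  shows "split_product e k \<le> exp (w0 * real (k - 1) + (\<Sum>s<S. w s * max_split_count (B s) k))"
  using assms(5,6)
proof (induction k rule: less_induct)
  case (less k)
  show ?case
  proof (cases "k = 1")
    case True
    then show ?thesis using w by (auto intro!: sum_nonneg)
  next
    case False
    hence k2: "2 \<le> k" using less by auto
    then obtain a where a: "1 \<le> a" "a < k"
      "split_product e k = split_product e a * split_product e (k - a) / e k"
      using split_product_attained[of k e] by metis
    define E where "E = (\<lambda>k. w0 * real (k - 1) + (\<Sum>s<S. w s * max_split_count (B s) k))"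
    have le: "split_product e a \<le> exp (E a)" "split_product e (k - a) \<le> exp (E (k - a))"
      using less.IH[of a] less.IH[of "k - a"] a less.prems by (auto simp: E_def)
    have "1 / e k = exp (ln (1 / e k))" using e0[OF k2] by simp
    also have "\<dots> \<le> exp (w0 + (\<Sum>s<S. w s * of_bool (k \<in> B s)))"
      using e[OF k2 less.prems(2)] by simp
    finally have "1 / e k \<le> exp (w0 + (\<Sum>s<S. w s * of_bool (k \<in> B s)))" .
    hence "split_product e a * split_product e (k - a) * (1 / e k)
        \<le> exp (E a) * exp (E (k - a)) * exp (w0 + (\<Sum>s<S. w s * of_bool (k \<in> B s)))"
      using le split_product_pos[of e, OF e0] e0[OF k2]
      by (intro mult_mono) (auto simp: less_imp_le)
    also have "\<dots> = exp (E a + E (k - a) + (w0 + (\<Sum>s<S. w s * of_bool (k \<in> B s))))"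
      by (simp add: exp_add)
    also have "E a + E (k - a) + (w0 + (\<Sum>s<S. w s * of_bool (k \<in> B s)))
       = w0 * real (k - 1) + (\<Sum>s<S. w s * (of_bool (k \<in> B s)
           + (real (max_split_count (B s) a) + real (max_split_count (B s) (k - a)))))"
    proof -
      have "real (k - 1) = real (a - 1) + real (k - a - 1) + 1" using a by linarith
      hence "w0 * real (k - 1) = w0 * real (a - 1) + w0 * real (k - a - 1) + w0"
        by (simp only: distrib_left mult_1_right)
      then show ?thesis by (simp only: E_def sum.distrib distrib_left add_ac)
    qed
    also have "\<dots> \<le> w0 * real (k - 1) + (\<Sum>s<S. w s * max_split_count (B s) k)"
    proof (intro add_left_mono sum_mono mult_left_mono w)
      fix s
      have "of_bool (k \<in> B s) + (max_split_count (B s) a + max_split_count (B s) (k - a)) \<le> max_split_count (B s) k"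
        using max_split_count_ge[of a k] a by blast
      thus "of_bool (k \<in> B s) + (real (max_split_count (B s) a) + real (max_split_count (B s) (k - a))) \<le> real (max_split_count (B s) k)"
        by (metis of_nat_add of_nat_le_iff of_nat_of_bool)
    qed
    finally show ?thesis using a by simp
  qed
qed

text \<open>The two norms belong to the coordinates with the eigenvalues \<open>L\<close> and 1. The
  cap 1 makes the products of reciprocals supermultiplicative.\<close>

definition divisor :: "complex \<Rightarrow> nat \<Rightarrow> real" where
  "divisor L k = min 1 (min (norm (L ^ k - L)) (norm (L ^ k - 1)))"

text \<open>Exponential growth of the products of reciprocal divisors is what leaves the invariant
  curve a positive radius of convergence.\<close>

definition good_divisors :: "complex \<Rightarrow> bool" where
  "good_divisors L \<longleftrightarrow> \<not> root_of_unity L \<and> L \<noteq> 0 \<and>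
     (\<exists>C\<ge>1. \<forall>k. split_product (divisor L) k \<le> C ^ k)"

lemma divisor_le_1: "divisor L k \<le> 1"
  by (simp add: divisor_def)

lemma divisor_pos:
  assumes "\<not> root_of_unity L" "L \<noteq> 0" "2 \<le> k"
  shows "0 < divisor L k"
proof -
  have "L ^ k \<noteq> 1" using assms unfolding root_of_unity_def by (metis less_le_trans pos2)
  moreover have "L ^ k \<noteq> L"
  proof
    assume "L ^ k = L"
    moreover have "L ^ k = L * L ^ (k - 1)" using assms by (metis Suc_diff_1 less_le_trans pos2 power_Suc)
    ultimately have "L ^ (k - 1) = 1" using assms by simp
    moreover have "k - 1 > 0" using assms by simp
    ultimately show False using assms unfolding root_of_unity_def by blast
  qed
  ultimately show ?thesis by (simp add: divisor_def)
qed

lemma good_divisors_if_bounded_below: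
  assumes "\<not> root_of_unity L" "L \<noteq> 0" "0 < c" "\<And>k. 2 \<le> k \<Longrightarrow> c \<le> divisor L k"
  shows "good_divisors L"
proof -
  have c1: "c \<le> 1" using assms(4)[of 2] divisor_le_1[of L 2] by auto
  define w0 where "w0 = ln (1 / c)"
  have w0: "0 \<le> w0" using c1 assms(3) by (simp add: w0_def)
  have "split_product (divisor L) k \<le> exp w0 ^ k" for k
  proof (cases "k = 0")
    case True
    then show ?thesis by (simp add: split_product.simps)
  next
    case False
    have "split_product (divisor L) k \<le> exp (w0 * real (k - 1) + (\<Sum>s<(0::nat). 0 * real (max_split_count {} k)))"
    proof (rule split_product_le_exp[where K = k and S = 0 and w = "\<lambda>_. 0" and B = "\<lambda>_. {}"])
      show "ln (1 / divisor L j) \<le> w0 + (\<Sum>s<(0::nat). 0 * of_bool (j \<in> {}))" if "2 \<le> j" for j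
        unfolding w0_def using assms(3) assms(4)[OF that] by (simp add: ln_div frac_le)
    qed (use False w0 divisor_pos assms in auto)
    also have "\<dots> \<le> exp (real k * w0)" using w0 by (simp add: mult_left_mono mult.commute mult_right_mono)
    finally show ?thesis by (simp add: exp_of_nat_mult)
  qed
  thus ?thesis unfolding good_divisors_def using assms w0 by (metis one_le_exp_iff)
qed

lemma good_divisors_if_norm_less_1:
  assumes "norm L < 1" "L \<noteq> 0"
  shows "good_divisors L"
proof (rule good_divisors_if_bounded_below)
  have pw: "norm (L ^ k) \<le> norm L" if "1 \<le> k" for k
    using power_decreasing[of 1 k "norm L"] assms that by (simp add: norm_power)
  show "\<not> root_of_unity L"
  proof
    assume "root_of_unity L"
    then obtain n where "n > 0" "L ^ n = 1" by (auto simp: root_of_unity_def)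
    thus False using pw[of n] assms by simp
  qed
  have one: "norm (L ^ k - 1) \<ge> 1 - norm L" if "1 \<le> k" for k
    using norm_triangle_ineq2[of 1 "L ^ k"] pw[OF that] by (simp add: norm_minus_commute)
  have two: "norm (L ^ k - L) \<ge> norm L * (1 - norm L)" if "2 \<le> k" for k
  proof -
    have "L ^ k - L = L * (L ^ (k - 1) - 1)"
      using that by (simp add: right_diff_distrib power_eq_if)
    thus ?thesis using one[of "k - 1"] that by (simp add: norm_mult mult_left_mono)
  qed
  have small: "norm L * (1 - norm L) \<le> 1 - norm L" using assms by (simp add: mult_left_le_one_le)
  show "norm L * (1 - norm L) \<le> divisor L k" if "2 \<le> k" for k
    proof -
    have "norm L * (1 - norm L) \<le> 1" using small norm_ge_zero[of L] by linarith
    thus ?thesis using one[of k] two[OF that] small that by (simp add: divisor_def)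
  qed
  show "0 < norm L * (1 - norm L)" using assms by simp
qed (use assms in auto)

text \<open>\<open>B s\<close> collects the degrees with a divisor below \<open>\<theta> s\<close>.
  Such a degree \<open>k\<close> puts \<open>L ^ k\<close> or \<open>L ^ (k - 1)\<close> within
  \<open>\<theta> s\<close> of 1, and for two such degrees the quotient of the powers is within
  \<open>2 * \<theta> s\<close> of 1. By the separation hypothesis these degrees are large and, up
  to consecutive pairs, far apart, so level \<open>s\<close> occurs at most
  \<open>4 * k / m s\<close> times. A degree outside \<open>B (Suc s)\<close> costs at most
  \<open>ln (1 / \<theta> (Suc s))\<close>; hence the shifted index in the summability
  condition.\<close>

lemma good_divisors_criterion:
  fixes m :: "nat \<Rightarrow> nat" and \<theta> :: "nat \<Rightarrow> real"
  assumes L: "norm L = 1" "\<not> root_of_unity L"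
    and \<theta>: "\<And>s. 0 < \<theta> s" "\<And>s. \<theta> s \<le> 1" and m: "\<And>s. 1 \<le> m s" "\<And>K. \<exists>s. K \<le> m s"
    and sep: "\<And>s j. 1 \<le> j \<Longrightarrow> j \<le> m s \<Longrightarrow> 2 * \<theta> s \<le> norm (L ^ j - 1)"
    and sum: "summable (\<lambda>s. ln (1 / \<theta> (Suc s)) / m s)"
  shows "good_divisors L"
proof -
  have L0: "L \<noteq> 0" using L by auto
  note pos = divisor_pos[OF L(2) L0]
  define B where "B = (\<lambda>s. {k. 2 \<le> k \<and> divisor L k < \<theta> s})"
  define w where "w = (\<lambda>s. ln (1 / \<theta> (Suc s)))"
  define w0 where "w0 = ln (1 / \<theta> 0)"
  have w: "0 \<le> w s" for s using \<theta>[of "Suc s"] by (simp add: w_def)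
  have w0: "0 \<le> w0" using \<theta>[of 0] by (simp add: w0_def)
  have B_witness: "\<exists>a\<in>{k - 1, k}. norm (L ^ a - 1) < \<theta> s" if "k \<in> B s" for k s
  proof -
    have "L ^ k - L = L * (L ^ (k - 1) - 1)"
      using that by (simp add: B_def right_diff_distrib power_eq_if)
    hence "norm (L ^ k - L) = norm (L ^ (k - 1) - 1)" using L by (simp add: norm_mult)
    thus ?thesis using that \<theta>(2)[of s] by (auto simp: B_def divisor_def min_def split: if_splits)
  qed
  have B_large: "m s < k" if kB: "k \<in> B s" for k s
  proof (rule ccontr)
    assume "\<not> m s < k"
    moreover obtain a where "a \<in> {k - 1, k}" "norm (L ^ a - 1) < \<theta> s" using B_witness[OF kB] by blast
    moreover have "2 \<le> k" using kB by (simp add: B_def)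
    ultimately have "1 \<le> a" "a \<le> m s" "norm (L ^ a - 1) < \<theta> s" by auto
    thus False using sep[of a s] \<theta>(1)[of s] by linarith
  qed
  have B_gap: "k = Suc j \<or> m s \<le> k - j" if jk: "j \<in> B s" "k \<in> B s" "j < k" for j k s
  proof (rule ccontr)
    assume c: "\<not> (k = Suc j \<or> m s \<le> k - j)"
    obtain a where a: "a \<in> {k - 1, k}" "norm (L ^ a - 1) < \<theta> s" using B_witness[OF jk(2)] by blast
    obtain b where b: "b \<in> {j - 1, j}" "norm (L ^ b - 1) < \<theta> s" using B_witness[OF jk(1)] by blast
    \<comment> \<open>\<open>a - b\<close> differs from \<open>k - j\<close> by at most 1. Excluding
      \<open>k = Suc j\<close> keeps it positive, and \<open>k - j < m s\<close> keeps it in the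
      range of \<open>sep\<close>.\<close>
    have ab: "b < a" "a - b \<le> m s" using a b c jk by (auto simp: B_def)
    have "L ^ a - L ^ b = L ^ b * (L ^ (a - b) - 1)"
      using ab by (simp add: right_diff_distrib flip: power_add)
    hence "norm (L ^ (a - b) - 1) = norm (L ^ a - L ^ b)" using L by (simp add: norm_mult norm_power)
    also have "\<dots> < 2 * \<theta> s" using a b norm_triangle_ineq4[of "L ^ a - 1" "L ^ b - 1"] by simp
    finally have "norm (L ^ (a - b) - 1) < 2 * \<theta> s" .
    moreover have "1 \<le> a - b" using ab by simp
    ultimately show False using sep[of "a - b" s] ab by linarith
  qed
  define M where "M = (\<Sum>s. w s / m s)"
  have sum': "summable (\<lambda>s. w s / m s)" using sum by (simp add: w_def)
  have bound: "split_product (divisor L) k \<le> exp (w0 + 4 * M) ^ k" if "1 \<le> k" for k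
  proof -
    \<comment> \<open>No degree up to \<open>k\<close> belongs to \<open>B S\<close>, so the levels
      below \<open>S\<close> account for all small divisors that occur.\<close>
    obtain S where S: "k \<le> m S" using m by blast
    have far: "\<theta> S \<le> divisor L j" if "2 \<le> j" "j \<le> k" for j
      using B_large[of j S] that S by (force simp: B_def)
    have "split_product (divisor L) k \<le> exp (w0 * real (k - 1) + (\<Sum>s<S. w s * max_split_count (B s) k))"
    proof (rule split_product_le_exp[where K = k])
      fix j assume j: "2 \<le> j" "j \<le> k"
      note pj = pos[OF j(1)]
      show "ln (1 / divisor L j) \<le> w0 + (\<Sum>s<S. w s * of_bool (j \<in> B s))"
      proof (cases "\<exists>s<S. j \<in> B s")
        case False
        have "\<theta> 0 \<le> divisor L j"
          using False far[OF j] j by (cases "S = 0") (force simp: B_def)+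
        hence "ln (1 / divisor L j) \<le> w0"
          unfolding w0_def using \<theta>[of 0] pj by (simp add: ln_div)
        also have "\<dots> \<le> w0 + (\<Sum>s<S. w s * of_bool (j \<in> B s))" using w by (simp add: sum_nonneg)
        finally show ?thesis .
      next
        case True
        \<comment> \<open>Only the last level containing \<open>j\<close> needs to be charged: its
          successor no longer contains \<open>j\<close> and bounds the divisor from below.\<close>
        define s where "s = (GREATEST s. s < S \<and> j \<in> B s)"
        have s: "s < S" "j \<in> B s"
          using GreatestI_ex_nat[of "\<lambda>s. s < S \<and> j \<in> B s" S] True by (auto simp: s_def)
        have smax: "s' \<le> s" if "s' < S" "j \<in> B s'" for s'
          unfolding s_def using that by (intro Greatest_le_nat[where b = S]) auto
        have "\<theta> (Suc s) \<le> divisor L j"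
        proof (cases "Suc s = S")
          case True
          then show ?thesis using far[OF j] by simp
        next
          case False
          hence "j \<notin> B (Suc s)" using smax[of "Suc s"] s by auto
          thus ?thesis using j by (auto simp: B_def)
        qed
        hence "ln (1 / divisor L j) \<le> w s * of_bool (j \<in> B s)"
          using s \<theta>[of "Suc s"] pj by (simp add: w_def ln_div)
        also have "\<dots> \<le> (\<Sum>s<S. w s * of_bool (j \<in> B s))"
          using s w by (intro member_le_sum) auto
        finally show ?thesis using w0 by simp
      qed
    qed (use that w w0 pos in auto)
    also have "(\<Sum>s<S. w s * max_split_count (B s) k) \<le> (\<Sum>s<S. w s * (4 * k / m s))"
      using max_split_count_le'[OF m(1) B_large B_gap] w by (intro sum_mono mult_left_mono) auto
    also have "\<dots> = 4 * k * (\<Sum>s<S. w s / m s)"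
      by (simp add: sum_distrib_left field_simps)
    also have "\<dots> \<le> 4 * k * M"
      unfolding M_def using sum' w by (intro mult_left_mono sum_le_suminf) auto
    also have "w0 * real (k - 1) \<le> w0 * k" using w0 by (intro mult_left_mono) auto
    finally have "split_product (divisor L) k \<le> exp (w0 * k + 4 * k * M)" by simp
    also have "\<dots> = exp (real k * (w0 + 4 * M))" by (simp add: algebra_simps)
    finally show ?thesis by (simp only: exp_of_nat_mult)
  qed
  have M0: "0 \<le> M" unfolding M_def using w sum' by (intro suminf_nonneg) auto
  have "split_product (divisor L) k \<le> exp (w0 + 4 * M) ^ k" for k
    using bound[of k] by (cases "k = 0") (auto simp: split_product.simps)
  thus ?thesis unfolding good_divisors_def using L L0 w0 M0 by (intro conjI exI[of _ "exp (w0 + 4 * M)"]) auto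
qed

section \<open>Bruno numbers\<close>

lemma root_of_unity_power_iff:
  assumes "p > 0"
  shows "root_of_unity (L ^ p) \<longleftrightarrow> root_of_unity L"
  unfolding root_of_unity_def using assms
  by (metis mult.commute nat_0_less_mult_iff power_mult power_one)

lemma Omega_le:
  assumes "2 \<le> k" "k \<le> m"
  shows "Omega lam m \<le> norm (lam ^ k - lam)"
  unfolding Omega_def using assms by (intro Min_le) auto

lemma Omega_pos:
  assumes "\<not> root_of_unity lam" "lam \<noteq> 0" "2 \<le> m"
  shows "0 < Omega lam m"
proof -
  have "norm (lam ^ k - lam) > 0" if "2 \<le> k" for k
    using divisor_pos[OF assms(1,2) that] by (auto simp: divisor_def)
  thus ?thesis unfolding Omega_def using assms(3) by (subst Min_gr_iff) auto
qed

text \<open>From \<open>N\<close> on the partial sums increase, which keeps the extended limit away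
  from -\<infinity>; the other end is excluded by hypothesis.\<close>

lemma sums_ereal_imp_summable:
  fixes f :: "nat \<Rightarrow> real"
  assumes "(\<lambda>k. ereal (f k)) sums s" "s < \<infinity>" "\<And>k. k \<ge> N \<Longrightarrow> 0 \<le> f k"
  shows "summable f"
proof -
  have lim: "(\<lambda>n. ereal (\<Sum>k<n. f k)) \<longlonglongrightarrow> s"
    using assms(1) by (simp add: sums_def)
  have mono: "(\<Sum>k<n. f k) \<le> (\<Sum>k<n'. f k)" if "N \<le> n" "n \<le> n'" for n n'
    using that assms(3) by (intro sum_mono2) auto
  have "ereal (\<Sum>k<n. f k) \<le> s" if "N \<le> n" for n
    using lim mono that by (intro LIMSEQ_le_const[OF lim]) (auto intro!: exI[of _ n])
  hence "ereal (\<Sum>k<N. f k) \<le> s" by simp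
  then obtain S where S: "s = ereal S" using assms(2) by (cases s) auto
  have "f sums S"
    using lim unfolding S sums_def by simp
  thus ?thesis by (rule sums_summable)
qed

lemma norm_power_minus_self:
  fixes L :: complex
  assumes "norm L = 1" "1 \<le> k"
  shows "norm (L ^ k - L) = norm (L ^ (k - 1) - 1)"
proof -
  have "L ^ k - L = L * (L ^ (k - 1) - 1)"
    using assms by (simp add: right_diff_distrib power_eq_if)
  thus ?thesis using assms by (simp add: norm_mult)
qed

text \<open>On the unit circle \<open>lam ^ (p * j) - 1\<close> has the same modulus as
  \<open>lam ^ (p * j + 1) - lam\<close>, which \<open>Omega\<close> controls. So the Bruno sequence
  of \<open>lam\<close>, divided by \<open>p\<close>, serves for \<open>lam ^ p\<close>.\<close>

theorem Bruno_number_power_good_divisors: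
  assumes "Bruno_number lam" and nr: "\<not> root_of_unity lam" and p: "p > 0"
  shows "good_divisors (lam ^ p)"
proof -
  have lam: "norm lam = 1" "lam \<noteq> 0" using assms(1) by (auto simp: Bruno_number_def)
  have L: "norm (lam ^ p) = 1" "\<not> root_of_unity (lam ^ p)" "lam ^ p \<noteq> 0"
    using lam nr p by (auto simp: norm_power root_of_unity_power_iff)
  show ?thesis
  proof (cases "\<exists>k\<ge>1. norm (lam ^ k - 1) < 1 / 2")
    case False
    hence F: "norm (lam ^ k - 1) \<ge> 1 / 2" if "k \<ge> 1" for k using that by force
    show ?thesis
    proof (rule good_divisors_if_bounded_below[where c = "1 / 2"])
      fix k :: nat assume k: "2 \<le> k"
      have "norm ((lam ^ p) ^ k - 1) \<ge> 1 / 2" "norm ((lam ^ p) ^ (k - 1) - 1) \<ge> 1 / 2"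
        using F[of "p * k"] F[of "p * (k - 1)"] k p by (auto simp: power_mult)
      thus "1 / 2 \<le> divisor (lam ^ p) k"
        using norm_power_minus_self[OF L(1), of k] k by (simp add: divisor_def)
    qed (use L in auto)
  next
    case True
    then obtain k0 where k0: "1 \<le> k0" "norm (lam ^ k0 - 1) < 1 / 2" by blast
    obtain q s where q: "1 < q 0" "strict_mono q" and s: "s < \<infinity>"
      "(\<lambda>k. ereal (1 / real (q k)) * log_recip (Omega lam (q (Suc k)))) sums s"
      using assms(1) unfolding Bruno_number_def by blast
    have qge: "k \<le> q k" for k using q(2) by (rule strict_mono_imp_increasing)
    have q2: "2 \<le> q k" for k
      using q(1) strict_mono_mono[OF q(2), THEN monoD, of 0 k] by auto
    have Opos: "0 < Omega lam (q k)" for k using Omega_pos[OF nr lam(2) q2] .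
    define a where "a = (\<lambda>k. 1 / real (q k) * ln (1 / Omega lam (q (Suc k))))"
    \<comment> \<open>From this index on, \<open>q k\<close> is at least \<open>Suc k0\<close>, so
      that \<open>Omega\<close> takes the close return at \<open>k0\<close> into account and is at
      most 1/2. It is also at least \<open>2 * p\<close>, so that rounding in the division by
      \<open>p\<close> loses at most a factor 2.\<close>
    define s0 where "s0 = Suc k0 + 2 * p"
    have Ohalf: "Omega lam (q k) \<le> 1 / 2" if "s0 \<le> k" for k
    proof -
      have "Omega lam (q k) \<le> norm (lam ^ Suc k0 - lam)"
        using that qge[of k] k0 by (intro Omega_le) (auto simp: s0_def)
      also have "\<dots> = norm (lam ^ k0 - 1)" using norm_power_minus_self[OF lam(1), of "Suc k0"] by simp
      finally show ?thesis using k0 by simp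
    qed
    have ln_ge: "ln 2 \<le> ln (1 / Omega lam (q k))" if "s0 \<le> k" for k
    proof (rule ln_mono)
      show "2 \<le> 1 / Omega lam (q k)"
        using Ohalf[OF that] Opos[of k] by (simp add: field_simps)
    qed (use Opos[of k] in simp_all)
    have "(\<lambda>k. ereal (a k)) sums s"
    proof -
      have "ereal (1 / real (q k)) * log_recip (Omega lam (q (Suc k))) = ereal (a k)" for k
        using Opos[of "Suc k"] by (simp add: log_recip_def a_def)
      thus ?thesis using s(2) by simp
    qed
    hence suma: "summable a"
    proof (rule sums_ereal_imp_summable[where N = s0])
      show "0 \<le> a k" if "s0 \<le> k" for k
      proof -
        have "0 \<le> ln (2::real)" by simp
        hence "0 \<le> ln (1 / Omega lam (q (Suc k)))" using ln_ge[of "Suc k"] that by linarith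
        thus ?thesis unfolding a_def by (intro mult_nonneg_nonneg) auto
      qed
    qed (use s in auto)
    \<comment> \<open>\<open>m k\<close> is the largest \<open>j\<close> with
      \<open>p * j + 1 \<le> q (k + s0)\<close>. In \<open>\<theta>\<close> the value of
      \<open>Omega\<close> is halved because the separation hypothesis is about twice the
      threshold.\<close>
    define m where "m = (\<lambda>k. (q (k + s0) - 1) div p)"
    define \<theta> where "\<theta> = (\<lambda>k. Omega lam (q (k + s0)) / 2)"
    have qp: "2 * p \<le> q (k + s0)" for k using qge[of "k + s0"] by (simp add: s0_def)
    have m_ge: "real (q (k + s0)) \<le> 2 * p * real (m k)" for k
    proof -
      have "q (k + s0) - 1 < p + p * m k"
        unfolding m_def using p by (rule dividend_less_times_div)
      hence "q (k + s0) \<le> p * m k + p" using q2[of "k + s0"] by simp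
      hence "q (k + s0) \<le> 2 * (p * m k)" using qp[of k] by linarith
      thus ?thesis by (metis mult.assoc of_nat_le_iff of_nat_mult of_nat_numeral)
    qed
    show ?thesis
    proof (rule good_divisors_criterion[OF L(1,2), of \<theta> m])
      show "0 < \<theta> k" for k using Opos by (simp add: \<theta>_def)
      show "\<theta> k \<le> 1" for k using Ohalf[of "k + s0"] by (simp add: \<theta>_def)
      show "1 \<le> m k" for k
      proof -
        have "m k \<noteq> 0" using m_ge[of k] q2[of "k + s0"] by (auto intro!: gr0I)
        thus ?thesis by simp
      qed
      show "\<exists>k. K \<le> m k" for K
      proof
        have "K * p \<le> q (K * p + 1 + s0) - 1" using qge[of "K * p + 1 + s0"] by simp
        thus "K \<le> m (K * p + 1)" unfolding m_def using p by (metis div_le_mono nonzero_mult_div_cancel_right neq0_conv)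
      qed
      show "2 * \<theta> k \<le> norm ((lam ^ p) ^ j - 1)" if "1 \<le> j" "j \<le> m k" for k j
      proof -
        have "j * p \<le> q (k + s0) - 1"
          using that(2) unfolding m_def using p by (metis less_eq_div_iff_mult_less_eq)
        hence "Omega lam (q (k + s0)) \<le> norm (lam ^ Suc (p * j) - lam)"
          using that p q2[of "k + s0"] by (intro Omega_le) (auto simp: mult.commute)
        also have "\<dots> = norm (lam ^ (p * j) - 1)"
          using norm_power_minus_self[OF lam(1), of "Suc (p * j)"] by simp
        finally show ?thesis by (simp add: \<theta>_def power_mult)
      qed
      show "summable (\<lambda>k. ln (1 / \<theta> (Suc k)) / real (m k))"
      proof (rule summable_comparison_test)
        \<comment> \<open>Of the factor \<open>4 * p\<close>, the part \<open>2 * p\<close> comes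
          from \<open>m_ge\<close>, and 2 from ln 2 + X \<le> 2 X, where X is the logarithm of
          \<open>1 / Omega\<close>.\<close>
        show "summable (\<lambda>k. 4 * p * a (k + s0))"
          using suma by (intro summable_mult) (simp add: summable_iff_shift)
        show "\<exists>N. \<forall>n\<ge>N. norm (ln (1 / \<theta> (Suc n)) / real (m n)) \<le> 4 * p * a (n + s0)"
        proof (intro exI[of _ 0] allI impI)
          fix k
          define X where "X = ln (1 / Omega lam (q (Suc (k + s0))))"
          have X: "ln 2 \<le> X" using ln_ge[of "Suc (k + s0)"] by (simp add: X_def)
          have X0: "0 \<le> X" using X ln_gt_zero[of 2] by linarith
          have "ln (1 / \<theta> (Suc k)) = ln 2 + X"
            using Opos[of "Suc (k + s0)"] by (simp add: \<theta>_def X_def ln_div ln_mult)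
          hence 1: "0 \<le> ln (1 / \<theta> (Suc k))" "ln (1 / \<theta> (Suc k)) \<le> 2 * X" using X X0 by auto
          have mk: "real (m k) > 0" using m_ge[of k] q2[of "k + s0"] p
            by (metis gr0I le_zero_eq mult_zero_right of_nat_0 of_nat_0_less_iff of_nat_le_0_iff zero_neq_numeral)
          have "norm (ln (1 / \<theta> (Suc k)) / real (m k)) = ln (1 / \<theta> (Suc k)) / real (m k)"
            using 1 by simp
          also have "\<dots> \<le> 2 * X / real (m k)"
            using 1 by (intro divide_right_mono) auto
          also have "\<dots> \<le> 4 * p * (1 / real (q (k + s0)) * X)"
          proof -
            have "X * real (q (k + s0)) \<le> X * (2 * p * real (m k))" using m_ge[of k] X0 by (intro mult_left_mono) auto
            moreover have "real (q (k + s0)) > 0" using q2[of "k + s0"] by simp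
            ultimately show ?thesis using mk by (simp add: field_simps)
          qed
          finally show "norm (ln (1 / \<theta> (Suc k)) / real (m k)) \<le> 4 * p * a (k + s0)"
            by (simp add: a_def X_def)
        qed
      qed
    qed
  qed
qed

section \<open>Connected sets of multipliers and the density of the powers of a Bruno number\<close>

lemma good_divisors_cnj:
  assumes "good_divisors L"
  shows "good_divisors (cnj L)"
proof -
  have "divisor (cnj L) = divisor L"
  proof
    fix k
    have "norm (cnj L ^ k - cnj L) = norm (L ^ k - L)" "norm (cnj L ^ k - 1) = norm (L ^ k - 1)"
      by (metis complex_cnj_diff complex_cnj_power complex_mod_cnj complex_cnj_one)+
    thus "divisor (cnj L) k = divisor L k" by (simp add: divisor_def)
  qed
  moreover have "root_of_unity (cnj L) \<longleftrightarrow> root_of_unity L"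
    unfolding root_of_unity_def by (metis complex_cnj_cnj complex_cnj_one complex_cnj_power)
  ultimately show ?thesis using assms by (simp add: good_divisors_def)
qed

lemma exists_power_Re_between:
  assumes lam: "norm lam = 1" "\<not> root_of_unity lam" and ab: "-1 \<le> a" "a < b" "b \<le> 1"
  obtains p where "0 < p" "a < Re (lam ^ p)" "Re (lam ^ p) < b"
proof -
  define \<theta> where "\<theta> = Arg lam / (2 * pi)"
  have "lam \<noteq> 0" using lam(1) by auto
  hence lam\<theta>: "lam = cis (2 * pi * \<theta>)" using lam(1) by (simp add: \<theta>_def cis_Arg sgn_div_norm)
  have "\<theta> \<notin> \<rat>"
  proof
    assume "\<theta> \<in> \<rat>"
    then obtain m n :: int where mn: "n > 0" "\<theta> = of_int m / of_int n" by (rule Rats_cases')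
    have "lam ^ nat n = cis (2 * pi * of_int m)"
      using mn by (simp add: lam\<theta> Complex.DeMoivre mult_ac)
    hence "lam ^ nat n = 1" by (simp add: cis_multiple_2pi)
    thus False using lam(2) mn(1) unfolding root_of_unity_def by (metis zero_less_nat_eq)
  qed
  define t where "t = arccos ((a + b) / 2)"
  have t: "0 \<le> t" "t \<le> pi" "cos t = (a + b) / 2"
    using ab by (simp_all add: t_def arccos_lbound arccos_ubound)
  have "0 < (b - a) / 2" using ab by simp
  then obtain d where d: "0 < d" "\<And>x. \<bar>x - t\<bar> < d \<Longrightarrow> \<bar>cos x - cos t\<bar> < (b - a) / 2"
    using isCont_cos[of t] unfolding continuous_at_eps_delta dist_real_def by meson
  have "0 \<le> t / (2 * pi)" "t / (2 * pi) \<le> 1" "0 < d / (2 * pi)" using t(1,2) d(1) by (simp_all add: field_simps)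
  then obtain p where p: "0 < p" "\<bar>frac (real p * \<theta>) - t / (2 * pi)\<bar> < d / (2 * pi)"
    by (rule Kronecker_approx_1_explicit[OF \<open>\<theta> \<notin> \<rat>\<close>])
  have "2 * pi * frac (real p * \<theta>) - t = (frac (real p * \<theta>) - t / (2 * pi)) * (2 * pi)" by (simp add: field_simps)
  hence "\<bar>2 * pi * frac (real p * \<theta>) - t\<bar> = \<bar>frac (real p * \<theta>) - t / (2 * pi)\<bar> * (2 * pi)" by (simp add: abs_mult)
  also have "\<dots> < d" using p(2) by (simp add: field_simps)
  finally have "\<bar>cos (2 * pi * frac (real p * \<theta>)) - cos t\<bar> < (b - a) / 2" by (rule d(2))
  moreover have "lam ^ p = cis (2 * pi * frac (real p * \<theta>)) * cis (2 * pi * of_int \<lfloor>real p * \<theta>\<rfloor>)"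
    by (simp add: lam\<theta> Complex.DeMoivre cis_mult frac_def algebra_simps)
  hence "Re (lam ^ p) = cos (2 * pi * frac (real p * \<theta>))" by (simp add: cis_multiple_2pi)
  ultimately have "a < Re (lam ^ p)" "Re (lam ^ p) < b" using t(3) by (simp_all add: abs_less_iff field_simps)
  thus ?thesis using that p(1) by blast
qed

text \<open>The real parts of \<open>S\<close> form an interval. If it were nondegenerate, it would
  contain the real part of some power \<open>lam ^ p\<close>, and then \<open>S\<close> would
  contain that power or its conjugate, both of which have good divisors. So the real part is
  constant, \<open>S\<close> has at most two points, and connectedness leaves one.\<close>

lemma connected_bad_multipliers:
  assumes lam: "Bruno_number lam" "\<not> root_of_unity lam"
    and S: "connected S" and bad: "\<And>z. z \<in> S \<Longrightarrow> root_of_unity z \<or> norm z = 1 \<and> \<not> good_divisors z"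
    and uv: "u \<in> S" "v \<in> S"
  shows "u = v"
proof -
  have n1: "norm z = 1" if "z \<in> S" for z
    using bad[OF that]
  proof
    assume "root_of_unity z"
    then obtain n where "n > 0" "z ^ n = 1" by (auto simp: root_of_unity_def)
    hence "norm z ^ n = 1 ^ n" "n > 0" by (simp_all flip: norm_power)
    thus ?thesis by (metis norm_ge_zero power_eq_imp_eq_base zero_le_one)
  qed simp
  have ng: "\<not> good_divisors z" if "z \<in> S" for z
    using bad[OF that] by (auto simp: good_divisors_def)
  have Re_le: "\<not> Re x < Re y" if xy: "x \<in> S" "y \<in> S" for x y
  proof
    assume "Re x < Re y"
    moreover have "-1 \<le> Re x" "Re y \<le> 1"
      using n1 xy abs_Re_le_cmod[of x] abs_Re_le_cmod[of y] by auto
    moreover have n: "norm lam = 1" using lam(1) by (simp add: Bruno_number_def)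
    ultimately obtain p where p: "0 < p" "Re x < Re (lam ^ p)" "Re (lam ^ p) < Re y"
      using exists_power_Re_between[OF _ lam(2)] \<open>Re x < Re y\<close> by metis
    define L where "L = lam ^ p"
    have L: "good_divisors L" "norm L = 1" "Re x < Re L" "Re L < Re y"
      using p n Bruno_number_power_good_divisors[OF lam p(1)] by (simp_all add: L_def norm_power)
    have "connected (Re ` S)" using S by (intro connected_continuous_image continuous_intros)
    hence "Re L \<in> Re ` S" using connectedD_interval[of "Re ` S" "Re x" "Re y" "Re L"] xy L by auto
    then obtain z where z: "z \<in> S" "Re z = Re L" by auto
    have "(Im z)\<^sup>2 = (Im L)\<^sup>2" using n1[OF z(1)] L(2) z(2) by (simp add: cmod_def)
    hence "z = L \<or> z = cnj L" using z(2) by (auto simp: complex_eq_iff power2_eq_iff)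
    thus False using ng[OF z(1)] L(1) good_divisors_cnj by blast
  qed
  have "S \<subseteq> {u, cnj u}"
  proof
    fix z assume z: "z \<in> S"
    have "Re z = Re u" using Re_le[of z u] Re_le[of u z] z uv by linarith
    moreover have "(Im z)\<^sup>2 = (Im u)\<^sup>2" using n1[OF z] n1[OF uv(1)] \<open>Re z = Re u\<close> by (simp add: cmod_def)
    ultimately show "z \<in> {u, cnj u}" by (auto simp: complex_eq_iff power2_eq_iff)
  qed
  hence "finite S" by (rule finite_subset) auto
  hence "S = {} \<or> (\<exists>x. S = {x})" using S connected_finite_iff_sing by blast
  thus ?thesis using uv by auto
qed

section \<open>The formal invariant curve\<close>

text \<open>Composition with the nonlinear part of a double power series. For \<open>X\<close> and
  \<open>Y\<close> without constant term, monomials with \<open>i\<close> or \<open>j\<close> beyond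
  \<open>N\<close> do not reach the coefficients up to \<open>N\<close>, so the truncation does not
  affect those.\<close>

definition poly_subst :: "(nat \<Rightarrow> nat \<Rightarrow> 'a::idom) \<Rightarrow> nat \<Rightarrow> 'a poly \<Rightarrow> 'a poly \<Rightarrow> 'a poly" where
  "poly_subst c N X Y = (\<Sum>i\<le>N. \<Sum>j\<le>N. if 2 \<le> i + j then smult (c i j) (X ^ i * Y ^ j) else 0)"

definition agree_below :: "nat \<Rightarrow> 'a::comm_ring_1 poly \<Rightarrow> 'a poly \<Rightarrow> bool" where
  "agree_below k A B \<longleftrightarrow> (\<forall>n<k. coeff A n = coeff B n)"

lemma agree_below_refl [simp]: "agree_below k A A"
  by (simp add: agree_below_def)

lemma agree_below_mult:
  assumes "agree_below k A A'" "agree_below k B B'"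
  shows "agree_below k (A * B) (A' * B')"
  using assms unfolding agree_below_def coeff_mult by (auto intro!: sum.cong)

text \<open>Without constant terms, the top coefficient of a product involves only smaller degrees.
  This gain of one degree is what makes the recursion for the curve possible: the nonlinear part in
  degree \<open>k\<close> depends on coefficients below \<open>k\<close>.\<close>

lemma agree_below_mult_Suc:
  assumes "agree_below k A A'" "agree_below k B B'"
    "coeff A 0 = 0" "coeff A' 0 = 0" "coeff B 0 = 0" "coeff B' 0 = 0"
  shows "agree_below (Suc k) (A * B) (A' * B')"
  unfolding agree_below_def coeff_mult
proof (intro allI impI sum.cong)
  fix n i assume n: "n < Suc k" "i \<in> {..n}"
  show "coeff A i * coeff B (n - i) = coeff A' i * coeff B' (n - i)"
  proof (cases "i = 0 \<or> i = n")
    case True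
    then show ?thesis using assms by auto
  next
    case False
    then show ?thesis using assms(1,2) n unfolding agree_below_def by auto
  qed
qed simp

lemma agree_below_power:
  "agree_below k A A' \<Longrightarrow> agree_below k (A ^ i) (A' ^ i)"
  by (induction i) (auto intro: agree_below_mult)

lemma agree_below_monomial:
  assumes "agree_below k X X'" "agree_below k Y Y'" "2 \<le> i + j"
    "coeff X 0 = 0" "coeff X' 0 = 0" "coeff Y 0 = 0" "coeff Y' 0 = 0"
  shows "agree_below (Suc k) (X ^ i * Y ^ j) (X' ^ i * Y' ^ j)"
proof (cases i)
  case 0
  then obtain j' where j: "j = Suc j'" "j' \<noteq> 0" using assms(3) by (cases j) auto
  have "agree_below (Suc k) (Y * Y ^ j') (Y' * Y' ^ j')"
    using assms j by (intro agree_below_mult_Suc agree_below_power) (auto simp: coeff_0_power power_0_left)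
  thus ?thesis using 0 j by simp
next
  case (Suc i')
  have "agree_below (Suc k) (X * (X ^ i' * Y ^ j)) (X' * (X' ^ i' * Y' ^ j))"
    using assms Suc
    by (intro agree_below_mult_Suc agree_below_mult agree_below_power)
      (auto simp: coeff_0_power coeff_mult zero_power power_0_left)
  thus ?thesis using Suc by (simp add: mult.assoc)
qed

lemma coeff_monomial_eq_0:
  fixes X Y :: "'a::idom poly"
  assumes "coeff X 0 = 0" "coeff Y 0 = 0" "k < i + j"
  shows "coeff (X ^ i * Y ^ j) k = 0"
proof -
  have X: "[:0, 1:] dvd X" "[:0, 1:] dvd Y" using assms poly_eq_0_iff_dvd[of X 0] poly_eq_0_iff_dvd[of Y 0] by (simp_all add: poly_0_coeff_0)
  have "monom 1 (i + j) = [:0, 1:] ^ i * ([:0, 1:] ^ j :: 'a poly)" by (simp add: monom_altdef power_add)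
  also have "\<dots> dvd X ^ i * Y ^ j" using X by (intro mult_dvd_mono dvd_power_same)
  finally show ?thesis using assms(3) unfolding monom_1_dvd_iff' by blast
qed

text \<open>The coefficient depends neither on the truncation nor on the coefficients of
  \<open>X\<close> and \<open>Y\<close> from degree \<open>k\<close> on, so the equation solved when
  degree \<open>k\<close> is added remains true for all later Taylor polynomials.\<close>

lemma coeff_poly_subst_cong:
  fixes X Y :: "'a::idom poly"
  assumes "agree_below k X X'" "agree_below k Y Y'" "k \<le> N" "k \<le> N'"
    "coeff X 0 = 0" "coeff X' 0 = 0" "coeff Y 0 = 0" "coeff Y' 0 = 0"
  shows "coeff (poly_subst c N X Y) k = coeff (poly_subst c N' X' Y') k"
proof -
  have "coeff (poly_subst c N X Y) k = (\<Sum>i\<le>k. \<Sum>j\<le>k. if 2 \<le> i + j then c i j * coeff (X' ^ i * Y' ^ j) k else 0)"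
    if "k \<le> N" and ag: "agree_below k X X'" "agree_below k Y Y'" "coeff X 0 = 0" "coeff Y 0 = 0" for N X Y
  proof -
    have "coeff (poly_subst c N X Y) k = (\<Sum>i\<le>N. \<Sum>j\<le>N. if 2 \<le> i + j then c i j * coeff (X ^ i * Y ^ j) k else 0)"
      by (simp add: poly_subst_def coeff_sum if_distrib[of "\<lambda>p. coeff p k"] cong: if_cong)
    also have "\<dots> = (\<Sum>i\<le>N. \<Sum>j\<le>k. if 2 \<le> i + j then c i j * coeff (X ^ i * Y ^ j) k else 0)"
      using that coeff_monomial_eq_0[of X Y k]
      by (intro sum.cong refl sum.mono_neutral_right) auto
    also have "\<dots> = (\<Sum>i\<le>k. \<Sum>j\<le>k. if 2 \<le> i + j then c i j * coeff (X ^ i * Y ^ j) k else 0)"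
      using that coeff_monomial_eq_0[of X Y k]
      by (intro sum.mono_neutral_right) (auto intro!: sum.neutral)
    also have "\<dots> = (\<Sum>i\<le>k. \<Sum>j\<le>k. if 2 \<le> i + j then c i j * coeff (X' ^ i * Y' ^ j) k else 0)"
      using agree_below_monomial[OF ag(1,2)] ag assms
      by (intro sum.cong refl) (auto simp: agree_below_def)
    finally show ?thesis .
  qed
  from this[of N X Y] this[of N' X' Y'] show ?thesis using assms by auto
qed

text \<open>The Taylor polynomials of the curve \<open>\<phi>\<close> with \<open>G(\<phi>(z)) = \<phi>(L z)\<close>, where \<open>G\<close> has linear part \<open>(L x, y)\<close>
  and nonlinear coefficients \<open>c\<close> and \<open>d\<close> in its two components.\<close>

fun curve_poly :: "complex \<Rightarrow> (nat \<Rightarrow> nat \<Rightarrow> complex) \<Rightarrow> (nat \<Rightarrow> nat \<Rightarrow> complex) \<Rightarrow> nat \<Rightarrow> complex poly \<times> complex poly" where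
  "curve_poly L c d 0 = (0, 0)"
| "curve_poly L c d (Suc 0) = (monom 1 1, 0)"
| "curve_poly L c d (Suc (Suc n)) =
     (let (X, Y) = curve_poly L c d (Suc n); k = Suc (Suc n) in
       (X + monom (coeff (poly_subst c k X Y) k / (L ^ k - L)) k,
        Y + monom (coeff (poly_subst d k X Y) k / (L ^ k - 1)) k))"

definition "curve_x L c d n = coeff (fst (curve_poly L c d n)) n"
definition "curve_y L c d n = coeff (snd (curve_poly L c d n)) n"

lemma curve_poly_Suc:
  assumes "1 \<le> n"
  shows "fst (curve_poly L c d (Suc n)) = fst (curve_poly L c d n) +
       monom (coeff (poly_subst c (Suc n) (fst (curve_poly L c d n)) (snd (curve_poly L c d n))) (Suc n) / (L ^ Suc n - L)) (Suc n)"
   and "snd (curve_poly L c d (Suc n)) = snd (curve_poly L c d n) +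
       monom (coeff (poly_subst d (Suc n) (fst (curve_poly L c d n)) (snd (curve_poly L c d n))) (Suc n) / (L ^ Suc n - 1)) (Suc n)"
  using assms by (cases n; simp add: Let_def case_prod_unfold)+

lemma coeff_curve_poly:
  "coeff (fst (curve_poly L c d N)) n = (if n \<le> N then curve_x L c d n else 0)"
  "coeff (snd (curve_poly L c d N)) n = (if n \<le> N then curve_y L c d n else 0)"
proof -
  have "coeff (fst (curve_poly L c d N)) n = (if n \<le> N then curve_x L c d n else 0) \<and>
     coeff (snd (curve_poly L c d N)) n = (if n \<le> N then curve_y L c d n else 0)"
  proof (induction N)
    case 0
    then show ?case by (auto simp: curve_x_def curve_y_def)
  next
    case (Suc N)
    show ?case
    proof (cases "n = Suc N")
      case True
      then show ?thesis by (simp add: curve_x_def curve_y_def)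
    next
      case False
      show ?thesis
      proof (cases "N = 0")
        case True
        then show ?thesis using False by (cases n) (auto simp: curve_x_def curve_y_def)
      next
        case False': False
        hence "1 \<le> N" by simp
        from curve_poly_Suc[OF this] Suc False show ?thesis by auto
      qed
    qed
  qed
  thus "coeff (fst (curve_poly L c d N)) n = (if n \<le> N then curve_x L c d n else 0)"
    "coeff (snd (curve_poly L c d N)) n = (if n \<le> N then curve_y L c d n else 0)" by auto
qed

lemma curve_0 [simp]: "curve_x L c d 0 = 0" "curve_y L c d 0 = 0"
  by (simp_all add: curve_x_def curve_y_def)

lemma curve_1 [simp]: "curve_x L c d (Suc 0) = 1" "curve_y L c d (Suc 0) = 0"
  by (simp_all add: curve_x_def curve_y_def)

lemma curve_recurrence:
  assumes "2 \<le> k"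
  shows "curve_x L c d k = coeff (poly_subst c k (fst (curve_poly L c d (k - 1))) (snd (curve_poly L c d (k - 1)))) k / (L ^ k - L)"
    and "curve_y L c d k = coeff (poly_subst d k (fst (curve_poly L c d (k - 1))) (snd (curve_poly L c d (k - 1)))) k / (L ^ k - 1)"
proof -
  have k: "k = Suc (k - 1)" "1 \<le> k - 1" using assms by auto
  show "curve_x L c d k = coeff (poly_subst c k (fst (curve_poly L c d (k - 1))) (snd (curve_poly L c d (k - 1)))) k / (L ^ k - L)"
    unfolding curve_x_def
    by (subst k(1), subst curve_poly_Suc[OF k(2)]) (use k in \<open>auto simp: coeff_curve_poly\<close>)
  show "curve_y L c d k = coeff (poly_subst d k (fst (curve_poly L c d (k - 1))) (snd (curve_poly L c d (k - 1)))) k / (L ^ k - 1)"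
    unfolding curve_y_def
    by (subst k(1), subst curve_poly_Suc[OF k(2)]) (use k in \<open>auto simp: coeff_curve_poly\<close>)
qed

lemma curve_functional_equation:
  assumes "2 \<le> k" "k \<le> N" "L ^ k \<noteq> L" "L ^ k \<noteq> 1"
  shows "coeff (poly_subst c N (fst (curve_poly L c d N)) (snd (curve_poly L c d N))) k = (L ^ k - L) * curve_x L c d k"
    and "coeff (poly_subst d N (fst (curve_poly L c d N)) (snd (curve_poly L c d N))) k = (L ^ k - 1) * curve_y L c d k"
proof -
  have "coeff (poly_subst e N (fst (curve_poly L c d N)) (snd (curve_poly L c d N))) k
      = coeff (poly_subst e k (fst (curve_poly L c d (k - 1))) (snd (curve_poly L c d (k - 1)))) k" for e
    using assms by (intro coeff_poly_subst_cong) (auto simp: agree_below_def coeff_curve_poly)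
  thus "coeff (poly_subst c N (fst (curve_poly L c d N)) (snd (curve_poly L c d N))) k = (L ^ k - L) * curve_x L c d k"
    "coeff (poly_subst d N (fst (curve_poly L c d N)) (snd (curve_poly L c d N))) k = (L ^ k - 1) * curve_y L c d k"
    using curve_recurrence[OF assms(1), of L c d] assms by auto
qed

section \<open>Majorants for the coefficients of the invariant curve\<close>

lemma coeff_mult_nonneg:
  fixes A B :: "real poly"
  assumes "\<And>n. 0 \<le> coeff A n" "\<And>n. 0 \<le> coeff B n"
  shows "0 \<le> coeff (A * B) n"
  unfolding coeff_mult using assms by (intro sum_nonneg mult_nonneg_nonneg) auto

lemma coeff_power_nonneg:
  fixes A :: "real poly"
  assumes "\<And>n. 0 \<le> coeff A n"
  shows "0 \<le> coeff (A ^ k) n"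
  using assms by (induction k arbitrary: n) (auto intro: coeff_mult_nonneg simp: coeff_1)

lemma coeff_power_mono:
  fixes A B :: "real poly"
  assumes "\<And>n. 0 \<le> coeff A n" "\<And>n. coeff A n \<le> coeff B n"
  shows "coeff (A ^ k) n \<le> coeff (B ^ k) n"
proof (induction k arbitrary: n)
  case (Suc k)
  have B: "0 \<le> coeff B n" for n using assms[of n] by linarith
  show ?case
    unfolding power_Suc coeff_mult using assms Suc B coeff_power_nonneg[OF assms(1)]
    by (intro sum_mono mult_mono) auto
qed simp

lemma sum_coeff_le_poly:
  fixes A :: "real poly"
  assumes "\<And>n. 0 \<le> coeff A n" "0 \<le> x"
  shows "(\<Sum>k\<le>K. coeff A k * x ^ k) \<le> poly A x"
proof -
  have "(\<Sum>k\<le>K. coeff A k * x ^ k) \<le> (\<Sum>k\<le>max K (degree A). coeff A k * x ^ k)"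
    using assms by (intro sum_mono2) auto
  also have "\<dots> = (\<Sum>k\<le>degree A. coeff A k * x ^ k)"
    by (intro sum.mono_neutral_right) (auto simp: coeff_eq_0)
  finally show ?thesis by (simp add: poly_altdef)
qed

locale divisor_sequence =
  fixes e :: "nat \<Rightarrow> real"
  assumes pos: "\<And>k. 2 \<le> k \<Longrightarrow> 0 < e k" and le_1: "\<And>k. 2 \<le> k \<Longrightarrow> e k \<le> 1"
begin

abbreviation "\<delta> \<equiv> split_product e"

lemma \<delta>_pos: "0 < \<delta> k"
  using split_product_pos[of e k] pos by auto

text \<open>A majorant relation with the small divisor products factored out, so that
  \<open>S\<close> can satisfy a recursion free of small divisors. The vanishing constant terms
  ensure that a product of two such polynomials pairs degrees of at least 1 only.\<close>

definition dominated :: "complex poly \<Rightarrow> real poly \<Rightarrow> bool" where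
  "dominated A S \<longleftrightarrow> coeff A 0 = 0 \<and> coeff S 0 = 0 \<and> (\<forall>n. 0 \<le> coeff S n \<and> norm (coeff A n) \<le> \<delta> n * coeff S n)"

text \<open>Two coefficients of degrees \<open>i\<close> and \<open>n - i\<close> cost
  \<open>\<delta> i * \<delta> (n - i)\<close>, which is at most \<open>e n * \<delta> n\<close>.
  The spare factor \<open>e n\<close> later cancels the division by the divisor of degree
  \<open>n\<close>.\<close>

lemma dominated_mult_strong:
  assumes "dominated A S" "dominated B U"
  shows "norm (coeff (A * B) n) \<le> e n * \<delta> n * coeff (S * U) n"
proof -
  have "norm (coeff (A * B) n) \<le> (\<Sum>i\<le>n. norm (coeff A i * coeff B (n - i)))"
    unfolding coeff_mult by (rule norm_sum)
  also have "\<dots> \<le> (\<Sum>i\<le>n. e n * \<delta> n * (coeff S i * coeff U (n - i)))"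
  proof (rule sum_mono)
    fix i assume "i \<in> {..n}"
    show "norm (coeff A i * coeff B (n - i)) \<le> e n * \<delta> n * (coeff S i * coeff U (n - i))"
    proof (cases "i = 0 \<or> i = n")
      case True
      then show ?thesis using assms by (auto simp: dominated_def)
    next
      case False
      hence i: "1 \<le> i" "1 \<le> n - i" "i + (n - i) = n" using \<open>i \<in> {..n}\<close> by auto
      have "norm (coeff A i * coeff B (n - i)) \<le> (\<delta> i * coeff S i) * (\<delta> (n - i) * coeff U (n - i))"
        unfolding norm_mult using assms \<delta>_pos[of i]
        by (intro mult_mono) (auto simp: dominated_def less_imp_le)
      also have "\<dots> = (\<delta> i * \<delta> (n - i)) * (coeff S i * coeff U (n - i))" by (simp add: mult_ac)
      also have "\<dots> \<le> (e n * \<delta> n) * (coeff S i * coeff U (n - i))"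
        using split_product_superadditive(1)[OF pos le_1 i(1,2)] assms i(3)
        by (intro mult_right_mono mult_nonneg_nonneg) (auto simp: dominated_def)
      finally show ?thesis .
    qed
  qed
  finally show ?thesis by (simp add: coeff_mult sum_distrib_left)
qed

lemma dominated_mult:
  assumes "dominated A S" "dominated B U"
  shows "dominated (A * B) (S * U)"
proof -
  have 0: "0 \<le> coeff (S * U) n" for n
    using assms by (intro coeff_mult_nonneg) (auto simp: dominated_def)
  have "norm (coeff (A * B) n) \<le> \<delta> n * coeff (S * U) n" for n
  proof (cases "2 \<le> n")
    case True
    have "e n * (\<delta> n * coeff (S * U) n) \<le> 1 * (\<delta> n * coeff (S * U) n)"
      using True le_1 \<delta>_pos[of n] 0[of n] by (intro mult_right_mono) auto
    then show ?thesis using dominated_mult_strong[OF assms, of n] by (simp add: mult.assoc)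
  next
    case False
    hence "n = 0 \<or> n = 1" by auto
    hence "coeff (A * B) n = 0"
      using assms by (auto simp: dominated_def coeff_mult)
    then show ?thesis using 0[of n] \<delta>_pos[of n] by simp
  qed
  thus ?thesis using 0 assms by (auto simp: dominated_def coeff_mult)
qed

lemma dominated_power:
  assumes "dominated A S" "1 \<le> k"
  shows "dominated (A ^ k) (S ^ k)"
  using assms(2) by (induction k rule: dec_induct) (use assms(1) in \<open>auto intro: dominated_mult\<close>)

lemma dominated_monomial:
  assumes "dominated X T" "dominated Y T" "1 \<le> i + j"
  shows "dominated (X ^ i * Y ^ j) (T ^ (i + j))"
proof (cases "i = 0 \<or> j = 0")
  case True
  then show ?thesis using dominated_power assms by fastforce
next
  case False
  then show ?thesis using dominated_power assms by (auto simp: power_add intro!: dominated_mult)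
qed

lemma dominated_monomial_strong:
  assumes "dominated X T" "dominated Y T" "2 \<le> i + j"
  shows "norm (coeff (X ^ i * Y ^ j) n) \<le> e n * \<delta> n * coeff (T ^ (i + j)) n"
proof (cases i)
  case 0
  then obtain j' where "j = Suc j'" "1 \<le> j'" using assms(3) by (cases j) auto
  then show ?thesis using dominated_mult_strong[OF assms(2) dominated_power[OF assms(2)]] 0 by simp
next
  case (Suc i')
  then show ?thesis
    using dominated_mult_strong[OF assms(1) dominated_monomial[OF assms(1,2), of i' j], of n] assms(3)
    by (simp add: mult_ac)
qed

end

lemma sum_half_powers_le: "(\<Sum>i\<le>K. (1 / 2 :: real) ^ i) \<le> 2"
proof -
  have "(\<Sum>i\<le>K. (1 / 2 :: real) ^ i) \<le> (\<Sum>i. (1 / 2 :: real) ^ i)"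
    by (intro sum_le_suminf summable_geometric) auto
  thus ?thesis by (simp add: suminf_geometric)
qed

lemma sum_square_powers_le:
  fixes q :: real
  assumes "0 \<le> q" "q \<le> 1 / 2"
  shows "(\<Sum>i\<le>K. \<Sum>j\<le>K. if 2 \<le> i + j then q ^ (i + j) else 0) \<le> 16 * q\<^sup>2"
proof -
  have "(\<Sum>i\<le>K. \<Sum>j\<le>K. if 2 \<le> i + j then q ^ (i + j) else 0)
      \<le> (\<Sum>i\<le>K. \<Sum>j\<le>K. 4 * q\<^sup>2 * ((1 / 2) ^ i * (1 / 2) ^ j))"
  proof (intro sum_mono)
    fix i j :: nat
    show "(if 2 \<le> i + j then q ^ (i + j) else 0) \<le> 4 * q\<^sup>2 * ((1 / 2) ^ i * (1 / 2) ^ j)"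
    proof (cases "2 \<le> i + j")
      case True
      then obtain k where k: "i + j = k + 2" by (metis add.commute le_Suc_ex)
      have "q ^ k * q\<^sup>2 \<le> (1 / 2) ^ k * q\<^sup>2" using assms by (intro mult_right_mono power_mono) auto
      also have "\<dots> = 4 * q\<^sup>2 * (1 / 2) ^ (i + j)" unfolding k by (simp add: power_add power2_eq_square)
      finally have "q ^ (i + j) \<le> 4 * q\<^sup>2 * (1 / 2) ^ (i + j)" unfolding k power_add .
      thus ?thesis using True by (simp add: power_add)
    qed auto
  qed
  also have "\<dots> = 4 * q\<^sup>2 * ((\<Sum>i\<le>K. (1 / 2) ^ i) * (\<Sum>j\<le>K. (1 / 2) ^ j))"
    unfolding sum_product by (simp only: sum_distrib_left)
  also have "\<dots> \<le> 4 * q\<^sup>2 * (2 * 2)"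
    using sum_half_powers_le[of K] by (intro mult_left_mono mult_mono) (auto intro: sum_nonneg)
  finally show ?thesis by simp
qed

text \<open>Dividing the coefficients by \<open>split_product (divisor L)\<close> removes the small
  divisors: the quotients \<open>a\<close> obey the recursive inequality that belongs to the
  geometric coefficients \<open>M / r ^ (i + j)\<close> alone. Their partial sums at a small radius
  are bounded by induction on the degree, without solving the majorant equation.\<close>

lemma curve_coefficients_bound:
  fixes c d :: "nat \<Rightarrow> nat \<Rightarrow> complex" and M r :: real
  assumes L: "\<not> root_of_unity L" "L \<noteq> 0" and M: "0 \<le> M" and r: "0 < r"
    and c: "\<And>i j. norm (c i j) \<le> M / r ^ (i + j)" and d: "\<And>i j. norm (d i j) \<le> M / r ^ (i + j)"
  shows "\<exists>B\<ge>1. \<forall>n. norm (curve_x L c d n) \<le> split_product (divisor L) n * B ^ n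
                  \<and> norm (curve_y L c d n) \<le> split_product (divisor L) n * B ^ n"
proof -
  interpret divisor_sequence "divisor L"
    using divisor_pos[OF L] divisor_le_1 by unfold_locales auto
  define x y where "x = curve_x L c d" and "y = curve_y L c d"
  define a where "a = (\<lambda>n. max (norm (x n)) (norm (y n)) / \<delta> n)"
  have a0: "a 0 = 0" "a (Suc 0) = 1" by (simp_all add: a_def x_def y_def)
  have a_nn: "0 \<le> a n" for n using \<delta>_pos[of n] by (simp add: a_def le_max_iff_disj)
  have xa: "norm (x n) \<le> \<delta> n * a n" "norm (y n) \<le> \<delta> n * a n" for n
    using \<delta>_pos[of n] by (simp_all add: a_def)
  define T where "T = (\<lambda>K. \<Sum>n\<le>K. monom (a n) n)"
  have cT: "coeff (T K) n = (if n \<le> K then a n else 0)" for K n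
    by (simp add: T_def coeff_sum)
  have T_nn: "0 \<le> coeff (T K) n" for K n using a_nn by (simp add: cT)
  have dom: "dominated (fst (curve_poly L c d K)) (T K)" "dominated (snd (curve_poly L c d K)) (T K)" for K
    using xa a0 a_nn by (auto simp: dominated_def coeff_curve_poly cT x_def y_def)
  have subst_bound: "norm (coeff (poly_subst f k (fst (curve_poly L c d (k - 1))) (snd (curve_poly L c d (k - 1)))) k)
     \<le> divisor L k * \<delta> k * (\<Sum>i\<le>k. \<Sum>j\<le>k. if 2 \<le> i + j then M / r ^ (i + j) * coeff (T (k - 1) ^ (i + j)) k else 0)"
    if f: "\<And>i j. norm (f i j) \<le> M / r ^ (i + j)" and "2 \<le> k" for f :: "nat \<Rightarrow> nat \<Rightarrow> complex" and k
  proof -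
    define X Y where "X = fst (curve_poly L c d (k - 1))" and "Y = snd (curve_poly L c d (k - 1))"
    have "norm (coeff (poly_subst f k X Y) k)
       \<le> (\<Sum>i\<le>k. \<Sum>j\<le>k. norm (coeff (if 2 \<le> i + j then smult (f i j) (X ^ i * Y ^ j) else 0) k))"
      unfolding poly_subst_def coeff_sum by (intro order_trans[OF norm_sum] sum_mono norm_sum)
    also have "\<dots> \<le> (\<Sum>i\<le>k. \<Sum>j\<le>k. divisor L k * \<delta> k * (if 2 \<le> i + j then M / r ^ (i + j) * coeff (T (k - 1) ^ (i + j)) k else 0))"
    proof (intro sum_mono)
      fix i j
      show "norm (coeff (if 2 \<le> i + j then smult (f i j) (X ^ i * Y ^ j) else 0) k)
        \<le> divisor L k * \<delta> k * (if 2 \<le> i + j then M / r ^ (i + j) * coeff (T (k - 1) ^ (i + j)) k else 0)"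
      proof (cases "2 \<le> i + j")
        case True
        have "norm (f i j) * norm (coeff (X ^ i * Y ^ j) k)
          \<le> M / r ^ (i + j) * (divisor L k * \<delta> k * coeff (T (k - 1) ^ (i + j)) k)"
          using f[of i j] M r dominated_monomial_strong[OF dom True, of "k - 1" k]
          by (intro mult_mono) (auto simp: X_def Y_def)
        then show ?thesis using True by (simp add: norm_mult mult_ac)
      qed auto
    qed
    finally show ?thesis by (simp add: X_def Y_def sum_distrib_left)
  qed
  have a_rec: "a k \<le> (\<Sum>i\<le>k. \<Sum>j\<le>k. if 2 \<le> i + j then M / r ^ (i + j) * coeff (T (k - 1) ^ (i + j)) k else 0)"
    (is "_ \<le> ?S") if k: "2 \<le> k" for k
  proof -
    have *: "norm u / norm w \<le> \<delta> k * ?S" if "norm u \<le> divisor L k * \<delta> k * ?S" "divisor L k \<le> norm w" for u w :: complex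
    proof -
      note p = divisor_pos[OF L k]
      have "norm u / norm w \<le> norm u / divisor L k" using that(2) p by (intro frac_le) auto
      also have "\<dots> \<le> \<delta> k * ?S" using that(1) p by (simp add: divide_le_eq mult_ac)
      finally show ?thesis .
    qed
    have dv: "divisor L k \<le> norm (L ^ k - L)" "divisor L k \<le> norm (L ^ k - 1)"
      by (auto simp: divisor_def min_le_iff_disj)
    have "norm (x k) \<le> \<delta> k * ?S" "norm (y k) \<le> \<delta> k * ?S"
      unfolding x_def y_def curve_recurrence[OF k] norm_divide
      using *[OF subst_bound[OF c k] dv(1)] *[OF subst_bound[OF d k] dv(2)] by auto
    thus ?thesis using \<delta>_pos[of k] by (simp add: a_def divide_le_eq mult.commute)
  qed
  \<comment> \<open>The entry \<open>r / 4\<close> turns \<open>P K \<le> 2 * \<rho>\<close> into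
    \<open>P K / r \<le> 1 / 2\<close>, as the geometric sums require. The other one makes the
    nonlinear terms contribute at most
    \<open>16 * M * (2 * \<rho> / r)\<^sup>2 \<le> \<rho>\<close>, the share left beside the linear
    term in the bound \<open>2 * \<rho>\<close>. \<open>M + 1\<close> avoids a zero
    denominator.\<close>
  define \<rho> where "\<rho> = min (r / 4) (r\<^sup>2 / (64 * (M + 1)))"
  have \<rho>: "0 < \<rho>" "2 * \<rho> / r \<le> 1 / 2" "64 * M * \<rho> \<le> r\<^sup>2"
  proof -
    show "0 < \<rho>" using r M by (simp add: \<rho>_def)
    have "\<rho> \<le> r / 4" unfolding \<rho>_def by (rule min.cobounded1)
    thus "2 * \<rho> / r \<le> 1 / 2" using r by (simp add: field_simps)
    have "\<rho> \<le> r\<^sup>2 / (64 * (M + 1))" unfolding \<rho>_def by (rule min.cobounded2)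
    hence "64 * (M + 1) * \<rho> \<le> r\<^sup>2" using M by (simp add: field_simps)
    thus "64 * M * \<rho> \<le> r\<^sup>2" using \<open>0 < \<rho>\<close> by (simp add: algebra_simps)
  qed
  define P where "P = (\<lambda>K. poly (T K) \<rho>)"
  have P_eq: "P K = (\<Sum>n\<le>K. a n * \<rho> ^ n)" for K
    by (simp add: P_def T_def poly_sum poly_monom)
  have P_nn: "0 \<le> P K" for K using a_nn \<rho> by (simp add: P_eq sum_nonneg)
  have P_le: "P K \<le> 2 * \<rho>" for K
  proof (induction K)
    case 0
    then show ?case using \<rho> a0 by (simp add: P_eq)
  next
    case (Suc K)
    define q where "q = P K / r"
    have q: "0 \<le> q" "q \<le> 2 * \<rho> / r" using P_nn Suc r by (simp_all add: q_def divide_right_mono)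
    define V where "V = (\<lambda>k. \<Sum>i\<le>Suc K. \<Sum>j\<le>Suc K. if 2 \<le> i + j then M / r ^ (i + j) * coeff (T K ^ (i + j)) k else 0)"
    have V_nn: "0 \<le> V k" for k
      unfolding V_def using M r coeff_power_nonneg[OF T_nn]
      by (intro sum_nonneg) (auto intro!: mult_nonneg_nonneg divide_nonneg_nonneg)
    have aV: "a k \<le> V k" if "2 \<le> k" "k \<le> Suc K" for k
    proof -
      have "a k \<le> (\<Sum>i\<le>k. \<Sum>j\<le>k. if 2 \<le> i + j then M / r ^ (i + j) * coeff (T (k - 1) ^ (i + j)) k else 0)"
        by (rule a_rec[OF that(1)])
      also have "\<dots> \<le> (\<Sum>i\<le>k. \<Sum>j\<le>k. if 2 \<le> i + j then M / r ^ (i + j) * coeff (T K ^ (i + j)) k else 0)"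
      proof (intro sum_mono)
        fix i j
        have "coeff (T (k - 1) ^ (i + j)) k \<le> coeff (T K ^ (i + j)) k"
          using that a_nn by (intro coeff_power_mono[OF T_nn]) (auto simp: cT)
        hence "M / r ^ (i + j) * coeff (T (k - 1) ^ (i + j)) k \<le> M / r ^ (i + j) * coeff (T K ^ (i + j)) k"
          using M r by (intro mult_left_mono) auto
        thus "(if 2 \<le> i + j then M / r ^ (i + j) * coeff (T (k - 1) ^ (i + j)) k else 0)
          \<le> (if 2 \<le> i + j then M / r ^ (i + j) * coeff (T K ^ (i + j)) k else 0)" by simp
      qed
      also have "\<dots> \<le> (\<Sum>i\<le>k. \<Sum>j\<le>Suc K. if 2 \<le> i + j then M / r ^ (i + j) * coeff (T K ^ (i + j)) k else 0)"
        using M r that coeff_power_nonneg[OF T_nn]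
        by (intro sum_mono sum_mono2) (auto intro!: mult_nonneg_nonneg divide_nonneg_nonneg)
      also have "\<dots> \<le> V k"
        unfolding V_def using M r that coeff_power_nonneg[OF T_nn]
        by (intro sum_mono2) (auto intro!: sum_nonneg mult_nonneg_nonneg divide_nonneg_nonneg simp del: sum.atMost_Suc)
      finally show ?thesis .
    qed
    have "{..Suc K} = {0, Suc 0} \<union> {2..Suc K}" by auto
    hence "P (Suc K) = (\<Sum>n\<in>{0, Suc 0}. a n * \<rho> ^ n) + (\<Sum>n\<in>{2..Suc K}. a n * \<rho> ^ n)"
      unfolding P_eq by (simp only:) (subst sum.union_disjoint, auto)
    also have "(\<Sum>n\<in>{2..Suc K}. a n * \<rho> ^ n) \<le> (\<Sum>n\<in>{2..Suc K}. V n * \<rho> ^ n)"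
      using aV \<rho> by (intro sum_mono mult_right_mono) auto
    also have "\<dots> \<le> (\<Sum>n\<le>Suc K. V n * \<rho> ^ n)"
      using V_nn \<rho> by (intro sum_mono2) auto
    also have "\<dots> = (\<Sum>i\<le>Suc K. \<Sum>j\<le>Suc K. if 2 \<le> i + j then M / r ^ (i + j) * (\<Sum>n\<le>Suc K. coeff (T K ^ (i + j)) n * \<rho> ^ n) else 0)"
    proof -
      have "(\<Sum>n\<le>Suc K. V n * \<rho> ^ n) = (\<Sum>n\<le>Suc K. \<Sum>i\<le>Suc K. \<Sum>j\<le>Suc K. if 2 \<le> i + j then M / r ^ (i + j) * (coeff (T K ^ (i + j)) n * \<rho> ^ n) else 0)"
        unfolding V_def sum_distrib_right by (intro sum.cong refl) auto
      also have "\<dots> = (\<Sum>i\<le>Suc K. \<Sum>j\<le>Suc K. \<Sum>n\<le>Suc K. if 2 \<le> i + j then M / r ^ (i + j) * (coeff (T K ^ (i + j)) n * \<rho> ^ n) else 0)"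
        by (subst sum.swap, intro sum.cong refl sum.swap)
      also have "\<dots> = (\<Sum>i\<le>Suc K. \<Sum>j\<le>Suc K. if 2 \<le> i + j then M / r ^ (i + j) * (\<Sum>n\<le>Suc K. coeff (T K ^ (i + j)) n * \<rho> ^ n) else 0)"
        by (intro sum.cong refl) (auto simp: sum_distrib_left simp del: sum.atMost_Suc)
      finally show ?thesis .
    qed
    also have "\<dots> \<le> (\<Sum>i\<le>Suc K. \<Sum>j\<le>Suc K. M * (if 2 \<le> i + j then q ^ (i + j) else 0))"
    proof (intro sum_mono)
      fix i j
      have "(\<Sum>n\<le>Suc K. coeff (T K ^ (i + j)) n * \<rho> ^ n) \<le> P K ^ (i + j)"
        using sum_coeff_le_poly[OF coeff_power_nonneg[OF T_nn], of \<rho> K "i + j" "Suc K"] \<rho>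
        by (simp add: P_def del: sum.atMost_Suc)
      hence "M / r ^ (i + j) * (\<Sum>n\<le>Suc K. coeff (T K ^ (i + j)) n * \<rho> ^ n) \<le> M / r ^ (i + j) * P K ^ (i + j)"
        using M r by (intro mult_left_mono) auto
      thus "(if 2 \<le> i + j then M / r ^ (i + j) * (\<Sum>n\<le>Suc K. coeff (T K ^ (i + j)) n * \<rho> ^ n) else 0)
          \<le> M * (if 2 \<le> i + j then q ^ (i + j) else 0)"
        by (auto simp: q_def power_divide)
    qed
    also have "\<dots> = M * (\<Sum>i\<le>Suc K. \<Sum>j\<le>Suc K. if 2 \<le> i + j then q ^ (i + j) else 0)"
      by (simp only: sum_distrib_left)
    also have "\<dots> \<le> M * (16 * q\<^sup>2)"
      using q \<rho> M by (intro mult_left_mono sum_square_powers_le) auto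
    also have "\<dots> \<le> M * (16 * (2 * \<rho> / r)\<^sup>2)"
      using q M by (intro mult_left_mono power_mono) auto
    also have "\<dots> = (64 * M * \<rho>) * \<rho> / r\<^sup>2" by (simp add: power2_eq_square)
    also have "\<dots> \<le> r\<^sup>2 * \<rho> / r\<^sup>2" using \<rho> r by (intro divide_right_mono mult_right_mono) auto
    also have "\<dots> = \<rho>" using r by simp
    also have "(\<Sum>n\<in>{0, Suc 0}. a n * \<rho> ^ n) = \<rho>" using a0 by simp
    finally show ?case by simp
  qed
  have an: "a n * \<rho> ^ n \<le> 2 * \<rho>" for n
  proof -
    have "a n * \<rho> ^ n \<le> P n" unfolding P_eq using a_nn \<rho> by (intro member_le_sum) auto
    thus ?thesis using P_le[of n] by linarith
  qed
  \<comment> \<open>For positive \<open>n\<close> the number \<open>2 * \<rho> + 1\<close> is at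
    most its \<open>n\<close>-th power, so it merges with the factor
    \<open>\<rho> ^ n\<close>.\<close>
  define B where "B = max 1 ((2 * \<rho> + 1) / \<rho>)"
  have "a n \<le> B ^ n" for n
  proof (cases "n = 0")
    case True
    then show ?thesis using a0 by simp
  next
    case False
    have "a n \<le> (2 * \<rho> + 1) / \<rho> ^ n" using an[of n] \<rho> by (simp add: field_simps)
    also have "\<dots> \<le> (2 * \<rho> + 1) ^ n / \<rho> ^ n"
      using False \<rho> self_le_power[of "2 * \<rho> + 1" n] by (intro divide_right_mono) auto
    also have "\<dots> \<le> B ^ n" unfolding power_divide[symmetric] using \<rho> by (intro power_mono) (auto simp: B_def)
    finally show ?thesis .
  qed
  hence "\<delta> n * a n \<le> \<delta> n * B ^ n" for n using \<delta>_pos[of n] by (intro mult_left_mono) auto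
  hence "norm (x n) \<le> \<delta> n * B ^ n \<and> norm (y n) \<le> \<delta> n * B ^ n" for n
    using xa[of n] order_trans by blast
  thus ?thesis unfolding x_def y_def by (intro exI[of _ B]) (auto simp: B_def)
qed

section \<open>Convergence of the invariant curve\<close>

definition taylor_coeff :: "(complex \<Rightarrow> complex) \<Rightarrow> nat \<Rightarrow> complex" where
  "taylor_coeff f n = (deriv ^^ n) f 0 / fact n"

lemma norm_taylor_coeff_le:
  assumes "f holomorphic_on ball 0 R" "0 < r" "r < R" "\<And>z. norm z = r \<Longrightarrow> norm (f z) \<le> M"
  shows "norm (taylor_coeff f n) \<le> M / r ^ n"
proof -
  have "norm ((deriv ^^ n) f 0) \<le> fact n * M / r ^ n"
  proof (rule Cauchy_inequality)
    show "f holomorphic_on ball 0 r" using assms by (auto elim: holomorphic_on_subset)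
    show "continuous_on (cball 0 r) f"
      using assms by (intro holomorphic_on_imp_continuous_on) (auto elim: holomorphic_on_subset)
  qed (use assms in auto)
  thus ?thesis by (simp add: taylor_coeff_def norm_divide field_simps)
qed

lemma taylor_tail:
  assumes "f holomorphic_on ball 0 R" "0 < r" "r < R" "\<And>z. norm z = r \<Longrightarrow> norm (f z) \<le> M"
    "norm z \<le> t" "t \<le> r / 2"
  shows "norm (f z - (\<Sum>n\<le>N. taylor_coeff f n * z ^ n)) \<le> 2 * M * (t / r) ^ Suc N"
proof -
  have M: "0 \<le> M" using assms(4)[of "of_real r"] assms(2) order_trans[OF norm_ge_zero] by fastforce
  have t: "0 \<le> t" using assms(5) norm_ge_zero order_trans by blast
  define q where "q = t / r"
  have q: "0 \<le> q" "q \<le> 1 / 2" using t assms by (auto simp: q_def field_simps)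
  define g where "g = (\<lambda>n. taylor_coeff f n * z ^ n)"
  have "z \<in> ball 0 R" using assms by auto
  hence "g sums f z" using holomorphic_power_series[OF assms(1)] by (simp add: g_def taylor_coeff_def)
  hence "(\<lambda>n. g (n + Suc N)) sums (f z - (\<Sum>n<Suc N. g n))"
    by (rule sums_split_initial_segment)
  hence s: "(\<lambda>n. g (n + Suc N)) sums (f z - (\<Sum>n\<le>N. g n))" by (simp only: lessThan_Suc_atMost)
  have gb: "norm (g (n + Suc N)) \<le> M * q ^ Suc N * (1 / 2) ^ n" for n
  proof -
    have "norm (g (n + Suc N)) \<le> M / r ^ (n + Suc N) * t ^ (n + Suc N)"
      unfolding g_def norm_mult norm_power
      by (intro mult_mono power_mono norm_taylor_coeff_le[OF assms(1-4)]) (use assms M in auto)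
    also have "\<dots> = M * q ^ Suc N * q ^ n" by (simp add: q_def power_divide power_add field_simps)
    also have "\<dots> \<le> M * q ^ Suc N * (1 / 2) ^ n" using q M by (intro mult_left_mono power_mono) auto
    finally show ?thesis .
  qed
  have geo: "(\<lambda>n. M * q ^ Suc N * (1 / 2) ^ n) sums (M * q ^ Suc N * 2)"
    using geometric_sums[of "1 / 2 :: real"] by (intro sums_mult) simp
  have "norm (f z - (\<Sum>n\<le>N. g n)) \<le> M * q ^ Suc N * 2"
    using gb sums_le[OF _ _ geo] norm_suminf_le[of "\<lambda>n. g (n + Suc N)" "\<lambda>n. M * q ^ Suc N * (1 / 2) ^ n"]
      sums_unique[OF s] sums_unique[OF geo] sums_summable[OF geo] by metis
  thus ?thesis by (simp add: g_def q_def mult_ac)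
qed

text \<open>The double series arises by iteration: expand in \<open>a\<close>, then expand each
  coefficient in \<open>b\<close>. The first tail contributes \<open>2 * M\<close>. The second
  contributes \<open>2 * M\<close> times a sum of powers of 1/2, thus at most \<open>4 * M\<close>,
  which gives the constant 6.\<close>

lemma taylor_tail_two_variables:
  fixes G :: "complex \<Rightarrow> complex \<Rightarrow> complex"
  assumes hol1: "\<And>b. norm b < R \<Longrightarrow> (\<lambda>a. G a b) holomorphic_on ball 0 R"
    and hol2: "\<And>n. (\<lambda>b. taylor_coeff (\<lambda>a. G a b) n) holomorphic_on ball 0 R"
    and r: "0 < r" "r < R" and M: "\<And>a b. norm a \<le> r \<Longrightarrow> norm b \<le> r \<Longrightarrow> norm (G a b) \<le> M"
  defines "c \<equiv> \<lambda>i j. taylor_coeff (\<lambda>b. taylor_coeff (\<lambda>a. G a b) i) j"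
  shows "norm (c i j) \<le> M / r ^ (i + j)"
    and "norm a \<le> t \<Longrightarrow> norm b \<le> t \<Longrightarrow> t \<le> r / 2 \<Longrightarrow>
      norm (G a b - (\<Sum>i\<le>N. \<Sum>j\<le>N. c i j * a ^ i * b ^ j)) \<le> 6 * M * (t / r) ^ Suc N"
proof -
  have M0: "0 \<le> M" using M[of 0 0] r norm_ge_zero order_trans by (metis less_imp_le norm_zero)
  have b1: "norm (taylor_coeff (\<lambda>a. G a b) i) \<le> M / r ^ i" if "norm b \<le> r" for b i
    using hol1[of b] r M that by (intro norm_taylor_coeff_le[of _ R]) auto
  have b1': "norm (taylor_coeff (\<lambda>a. G a b) i) \<le> M / r ^ i" if "norm b = r" for b i
    using b1[of b i] that by simp
  have "norm (c i j) \<le> M / r ^ i / r ^ j"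
    unfolding c_def using r b1' by (intro norm_taylor_coeff_le[OF hol2]) auto
  thus "norm (c i j) \<le> M / r ^ (i + j)" by (simp add: power_add)
  assume t: "norm a \<le> t" "norm b \<le> t" "t \<le> r / 2"
  have t0: "0 \<le> t" using t(1) norm_ge_zero order_trans by blast
  define Q where "Q = (t / r) ^ Suc N"
  have Q: "0 \<le> Q" using t0 r by (simp add: Q_def)
  have "norm (G a b - (\<Sum>i\<le>N. taylor_coeff (\<lambda>a. G a b) i * a ^ i)) \<le> 2 * M * Q"
    unfolding Q_def using hol1[of b] t r M by (intro taylor_tail[of _ R]) auto
  moreover have "norm ((\<Sum>i\<le>N. taylor_coeff (\<lambda>a. G a b) i * a ^ i) - (\<Sum>i\<le>N. \<Sum>j\<le>N. c i j * a ^ i * b ^ j)) \<le> 4 * M * Q"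
  proof -
    have "norm ((\<Sum>i\<le>N. taylor_coeff (\<lambda>a. G a b) i * a ^ i) - (\<Sum>i\<le>N. \<Sum>j\<le>N. c i j * a ^ i * b ^ j))
      = norm (\<Sum>i\<le>N. (taylor_coeff (\<lambda>a. G a b) i - (\<Sum>j\<le>N. c i j * b ^ j)) * a ^ i)"
    proof -
      have "(taylor_coeff (\<lambda>a. G a b) i - (\<Sum>j\<le>N. c i j * b ^ j)) * a ^ i
          = taylor_coeff (\<lambda>a. G a b) i * a ^ i - (\<Sum>j\<le>N. c i j * a ^ i * b ^ j)" for i
        unfolding left_diff_distrib sum_distrib_right
        by (intro arg_cong2[where f = "(-)"] refl sum.cong) (simp add: mult_ac)
      thus ?thesis by (simp only: sum_subtractf)
    qed
    also have "\<dots> \<le> (\<Sum>i\<le>N. 2 * M * Q * (1 / 2) ^ i)"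
    proof (intro order_trans[OF norm_sum] sum_mono)
      fix i
      have "norm (taylor_coeff (\<lambda>a. G a b) i - (\<Sum>j\<le>N. c i j * b ^ j)) \<le> 2 * (M / r ^ i) * Q"
        unfolding Q_def c_def using t r b1' by (intro taylor_tail[OF hol2]) auto
      hence "norm ((taylor_coeff (\<lambda>a. G a b) i - (\<Sum>j\<le>N. c i j * b ^ j)) * a ^ i) \<le> 2 * (M / r ^ i) * Q * (r / 2) ^ i"
        unfolding norm_mult norm_power using t t0 M0 Q r by (intro mult_mono power_mono) auto
      also have "\<dots> = 2 * M * Q * (1 / 2) ^ i" using r by (simp add: power_divide)
      finally show "norm ((taylor_coeff (\<lambda>a. G a b) i - (\<Sum>j\<le>N. c i j * b ^ j)) * a ^ i) \<le> 2 * M * Q * (1 / 2) ^ i" .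
    qed
    also have "\<dots> = 2 * M * Q * (\<Sum>i\<le>N. (1 / 2) ^ i)" by (simp add: sum_distrib_left)
    also have "\<dots> \<le> 2 * M * Q * 2" using sum_half_powers_le M0 Q by (intro mult_left_mono) auto
    finally show ?thesis by simp
  qed
  ultimately show "norm (G a b - (\<Sum>i\<le>N. \<Sum>j\<le>N. c i j * a ^ i * b ^ j)) \<le> 6 * M * (t / r) ^ Suc N"
    unfolding Q_def[symmetric] by norm
qed

text \<open>The coefficient is a Cauchy integral in \<open>a\<close> over a fixed circle, and this
  integral can be differentiated with respect to the parameter \<open>b\<close>.\<close>

lemma holomorphic_taylor_coeff:
  fixes G Gb :: "complex \<Rightarrow> complex \<Rightarrow> complex"
  assumes R: "0 < R"
    and hol1: "\<And>b. norm b < R \<Longrightarrow> (\<lambda>a. G a b) holomorphic_on ball 0 R"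
    and der2: "\<And>a b. norm a < R \<Longrightarrow> norm b < R \<Longrightarrow> ((\<lambda>b. G a b) has_field_derivative Gb a b) (at b)"
    and cont: "continuous_on (ball 0 R \<times> ball 0 R) (\<lambda>(a, b). Gb a b)"
  shows "(\<lambda>b. taylor_coeff (\<lambda>a. G a b) n) holomorphic_on ball 0 R"
proof -
  define r where "r = R / 2"
  have r: "0 < r" "r < R" using R by (simp_all add: r_def)
  define \<gamma> where "\<gamma> = circlepath 0 r"
  have \<gamma>n: "norm (\<gamma> t) = r" for t
    using r by (simp add: \<gamma>_def circlepath norm_mult)
  have \<gamma>c: "continuous_on UNIV \<gamma>"
    unfolding \<gamma>_def circlepath by (intro continuous_intros)
  define K where "K = (\<lambda>t. (2 * pi * \<i> * r * exp (2 * of_real pi * \<i> * t)) / \<gamma> t ^ Suc n :: complex)"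
  have \<gamma>0: "\<gamma> t \<noteq> 0" for t using \<gamma>n[of t] r by auto
  have Kc: "continuous_on UNIV K"
    unfolding K_def using \<gamma>0 \<gamma>c by (intro continuous_intros) auto
  have eq: "taylor_coeff (\<lambda>a. G a b) n = integral (cbox 0 1) (\<lambda>t. G (\<gamma> t) b * K t) / (2 * pi * \<i>)"
    if b: "b \<in> ball 0 R" for b
  proof -
    have "((\<lambda>u. G u b / (u - 0) ^ Suc n) has_contour_integral (2 * pi * \<i>) / fact n * (deriv ^^ n) (\<lambda>a. G a b) 0) (circlepath 0 r)"
    proof (rule Cauchy_has_contour_integral_higher_derivative_circlepath)
      show "continuous_on (cball 0 r) (\<lambda>a. G a b)"
        by (intro holomorphic_on_imp_continuous_on holomorphic_on_subset[OF hol1[of b]]) (use b r in auto)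
      show "(\<lambda>a. G a b) holomorphic_on ball 0 r"
        by (intro holomorphic_on_subset[OF hol1[of b]]) (use b r in auto)
    qed (use r in auto)
    hence "((\<lambda>t. G (\<gamma> t) b / \<gamma> t ^ Suc n * vector_derivative \<gamma> (at t within {0..1})) has_integral
        (2 * pi * \<i>) / fact n * (deriv ^^ n) (\<lambda>a. G a b) 0) {0..1}"
      unfolding has_contour_integral_def \<gamma>_def by simp
    hence "((\<lambda>t. G (\<gamma> t) b * K t) has_integral (2 * pi * \<i>) / fact n * (deriv ^^ n) (\<lambda>a. G a b) 0) {0..1}"
    proof (rule has_integral_eq[rotated])
      fix t :: real assume "t \<in> {0..1}"
      thus "G (\<gamma> t) b / \<gamma> t ^ Suc n * vector_derivative \<gamma> (at t within {0..1}) = G (\<gamma> t) b * K t"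
        unfolding K_def \<gamma>_def by (subst vector_derivative_circlepath01) auto
    qed
    thus ?thesis by (simp add: taylor_coeff_def integral_unique)
  qed
  have "(\<lambda>b. integral (cbox 0 1) (\<lambda>t. G (\<gamma> t) b * K t)) holomorphic_on ball 0 R"
  proof (rule leibniz_rule_holomorphic)
    show "((\<lambda>b. G (\<gamma> t) b * K t) has_field_derivative Gb (\<gamma> t) b * K t) (at b within ball 0 R)"
      if "b \<in> ball 0 R" for b t
      by (rule has_field_derivative_at_within, rule DERIV_cmult_right, rule der2) (use \<gamma>n[of t] r that in auto)
    show "(\<lambda>t. G (\<gamma> t) b * K t) integrable_on cbox 0 1" if b: "b \<in> ball 0 R" for b
    proof (rule integrable_continuous)
      have "continuous_on (ball 0 R) (\<lambda>a. G a b)"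
        using hol1[of b] b by (intro holomorphic_on_imp_continuous_on) auto
      hence "continuous_on (cbox 0 1) (\<lambda>t. G (\<gamma> t) b)"
        by (rule continuous_on_compose2[OF _ continuous_on_subset[OF \<gamma>c]]) (use \<gamma>n r in auto)
      thus "continuous_on (cbox 0 1) (\<lambda>t. G (\<gamma> t) b * K t)"
        by (intro continuous_on_mult continuous_on_subset[OF Kc]) auto
    qed
    have "continuous_on (ball 0 R \<times> cbox 0 1) (\<lambda>x. (\<lambda>(a, b). Gb a b) (\<gamma> (snd x), fst x))"
    proof (rule continuous_on_compose2[OF cont])
      show "continuous_on (ball 0 R \<times> cbox 0 1) (\<lambda>x. (\<gamma> (snd x), fst x))"
        by (intro continuous_intros continuous_on_compose2[OF \<gamma>c]) auto
    qed (use \<gamma>n r in auto)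
    hence "continuous_on (ball 0 R \<times> cbox 0 1) (\<lambda>x. Gb (\<gamma> (snd x)) (fst x) * K (snd x))"
      by (intro continuous_intros continuous_on_compose2[OF Kc]) auto
    thus "continuous_on (ball 0 R \<times> cbox 0 1) (\<lambda>(b, t). Gb (\<gamma> t) b * K t)"
      by (simp add: case_prod_unfold)
  qed auto
  hence "(\<lambda>b. integral (cbox 0 1) (\<lambda>t. G (\<gamma> t) b * K t) / (2 * pi * \<i>)) holomorphic_on ball 0 R"
    by (intro holomorphic_intros) auto
  thus ?thesis by (rule holomorphic_transform) (simp add: eq)
qed

lemma power_series_tail:
  fixes x :: "nat \<Rightarrow> complex"
  assumes x: "\<And>n. norm (x n) \<le> D ^ n" and D: "1 \<le> D" and z: "norm z \<le> t" "t \<le> 1 / (2 * D)"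
  shows "(\<lambda>n. x n * z ^ n) sums (\<Sum>n. x n * z ^ n)"
    and "norm ((\<Sum>n. x n * z ^ n) - (\<Sum>n\<le>N. x n * z ^ n)) \<le> 2 * (D * t) ^ Suc N"
proof -
  have t: "0 \<le> t" "D * t \<le> 1 / 2" using z D order_trans[OF norm_ge_zero z(1)] by (simp_all add: field_simps)
  have le: "norm (x (n + m) * z ^ (n + m)) \<le> (D * t) ^ m * (1 / 2) ^ n" for n m
  proof -
    have "norm (x (n + m) * z ^ (n + m)) \<le> D ^ (n + m) * t ^ (n + m)"
      unfolding norm_mult norm_power using x z D by (intro mult_mono power_mono) auto
    also have "\<dots> = (D * t) ^ m * (D * t) ^ n" by (simp add: power_add power_mult_distrib)
    also have "\<dots> \<le> (D * t) ^ m * (1 / 2) ^ n" using t D by (intro mult_left_mono power_mono) auto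
    finally show ?thesis .
  qed
  have sm: "summable (\<lambda>n. (D * t) ^ m * (1 / 2 :: real) ^ n)" for m
    by (intro summable_mult summable_geometric) auto
  have "summable (\<lambda>n. x n * z ^ n)"
    using le[of _ 0] by (intro summable_comparison_test[OF _ sm[of 0]]) auto
  thus s: "(\<lambda>n. x n * z ^ n) sums (\<Sum>n. x n * z ^ n)" by (rule summable_sums)
  have "(\<lambda>n. x (n + Suc N) * z ^ (n + Suc N)) sums ((\<Sum>n. x n * z ^ n) - (\<Sum>n<Suc N. x n * z ^ n))"
    using s by (rule sums_split_initial_segment)
  hence "(\<Sum>n. x n * z ^ n) - (\<Sum>n\<le>N. x n * z ^ n) = (\<Sum>n. x (n + Suc N) * z ^ (n + Suc N))"
    by (simp only: lessThan_Suc_atMost sums_unique)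
  also have "norm \<dots> \<le> (\<Sum>n. (D * t) ^ Suc N * (1 / 2) ^ n)"
    by (rule norm_suminf_le[OF le sm])
  also have "\<dots> = 2 * (D * t) ^ Suc N"
    by (subst suminf_mult) (auto simp: suminf_geometric intro: summable_geometric)
  finally show "norm ((\<Sum>n. x n * z ^ n) - (\<Sum>n\<le>N. x n * z ^ n)) \<le> 2 * (D * t) ^ Suc N" .
qed

text \<open>Otherwise \<open>f\<close> is a power of the variable times a function that is nonzero
  at 0, and flatness of one order more forces that function to vanish there.\<close>

lemma holomorphic_flat_eq_0:
  assumes f: "f holomorphic_on ball 0 s" and s: "0 < s"
    and flat: "\<And>N. \<exists>K. \<forall>z. norm z < s \<longrightarrow> norm (f z) \<le> K * norm z ^ Suc N"
    and z: "norm z < s"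
  shows "f z = 0"
proof (rule ccontr)
  assume nz: "f z \<noteq> 0"
  have f0: "f 0 = 0" using flat[of 0] s by (auto dest: spec[of _ 0])
  have nc: "\<not> f constant_on ball 0 s"
  proof
    assume "f constant_on ball 0 s"
    hence "f z = f 0" using z s unfolding constant_on_def by auto
    thus False using nz f0 by simp
  qed
  have "0 \<in> ball 0 s" using s by simp
  then obtain g r n where g: "0 < n" "0 < r" "ball (0::complex) r \<subseteq> ball 0 s" "g holomorphic_on ball 0 r"
    "\<And>w. w \<in> ball 0 r \<Longrightarrow> f w = (w - 0) ^ n * g w" "\<And>w. w \<in> ball 0 r \<Longrightarrow> g w \<noteq> 0"
    by (rule holomorphic_factor_zero_nonconstant[OF f open_ball connected_ball _ f0 nc]) (rule that)
  obtain K where K: "norm (f w) \<le> K * norm w ^ Suc n" if "norm w < s" for w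
    using flat[of n] by blast
  have "norm (g w) \<le> K * norm w" if "w \<in> ball 0 r - {0}" for w
  proof -
    have "norm w ^ n * norm (g w) \<le> norm w ^ n * (K * norm w)"
      using K[of w] g(3) g(5)[of w] that by (auto simp: norm_mult norm_power mult_ac)
    thus ?thesis using that by (simp add: mult_le_cancel_left)
  qed
  hence ev: "eventually (\<lambda>w. norm (g w) \<le> K * norm w) (at 0)"
    unfolding eventually_at_topological using g(2) by (intro exI[of _ "ball 0 r"]) auto
  have "continuous_on (ball 0 r) g" using g(4) by (rule holomorphic_on_imp_continuous_on)
  hence "isCont g 0" using g(2) by (simp add: continuous_on_eq_continuous_at)
  hence 1: "((\<lambda>w. norm (g w)) \<longlongrightarrow> norm (g 0)) (at 0)" by (intro tendsto_norm) (simp add: isCont_def)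
  have 2: "((\<lambda>w::complex. K * norm w) \<longlongrightarrow> 0) (at 0)"
    by (intro tendsto_mult_right_zero tendsto_norm_zero tendsto_ident_at)
  have "norm (g 0) \<le> 0"
    by (rule tendsto_le[OF _ 2 1 ev]) simp
  hence "g 0 = 0" by simp
  thus False using g(2,6) by auto
qed

lemma poly_flat:
  fixes W :: "complex poly"
  assumes "\<And>k. k \<le> N \<Longrightarrow> coeff W k = 0"
  obtains K where "\<And>z. norm z \<le> 1 \<Longrightarrow> norm (poly W z) \<le> K * norm z ^ Suc N"
proof -
  have "monom 1 (Suc N) dvd W" using assms unfolding monom_1_dvd_iff' by auto
  then obtain V where V: "W = monom 1 (Suc N) * V" by (auto elim: dvdE)
  have "compact (poly V ` cball 0 1)" by (intro compact_continuous_image continuous_intros compact_cball)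
  then obtain K where K: "\<And>z. z \<in> cball 0 1 \<Longrightarrow> norm (poly V z) \<le> K"
    using compact_imp_bounded bounded_iff by (metis imageI)
  have "norm (poly W z) \<le> K * norm z ^ Suc N" if "norm z \<le> 1" for z
    unfolding V poly_mult norm_mult poly_monom norm_power using K[of z] that
    by (simp add: mult.commute mult_right_mono norm_mult norm_power)
  thus ?thesis by (rule that)
qed

lemma norm_monomial_diff:
  fixes a b a' b' :: complex
  assumes "norm a \<le> 1" "norm b \<le> 1" "norm a' \<le> 1" "norm b' \<le> 1"
  shows "norm (a ^ i * b ^ j - a' ^ i * b' ^ j) \<le> i * norm (a - a') + j * norm (b - b')"
proof -
  have "a ^ i * b ^ j - a' ^ i * b' ^ j = (a ^ i - a' ^ i) * b ^ j + a' ^ i * (b ^ j - b' ^ j)"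
    by (simp add: algebra_simps)
  also have "norm \<dots> \<le> norm (a ^ i - a' ^ i) * norm (b ^ j) + norm (a' ^ i) * norm (b ^ j - b' ^ j)"
    unfolding norm_mult[symmetric] by (rule norm_triangle_ineq)
  also have "\<dots> \<le> norm (a ^ i - a' ^ i) * 1 + 1 * norm (b ^ j - b' ^ j)"
    using assms by (intro add_mono mult_mono) (auto simp: norm_power power_le_one)
  also have "\<dots> \<le> i * norm (a - a') + j * norm (b - b')"
    using norm_power_diff[of a a' i] norm_power_diff[of b b' j] assms by simp
  finally show ?thesis .
qed

text \<open>Both sides are holomorphic and agree to infinite order at the origin.\<close>

lemma curve_component:
  fixes G :: "complex \<Rightarrow> complex \<Rightarrow> complex" and c :: "nat \<Rightarrow> nat \<Rightarrow> complex"
    and x y w :: "nat \<Rightarrow> complex"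
  defines "f \<equiv> \<lambda>w z. \<Sum>n. w n * z ^ n"
  defines "X \<equiv> \<lambda>N. \<Sum>n\<le>N. monom (x n) n" and "Y \<equiv> \<lambda>N. \<Sum>n\<le>N. monom (y n) n"
  assumes D: "1 \<le> D" and x: "\<And>n. norm (x n) \<le> D ^ n" and y: "\<And>n. norm (y n) \<le> D ^ n"
    and w: "\<And>n. norm (w n) \<le> D ^ n" and xy0: "x 0 = 0" "y 0 = 0"
    and L: "norm L \<le> 1" and r: "0 < r"
    and tail: "\<And>a b t N. norm a \<le> t \<Longrightarrow> norm b \<le> t \<Longrightarrow> t \<le> r / 2 \<Longrightarrow>
      norm (G a b - (\<Sum>i\<le>N. \<Sum>j\<le>N. c i j * a ^ i * b ^ j)) \<le> 6 * M * (t / r) ^ Suc N"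
    and c0: "c 0 0 = 0"
    and eq: "\<And>k N. k \<le> N \<Longrightarrow> 1 \<le> N \<Longrightarrow>
      coeff (smult (c 1 0) (X N) + smult (c 0 1) (Y N) + poly_subst c N (X N) (Y N)) k = L ^ k * w k"
    and s: "s = min (1 / (2 * D)) (r / (4 * D))"
    and hol: "(\<lambda>z. G (f x z) (f y z)) holomorphic_on ball 0 s"
    and z: "norm z < s"
  shows "G (f x z) (f y z) = f w (L * z)"
proof -
  have s0: "0 < s" using r D by (simp add: s)
  have s1: "t \<le> 1 / (2 * D)" "D * t \<le> 1 / 2" "2 * D * t \<le> r / 2" "t \<le> 1" if "t < s" for t
  proof -
    show 1: "t \<le> 1 / (2 * D)" using that by (simp add: s)
    thus "D * t \<le> 1 / 2" using D by (simp add: field_simps)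
    have "t \<le> r / (4 * D)" using that by (simp add: s)
    thus "2 * D * t \<le> r / 2" using D by (simp add: field_simps)
    have "1 / (2 * D) \<le> 1" using D by simp
    thus "t \<le> 1" using 1 by linarith
  qed
  have hw: "f w holomorphic_on ball 0 s"
  proof (rule power_series_holomorphic)
    fix u :: complex assume "u \<in> ball 0 s"
    hence "(\<lambda>n. w n * u ^ n) sums f w u" unfolding f_def
      using power_series_tail(1)[OF w D order_refl, of u] s1(1)[of "norm u"] by simp
    thus "(\<lambda>n. w n * (u - 0) ^ n) sums f w u" by simp
  qed
  have Lz: "norm (L * u) \<le> norm u" for u
    using mult_right_mono[OF L norm_ge_zero, of u] by (simp add: norm_mult)
  define E where "E = (\<lambda>z. G (f x z) (f y z) - f w (L * z))"
  have "E holomorphic_on ball 0 s"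
  proof -
    have "(f w \<circ> (\<lambda>z. L * z)) holomorphic_on ball 0 s"
      using Lz by (intro holomorphic_on_compose_gen[OF _ hw] holomorphic_intros) (auto intro: le_less_trans[OF Lz])
    thus ?thesis unfolding E_def using hol by (intro holomorphic_intros) (auto simp: o_def)
  qed
  moreover have "\<exists>K. \<forall>z. norm z < s \<longrightarrow> norm (E z) \<le> K * norm z ^ Suc N" for N
  proof -
    \<comment> \<open>With \<open>1 \<le> N\<close> the truncated double sum contains both linear
      monomials. The remaining order follows afterwards from \<open>N = 1\<close>, as the disc has
      radius at most 1.\<close>
    have main: "\<exists>K. \<forall>z. norm z < s \<longrightarrow> norm (E z) \<le> K * norm z ^ Suc N" if N: "1 \<le> N" for N
    proof -
      define S where "S = (\<lambda>a b. \<Sum>i\<le>N. \<Sum>j\<le>N. c i j * a ^ i * b ^ j)"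
      define W where "W = smult (c 1 0) (X N) + smult (c 0 1) (Y N) + poly_subst c N (X N) (Y N)
        - (\<Sum>n\<le>N. monom (L ^ n * w n) n)"
      have "coeff W k = 0" if "k \<le> N" for k
        using eq[OF that N] that by (simp add: W_def coeff_sum)
      then obtain K1 where K1: "\<And>z. norm z \<le> 1 \<Longrightarrow> norm (poly W z) \<le> K1 * norm z ^ Suc N"
        using poly_flat[of N W] by metis
      define K2 where "K2 = (\<Sum>i\<le>N. \<Sum>j\<le>N. norm (c i j) * (i + j)) * (2 * D ^ Suc N)"
      have S_poly: "S (poly (X N) u) (poly (Y N) u) = poly W u + (\<Sum>n\<le>N. w n * (L * u) ^ n)" for u
      proof -
        define a b where "a = poly (X N) u" and "b = poly (Y N) u"
        have "S a b = (\<Sum>i\<le>N. \<Sum>j\<le>N. if 2 \<le> i + j then c i j * a ^ i * b ^ j else 0)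
            + (\<Sum>i\<le>N. \<Sum>j\<le>N. if i + j < 2 then c i j * a ^ i * b ^ j else 0)"
          unfolding S_def sum.distrib[symmetric] by (intro sum.cong refl) auto
        also have "(\<Sum>i\<le>N. \<Sum>j\<le>N. if i + j < 2 then c i j * a ^ i * b ^ j else 0)
            = (\<Sum>i\<le>1. \<Sum>j\<le>N. if i + j < 2 then c i j * a ^ i * b ^ j else 0)"
          using N by (intro sum.mono_neutral_right) (auto intro!: sum.neutral)
        also have "\<dots> = (\<Sum>i\<le>1. \<Sum>j\<le>1. if i + j < 2 then c i j * a ^ i * b ^ j else 0)"
          using N by (intro sum.cong refl sum.mono_neutral_right) auto
        also have "\<dots> = c 1 0 * a + c 0 1 * b" by (simp add: c0 atMost_Suc)
        also have "(\<Sum>i\<le>N. \<Sum>j\<le>N. if 2 \<le> i + j then c i j * a ^ i * b ^ j else 0) = poly (poly_subst c N (X N) (Y N)) u"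
          unfolding poly_subst_def a_def b_def poly_sum by (intro sum.cong refl) auto
        finally show ?thesis
          by (simp add: W_def a_def b_def poly_sum poly_monom power_mult_distrib mult_ac)
      qed
      have "norm (E u) \<le> (6 * M * (2 * D / r) ^ Suc N + K2 + K1 + 2 * D ^ Suc N) * norm u ^ Suc N"
        if u: "norm u < s" for u
      proof -
        define t where "t = norm u"
        have t: "0 \<le> t" "t \<le> 1 / (2 * D)" "D * t \<le> 1 / 2" "2 * D * t \<le> r / 2" "t \<le> 1"
          using s1[of t] u by (simp_all add: t_def)
        have small: "norm (f v u) \<le> 2 * D * t" "norm (\<Sum>n\<le>N. v n * u ^ n) \<le> 2 * (D * t)"
          "norm (f v u - (\<Sum>n\<le>N. v n * u ^ n)) \<le> 2 * (D * t) ^ Suc N"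
          if v: "\<And>n. norm (v n) \<le> D ^ n" "v 0 = 0" for v
        proof -
          show "norm (f v u) \<le> 2 * D * t"
            using power_series_tail(2)[OF v(1) D _ t(2), of u 0] v(2) by (simp add: f_def t_def)
          show "norm (f v u - (\<Sum>n\<le>N. v n * u ^ n)) \<le> 2 * (D * t) ^ Suc N"
            using power_series_tail(2)[OF v(1) D _ t(2), of u N] by (simp add: f_def t_def)
          define v' where "v' = (\<lambda>n. if n \<le> N then v n else 0)"
          have "(\<lambda>n. v' n * u ^ n) sums (\<Sum>n\<le>N. v' n * u ^ n)"
            by (intro sums_finite) (auto simp: v'_def)
          hence "(\<Sum>n. v' n * u ^ n) = (\<Sum>n\<le>N. v n * u ^ n)"
            by (subst sums_unique[symmetric]) (auto simp: v'_def)
          moreover have "norm (v' n) \<le> D ^ n" for n using v D by (auto simp: v'_def)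
          ultimately show "norm (\<Sum>n\<le>N. v n * u ^ n) \<le> 2 * (D * t)"
            using power_series_tail(2)[OF _ D _ t(2), of v' u 0] v(2) by (simp add: v'_def t_def)
        qed
        have pX: "poly (X N) u = (\<Sum>n\<le>N. x n * u ^ n)" "poly (Y N) u = (\<Sum>n\<le>N. y n * u ^ n)"
          by (simp_all add: X_def Y_def poly_sum poly_monom)
        note sx = small[OF x xy0(1)] and sy = small[OF y xy0(2)]
        have one: "2 * D * t \<le> 1" using t(3) by simp
        have A: "norm (G (f x u) (f y u) - S (f x u) (f y u)) \<le> 6 * M * (2 * D / r) ^ Suc N * t ^ Suc N"
        proof -
          have "norm (G (f x u) (f y u) - S (f x u) (f y u)) \<le> 6 * M * (2 * D * t / r) ^ Suc N"
            unfolding S_def by (rule tail) (use sx(1) sy(1) t(4) in simp_all)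
          also have "2 * D * t / r = (2 * D / r) * t" by simp
          finally show ?thesis by (simp only: power_mult_distrib mult.assoc)
        qed
        have B: "norm (S (f x u) (f y u) - S (poly (X N) u) (poly (Y N) u)) \<le> K2 * t ^ Suc N"
        proof -
          have "S (f x u) (f y u) - S (poly (X N) u) (poly (Y N) u)
            = (\<Sum>i\<le>N. \<Sum>j\<le>N. c i j * (f x u ^ i * f y u ^ j - poly (X N) u ^ i * poly (Y N) u ^ j))"
            unfolding S_def sum_subtractf[symmetric] by (simp only: right_diff_distrib mult.assoc)
          also have "norm \<dots> \<le> (\<Sum>i\<le>N. \<Sum>j\<le>N. norm (c i j) * (i + j) * (2 * (D * t) ^ Suc N))"
          proof (intro order_trans[OF norm_sum] sum_mono)
            fix i j
            have "norm (f x u ^ i * f y u ^ j - poly (X N) u ^ i * poly (Y N) u ^ j)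
              \<le> i * norm (f x u - poly (X N) u) + j * norm (f y u - poly (Y N) u)"
              unfolding pX by (rule norm_monomial_diff; rule order_trans[OF _ one]) (use sx(1,2) sy(1,2) in simp_all)
            also have "\<dots> \<le> i * (2 * (D * t) ^ Suc N) + j * (2 * (D * t) ^ Suc N)"
              using sx(3) sy(3) unfolding pX by (intro add_mono mult_left_mono) simp_all
            finally have "norm (f x u ^ i * f y u ^ j - poly (X N) u ^ i * poly (Y N) u ^ j) \<le> (i + j) * (2 * (D * t) ^ Suc N)"
              by (simp only: of_nat_add distrib_right)
            thus "norm (c i j * (f x u ^ i * f y u ^ j - poly (X N) u ^ i * poly (Y N) u ^ j)) \<le> norm (c i j) * (i + j) * (2 * (D * t) ^ Suc N)"
              unfolding norm_mult mult.assoc by (intro mult_left_mono) auto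
          qed
          also have "\<dots> = K2 * t ^ Suc N"
            unfolding K2_def sum_distrib_right by (intro sum.cong refl) (simp only: power_mult_distrib mult_ac)
          finally show ?thesis .
        qed
        have C: "norm (poly W u) \<le> K1 * t ^ Suc N" using K1[of u] t by (simp add: t_def)
        have F: "norm (f w (L * u) - (\<Sum>n\<le>N. w n * (L * u) ^ n)) \<le> 2 * D ^ Suc N * t ^ Suc N"
          using power_series_tail(2)[OF w D _ t(2), of "L * u" N] Lz[of u]
          unfolding f_def power_mult_distrib[of D] t_def by (simp only: mult.assoc)
        \<comment> \<open>Four errors of order \<open>Suc N\<close>: the Taylor tail of
          \<open>G\<close>, the replacement of the series by their Taylor polynomials, the defect
          \<open>W\<close> of the formal equation, and the tail of the right-hand side.\<close>
        have "E u = (G (f x u) (f y u) - S (f x u) (f y u)) + (S (f x u) (f y u) - S (poly (X N) u) (poly (Y N) u))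
            + poly W u - (f w (L * u) - (\<Sum>n\<le>N. w n * (L * u) ^ n))"
          unfolding E_def S_poly by simp
        moreover have "norm (p + q + v - v') \<le> norm p + norm q + norm v + norm v'" for p q v v' :: complex
          by norm
        ultimately have "norm (E u) \<le> norm (G (f x u) (f y u) - S (f x u) (f y u))
            + norm (S (f x u) (f y u) - S (poly (X N) u) (poly (Y N) u)) + norm (poly W u)
            + norm (f w (L * u) - (\<Sum>n\<le>N. w n * (L * u) ^ n))"
          by (simp only:)
        also have "\<dots> \<le> 6 * M * (2 * D / r) ^ Suc N * t ^ Suc N + K2 * t ^ Suc N + K1 * t ^ Suc N + 2 * D ^ Suc N * t ^ Suc N"
          by (intro add_mono A B C F)
        finally show ?thesis unfolding t_def[symmetric] by (simp only: distrib_right)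
      qed
      thus ?thesis by blast
    qed
    show ?thesis
    proof (cases "1 \<le> N")
      case True
      then show ?thesis by (rule main)
    next
      case False
      then obtain K where K: "\<forall>z. norm z < s \<longrightarrow> norm (E z) \<le> K * norm z ^ Suc 1" using main[of 1] by auto
      have "norm (E z) \<le> max K 0 * norm z ^ Suc N" if "norm z < s" for z
      proof -
        have "norm (E z) \<le> max K 0 * norm z ^ Suc 1"
          using K that mult_right_mono[of K "max K 0" "norm z ^ Suc 1"] by fastforce
        also have "\<dots> \<le> max K 0 * norm z ^ Suc N"
          using False s1(4)[OF that] by (intro mult_left_mono power_decreasing) auto
        finally show ?thesis .
      qed
      thus ?thesis by blast
    qed
  qed
  ultimately have "E z = 0" using holomorphic_flat_eq_0[of E s z] s0 z by blast
  thus ?thesis by (simp add: E_def)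
qed

text \<open>Complex differentiability on a polydisc. Continuity of \<open>Gb\<close> is the
  condition for differentiating the Cauchy integral in \<open>a\<close> with respect to
  \<open>b\<close>.\<close>

definition has_partials ::
  "(complex \<Rightarrow> complex \<Rightarrow> complex) \<Rightarrow> (complex \<Rightarrow> complex \<Rightarrow> complex) \<Rightarrow> (complex \<Rightarrow> complex \<Rightarrow> complex) \<Rightarrow> real \<Rightarrow> bool" where
  "has_partials G Ga Gb R \<longleftrightarrow>
     (\<forall>a b. norm a < R \<longrightarrow> norm b < R \<longrightarrow>
        ((\<lambda>(u, v). G u v) has_derivative (\<lambda>(u, v). Ga a b * u + Gb a b * v)) (at (a, b))) \<and>
     continuous_on (ball 0 R \<times> ball 0 R) (\<lambda>(a, b). Gb a b)"

lemma has_partials_chain: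
  assumes G: "has_partials G Ga Gb R" and f: "(f has_field_derivative f') (at z)"
    and g: "(g has_field_derivative g') (at z)" and "norm (f z) < R" "norm (g z) < R"
  shows "((\<lambda>z. G (f z) (g z)) has_field_derivative Ga (f z) (g z) * f' + Gb (f z) (g z) * g') (at z)"
proof -
  have "((\<lambda>(u, v). G u v) has_derivative (\<lambda>(u, v). Ga (f z) (g z) * u + Gb (f z) (g z) * v)) (at (f z, g z))"
    using assms by (auto simp: has_partials_def)
  moreover have "((\<lambda>z. (f z, g z)) has_derivative (\<lambda>h. (f' * h, g' * h))) (at z)"
    using f g by (intro has_derivative_Pair) (auto simp: has_field_derivative_def)
  ultimately have "((\<lambda>(u, v). G u v) \<circ> (\<lambda>z. (f z, g z)) has_derivative
      (\<lambda>(u, v). Ga (f z) (g z) * u + Gb (f z) (g z) * v) \<circ> (\<lambda>h. (f' * h, g' * h))) (at z)"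
    by (rule diff_chain_at[rotated])
  moreover have "(\<lambda>(u, v). Ga (f z) (g z) * u + Gb (f z) (g z) * v) \<circ> (\<lambda>h. (f' * h, g' * h))
      = (*) (Ga (f z) (g z) * f' + Gb (f z) (g z) * g')"
    by (auto simp: fun_eq_iff algebra_simps)
  ultimately show ?thesis by (simp add: has_field_derivative_def o_def)
qed

lemma has_partials_1:
  assumes "has_partials G Ga Gb R" "norm a < R" "norm b < R"
  shows "((\<lambda>a. G a b) has_field_derivative Ga a b) (at a)"
  using has_partials_chain[OF assms(1), of "\<lambda>a. a" 1 a "\<lambda>_. b" 0] assms(2,3) by simp

lemma has_partials_2:
  assumes "has_partials G Ga Gb R" "norm a < R" "norm b < R"
  shows "((\<lambda>b. G a b) has_field_derivative Gb a b) (at b)"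
  using has_partials_chain[OF assms(1), of "\<lambda>_. a" 0 b "\<lambda>b. b" 1] assms(2,3) by simp

lemma has_partials_holomorphic_1:
  assumes "has_partials G Ga Gb R" "norm b < R"
  shows "(\<lambda>a. G a b) holomorphic_on ball 0 R"
  unfolding holomorphic_on_open[OF open_ball] using has_partials_1[OF assms(1) _ assms(2)]
  by (intro ballI exI) auto

lemma has_partials_compose_holomorphic:
  assumes "has_partials G Ga Gb R" "f holomorphic_on S" "g holomorphic_on S" "open S"
    "\<And>z. z \<in> S \<Longrightarrow> norm (f z) < R" "\<And>z. z \<in> S \<Longrightarrow> norm (g z) < R"
  shows "(\<lambda>z. G (f z) (g z)) holomorphic_on S"
  unfolding holomorphic_on_open[OF assms(4)]
proof
  fix z assume z: "z \<in> S"
  have "(f has_field_derivative deriv f z) (at z)" "(g has_field_derivative deriv g z) (at z)"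
    using assms z by (auto intro: holomorphic_derivI)
  from has_partials_chain[OF assms(1) this] z assms
  show "\<exists>f'. ((\<lambda>z. G (f z) (g z)) has_field_derivative f') (at z)" by blast
qed

lemma has_partials_bounded:
  assumes "has_partials G Ga Gb R" "r < R"
  obtains M where "0 \<le> M" "\<And>a b. norm a \<le> r \<Longrightarrow> norm b \<le> r \<Longrightarrow> norm (G a b) \<le> M"
proof -
  have "continuous_on (cball 0 r \<times> cball 0 r) (\<lambda>(u, v). G u v)"
  proof (rule continuous_at_imp_continuous_on, rule ballI)
    fix x :: "complex \<times> complex" assume "x \<in> cball 0 r \<times> cball 0 r"
    then obtain a b where "x = (a, b)" "norm a < R" "norm b < R" using assms(2) by auto
    thus "isCont (\<lambda>(u, v). G u v) x"
      using assms(1) unfolding has_partials_def by (blast intro: has_derivative_continuous)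
  qed
  hence "compact ((\<lambda>(u, v). G u v) ` (cball 0 r \<times> cball 0 r))"
    by (intro compact_continuous_image compact_Times compact_cball)
  then obtain M where "\<And>y. y \<in> (\<lambda>(u, v). G u v) ` (cball 0 r \<times> cball 0 r) \<Longrightarrow> norm y \<le> M"
    using compact_imp_bounded bounded_iff by metis
  hence "norm (G a b) \<le> max 0 M" if "norm a \<le> r" "norm b \<le> r" for a b
    using that by (force simp: le_max_iff_disj)
  thus ?thesis by (intro that[of "max 0 M"]) auto
qed

text \<open>The product growth \<open>C ^ n\<close> and the majorant bound \<open>B ^ n\<close>
  combine to \<open>D ^ n\<close>, so the formal curve converges. The condition
  \<open>norm L \<le> 1\<close> keeps \<open>L * z\<close> in the disc of convergence.\<close>

theorem invariant_disc:
  fixes G H Ga Gb Ha Hb :: "complex \<Rightarrow> complex \<Rightarrow> complex"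
  assumes L: "good_divisors L" "norm L \<le> 1" and R: "0 < R"
    and G: "has_partials G Ga Gb R" "G 0 0 = 0" "Ga 0 0 = L" "Gb 0 0 = 0"
    and H: "has_partials H Ha Hb R" "H 0 0 = 0" "Ha 0 0 = 0" "Hb 0 0 = 1"
  obtains s f g where "0 < s" "f holomorphic_on ball 0 s" "g holomorphic_on ball 0 s"
    "f 0 = 0" "g 0 = 0" "deriv f 0 = 1"
    "\<And>z. norm z < s \<Longrightarrow> norm (f z) < R \<and> norm (g z) < R"
    "\<And>z. norm z < s \<Longrightarrow> G (f z) (g z) = f (L * z) \<and> H (f z) (g z) = g (L * z)"
proof -
  define c where "c = (\<lambda>i j. taylor_coeff (\<lambda>b. taylor_coeff (\<lambda>a. G a b) i) j)"
  define d where "d = (\<lambda>i j. taylor_coeff (\<lambda>b. taylor_coeff (\<lambda>a. H a b) i) j)"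
  define r where "r = R / 2"
  have r: "0 < r" "r < R" using R by (simp_all add: r_def)
  obtain M1 where M1: "0 \<le> M1" "\<And>a b. norm a \<le> r \<Longrightarrow> norm b \<le> r \<Longrightarrow> norm (G a b) \<le> M1"
    using has_partials_bounded[OF G(1) r(2)] by blast
  obtain M2 where M2: "0 \<le> M2" "\<And>a b. norm a \<le> r \<Longrightarrow> norm b \<le> r \<Longrightarrow> norm (H a b) \<le> M2"
    using has_partials_bounded[OF H(1) r(2)] by blast
  define M where "M = max M1 M2"
  have M: "0 \<le> M" "\<And>a b. norm a \<le> r \<Longrightarrow> norm b \<le> r \<Longrightarrow> norm (G a b) \<le> M"
    "\<And>a b. norm a \<le> r \<Longrightarrow> norm b \<le> r \<Longrightarrow> norm (H a b) \<le> M"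
    using M1 M2 by (auto simp: M_def le_max_iff_disj)
  have hol: "(\<lambda>b. taylor_coeff (\<lambda>a. G a b) n) holomorphic_on ball 0 R"
    if "has_partials G Ga Gb R" for G Ga Gb n
    using that has_partials_def
    by (intro holomorphic_taylor_coeff[OF R has_partials_holomorphic_1[OF that] has_partials_2[OF that]]) auto
  have tG1: "norm (c i j) \<le> M / r ^ (i + j)" and tH1: "norm (d i j) \<le> M / r ^ (i + j)" for i j
    unfolding c_def d_def
    by (rule taylor_tail_two_variables(1)[OF has_partials_holomorphic_1[OF G(1)] hol[OF G(1)] r M(2)]
        taylor_tail_two_variables(1)[OF has_partials_holomorphic_1[OF H(1)] hol[OF H(1)] r M(3)]; assumption)+
  have tG2: "norm (G a b - (\<Sum>i\<le>N. \<Sum>j\<le>N. c i j * a ^ i * b ^ j)) \<le> 6 * M * (t / r) ^ Suc N"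
    if "norm a \<le> t" "norm b \<le> t" "t \<le> r / 2" for a b t N
    unfolding c_def
    by (rule taylor_tail_two_variables(2)[OF has_partials_holomorphic_1[OF G(1)] hol[OF G(1)] r M(2) that])
  have tH2: "norm (H a b - (\<Sum>i\<le>N. \<Sum>j\<le>N. d i j * a ^ i * b ^ j)) \<le> 6 * M * (t / r) ^ Suc N"
    if "norm a \<le> t" "norm b \<le> t" "t \<le> r / 2" for a b t N
    unfolding d_def
    by (rule taylor_tail_two_variables(2)[OF has_partials_holomorphic_1[OF H(1)] hol[OF H(1)] r M(3) that])
  have deriv_at: "deriv h 0 = h'" if "(h has_field_derivative h') (at 0)" for h :: "complex \<Rightarrow> complex" and h'
    using that by (rule DERIV_imp_deriv)
  have c: "c 0 0 = 0" "c 1 0 = L" "c 0 1 = 0" and d: "d 0 0 = 0" "d 1 0 = 0" "d 0 1 = 1"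
    using G H R has_partials_1[OF G(1), of 0 0] has_partials_2[OF G(1), of 0 0]
      has_partials_1[OF H(1), of 0 0] has_partials_2[OF H(1), of 0 0]
    by (auto simp: c_def d_def taylor_coeff_def dest!: DERIV_imp_deriv)
  have L0: "\<not> root_of_unity L" "L \<noteq> 0" using L by (auto simp: good_divisors_def)
  obtain C where C: "1 \<le> C" "\<And>k. split_product (divisor L) k \<le> C ^ k"
    using L by (auto simp: good_divisors_def)
  define x y where "x = curve_x L c d" and "y = curve_y L c d"
  obtain B where B: "1 \<le> B" "\<And>n. norm (x n) \<le> split_product (divisor L) n * B ^ n"
      "\<And>n. norm (y n) \<le> split_product (divisor L) n * B ^ n"
    using curve_coefficients_bound[OF L0 M(1) r(1) tG1 tH1] unfolding x_def y_def by blast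
  define D where "D = C * B"
  have D: "1 \<le> D" using C(1) B(1) mult_mono[of 1 C 1 B] by (simp add: D_def)
  have "split_product (divisor L) n * B ^ n \<le> D ^ n" for n
    unfolding D_def power_mult_distrib using C B by (intro mult_right_mono) auto
  hence xD: "norm (x n) \<le> D ^ n" and yD: "norm (y n) \<le> D ^ n" for n
    using B(2,3)[of n] order_trans by blast+
  have xy0: "x 0 = 0" "y 0 = 0" by (simp_all add: x_def y_def)
  define X where "X = (\<lambda>N. \<Sum>n\<le>N. monom (x n) n)"
  define Y where "Y = (\<lambda>N. \<Sum>n\<le>N. monom (y n) n)"
  have XY: "X N = fst (curve_poly L c d N)" "Y N = snd (curve_poly L c d N)" for N
    by (rule poly_eqI, simp add: X_def Y_def coeff_sum coeff_curve_poly x_def y_def)+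
  have cX: "coeff (X N) n = (if n \<le> N then x n else 0)" "coeff (Y N) n = (if n \<le> N then y n else 0)" for N n
    by (simp_all add: XY coeff_curve_poly x_def y_def)
  have low: "coeff (poly_subst e N (X N) (Y N)) k = 0" if "k \<le> 1" for e N k
    using coeff_monomial_eq_0[of "X N" "Y N" k] that xy0
    by (auto simp: poly_subst_def coeff_sum cX intro!: sum.neutral)
  have eqG: "coeff (smult (c 1 0) (X N) + smult (c 0 1) (Y N) + poly_subst c N (X N) (Y N)) k = L ^ k * x k"
    and eqH: "coeff (smult (d 1 0) (X N) + smult (d 0 1) (Y N) + poly_subst d N (X N) (Y N)) k = L ^ k * y k"
    if k: "k \<le> N" for k N
  proof -
    have "coeff (smult (c 1 0) (X N) + smult (c 0 1) (Y N) + poly_subst c N (X N) (Y N)) k = L ^ k * x k \<and>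
      coeff (smult (d 1 0) (X N) + smult (d 0 1) (Y N) + poly_subst d N (X N) (Y N)) k = L ^ k * y k"
    proof (cases "k \<le> 1")
      case True
      then have "k = 0 \<or> k = Suc 0" by auto
      then show ?thesis using low[OF True] k c d by (auto simp: cX x_def y_def)
    next
      case False
      hence "L ^ k \<noteq> L" "L ^ k \<noteq> 1" using divisor_pos[OF L0, of k] by (auto simp: divisor_def)
      with curve_functional_equation(1)[of k N L c d] curve_functional_equation(2)[of k N L d c] False k c d
      show ?thesis by (simp add: XY coeff_curve_poly algebra_simps flip: x_def y_def)
    qed
    thus "coeff (smult (c 1 0) (X N) + smult (c 0 1) (Y N) + poly_subst c N (X N) (Y N)) k = L ^ k * x k"
      "coeff (smult (d 1 0) (X N) + smult (d 0 1) (Y N) + poly_subst d N (X N) (Y N)) k = L ^ k * y k" by auto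
  qed
  \<comment> \<open>Here a series without constant term is at most
    \<open>2 * D * norm z \<le> r / 2\<close>, which stays in the range of the Taylor estimates
    \<open>tG2\<close> and \<open>tH2\<close>.\<close>
  define s where "s = min (1 / (2 * D)) (r / (4 * D))"
  have s: "0 < s" using D r by (simp add: s_def)
  define f where "f = (\<lambda>(w :: nat \<Rightarrow> complex) z. \<Sum>n. w n * z ^ n)"
  have sums: "(\<lambda>n. w n * z ^ n) sums f w z" and small: "w 0 = 0 \<Longrightarrow> norm (f w z) \<le> r / 2"
    if "norm z < s" "\<And>n. norm (w n) \<le> D ^ n" for w z
  proof -
    have z: "norm z \<le> 1 / (2 * D)" "norm z \<le> r / (4 * D)" using that(1) by (simp_all add: s_def)
    show "(\<lambda>n. w n * z ^ n) sums f w z"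
      using power_series_tail(1)[OF that(2) D order_refl z(1)] by (simp add: f_def)
    assume "w 0 = 0"
    hence "norm (f w z) \<le> 2 * (D * norm z)"
      using power_series_tail(2)[OF that(2) D order_refl z(1), of 0] by (simp add: f_def)
    also have "\<dots> \<le> r / 2" using z(2) D by (simp add: field_simps)
    finally show "norm (f w z) \<le> r / 2" .
  qed
  have holf: "f w holomorphic_on ball 0 s" if "\<And>n. norm (w n) \<le> D ^ n" for w
    by (rule power_series_holomorphic[where a = w]) (use sums[OF _ that] in simp)
  have fR: "norm (f x z) < R" "norm (f y z) < R" if "norm z < s" for z
    using small[OF that xD xy0(1)] small[OF that yD xy0(2)] r by linarith+
  have comp: "(\<lambda>z. G (f x z) (f y z)) holomorphic_on ball 0 s" "(\<lambda>z. H (f x z) (f y z)) holomorphic_on ball 0 s"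
    using fR by (intro has_partials_compose_holomorphic[OF G(1) holf[OF xD] holf[OF yD]]
      has_partials_compose_holomorphic[OF H(1) holf[OF xD] holf[OF yD]]; simp)+
  have eq1: "G (f x z) (f y z) = f x (L * z)" if "norm z < s" for z
    using curve_component[of D x y x L r G c M s z, OF D xD yD xD xy0 L(2) r(1) tG2 c(1) _ s_def _ that]
      eqG comp(1) unfolding f_def X_def Y_def by blast
  have eq2: "H (f x z) (f y z) = f y (L * z)" if "norm z < s" for z
    using curve_component[of D x y y L r H d M s z, OF D xD yD yD xy0 L(2) r(1) tH2 d(1) _ s_def _ that]
      eqH comp(2) unfolding f_def X_def Y_def by blast
  have "deriv (f x) 0 = x 1"
  proof -
    have "((\<lambda>z. \<Sum>n. x n * z ^ n) has_field_derivative (\<Sum>n. diffs x n * 0 ^ n)) (at 0)"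
    proof (rule termdiffs_strong)
      show "summable (\<lambda>n. x n * (of_real (s / 2)) ^ n)"
        using sums[of "of_real (s / 2)" x] xD s by (auto intro: sums_summable)
    qed (use s in auto)
    hence "deriv (f x) 0 = (\<Sum>n. diffs x n * 0 ^ n)" unfolding f_def by (rule DERIV_imp_deriv)
    thus ?thesis by (simp add: diffs_def)
  qed
  hence "deriv (f x) 0 = 1" by (simp add: x_def)
  moreover have "f x 0 = 0" "f y 0 = 0" using xy0 by (simp_all add: f_def)
  ultimately show ?thesis
    using that[OF s holf[OF xD] holf[OF yD]] fR eq1 eq2 by blast
qed

section \<open>Holomorphic maps of the plane\<close>

definition jac :: "(complex^2 \<Rightarrow> complex^2) \<Rightarrow> complex^2 \<Rightarrow> complex^2^2" where
  "jac F x = matrix (frechet_derivative F (at x))"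

lemma jac_eqI:
  assumes "(F has_derivative (\<lambda>v. A *v v)) (at x)"
  shows "jac F x = A"
  unfolding jac_def using frechet_derivative_at[OF assms] by (metis matrix_of_matrix_vector_mul)

lemma has_derivative_jac:
  assumes "holomorphic_map_on F U" "x \<in> U"
  shows "(F has_derivative (\<lambda>v. jac F x *v v)) (at x)"
proof -
  obtain D where D: "(F has_derivative D) (at x)" "Vector_Spaces.linear (*s) (*s) D"
    using assms unfolding holomorphic_map_on_def by blast
  have "D = frechet_derivative F (at x)" using D(1) by (rule frechet_derivative_at)
  hence "jac F x = matrix D" by (simp add: jac_def)
  hence "D = (\<lambda>v. jac F x *v v)" using matrix_works[OF D(2)] by auto
  thus ?thesis using D by simp
qed

lemma holomorphic_map_onI:
  assumes "\<And>x. x \<in> U \<Longrightarrow> (F has_derivative (\<lambda>v. A x *v v)) (at x)"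
  shows "holomorphic_map_on F U"
  unfolding holomorphic_map_on_def using assms matrix_vector_mul_linear_gen by blast

lemma holomorphic_map_on_subset:
  "holomorphic_map_on F U \<Longrightarrow> V \<subseteq> U \<Longrightarrow> holomorphic_map_on F V"
  unfolding holomorphic_map_on_def by blast

lemma holomorphic_map_on_imp_continuous_on:
  fixes F :: "complex^2 \<Rightarrow> complex^2"
  assumes "holomorphic_map_on F U"
  shows "continuous_on U F"
  using has_derivative_jac[OF assms] by (auto intro!: continuous_at_imp_continuous_on has_derivative_continuous)

lemma has_derivative_compose_jac:
  assumes "(F has_derivative (\<lambda>v. A *v v)) (at x)" "(G has_derivative (\<lambda>v. B *v v)) (at (F x))"
  shows "((\<lambda>x. G (F x)) has_derivative (\<lambda>v. (B ** A) *v v)) (at x)"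
  using has_derivative_compose[OF assms] by (simp add: matrix_vector_mul_assoc)

lemma norm_vector_smult: "norm (c *s (v :: complex^2)) = norm c * norm v"
  by (simp add: norm_vec_def norm_mult L2_set_right_distrib)

lemma bounded_linear_smult_left: "bounded_linear (\<lambda>c. c *s (v :: complex^2))"
proof
  show "\<exists>K. \<forall>x. norm (x *s v) \<le> norm x * K" by (auto simp: norm_vector_smult intro!: exI[of _ "norm v"])
qed (auto simp: vec_eq_iff algebra_simps)

lemma norm_vec2_le: "norm (x :: complex^2) \<le> norm (x $ 1) + norm (x $ 2)"
  unfolding norm_vec_def L2_set_def UNIV_2 by (simp add: sqrt_sum_squares_le_sum)

lemma norm_matrix_vector_le:
  fixes A :: "complex^2^2"
  assumes "\<And>i j. norm (A $ i $ j) \<le> e"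
  shows "norm (A *v v) \<le> 4 * e * norm v"
proof -
  have e: "0 \<le> e" using assms[of 1 1] norm_ge_zero order_trans by blast
  have "norm ((A *v v) $ i) \<le> 2 * e * norm v" for i
  proof -
    have "norm ((A *v v) $ i) \<le> norm (A $ i $ 1) * norm (v $ 1) + norm (A $ i $ 2) * norm (v $ 2)"
      unfolding matrix_vector_mult_def UNIV_2 by (simp add: norm_triangle_ineq norm_mult[symmetric])
    also have "\<dots> \<le> e * norm v + e * norm v"
      using assms e by (intro add_mono mult_mono Finite_Cartesian_Product.norm_nth_le) auto
    finally show ?thesis by simp
  qed
  from this[of 1] this[of 2] norm_vec2_le[of "A *v v"] show ?thesis by linarith
qed

lemma matrix_entry_eq: "(A *v axis j 1) $ i = (A :: complex^2^2) $ i $ j"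
  by (simp add: matrix_vector_mult_def axis_def if_distrib cong: if_cong)

text \<open>\<open>holomorphic_map_on\<close> demands differentiability only, so continuity of the
  derivative has to be gained from Cauchy's inequality. It is applied to the difference
  \<open>h\<close> of \<open>F\<close> along parallel complex lines through \<open>x\<close> and
  \<open>y\<close>, which is small by uniform continuity and whose derivative at 0 is the difference
  of the matrix entries.\<close>

lemma isCont_jac:
  assumes hol: "holomorphic_map_on F U" and U: "open U" and y: "y \<in> U" and e: "0 < e"
  shows "\<exists>d>0. \<forall>x. dist x y < d \<longrightarrow> x \<in> U \<and> (\<forall>i j. norm ((jac F x - jac F y) $ i $ j) \<le> e)"
proof -
  obtain r0 where r0: "0 < r0" "cball y r0 \<subseteq> U" using U y open_contains_cball by blast
  define r where "r = r0 / 2"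
  have r: "0 < r" "cball y (2 * r) \<subseteq> U" using r0 by (simp_all add: r_def)
  have "continuous_on (cball y (2 * r)) F"
    using holomorphic_map_on_imp_continuous_on[OF hol] r(2) by (rule continuous_on_subset)
  hence "uniformly_continuous_on (cball y (2 * r)) F"
    by (rule compact_uniformly_continuous) simp
  then obtain d where d: "0 < d"
    "\<And>p q. p \<in> cball y (2 * r) \<Longrightarrow> q \<in> cball y (2 * r) \<Longrightarrow> dist q p < d \<Longrightarrow> dist (F q) (F p) < e * r"
    unfolding uniformly_continuous_on_def using mult_pos_pos[OF e r(1)] by blast
  have "norm ((jac F x - jac F y) $ i $ j) \<le> e" if x: "dist x y < min d r" for x i j
  proof -
    define v :: "complex^2" where "v = axis j 1"
    have nv: "norm v = 1" by (simp add: v_def)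
    define h where "h = (\<lambda>t. F (x + t *s v) $ i - F (y + t *s v) $ i)"
    have in_ball: "x + t *s v \<in> cball y (2 * r)" "y + t *s v \<in> cball y (2 * r)" if "norm t \<le> r" for t
    proof -
      have "norm (x - y + t *s v) \<le> norm (x - y) + norm (t *s v)" by (rule norm_triangle_ineq)
      moreover have "norm (x - y) < r" using x by (simp add: dist_norm)
      ultimately have "norm (x - y + t *s v) \<le> 2 * r" using that nv by (simp add: norm_vector_smult)
      moreover have "dist y (x + t *s v) = norm (x - y + t *s v)"
        unfolding dist_norm by (subst norm_minus_commute) (simp add: algebra_simps)
      ultimately show "x + t *s v \<in> cball y (2 * r)" by simp
      show "y + t *s v \<in> cball y (2 * r)" using that nv r(1) by (simp add: dist_norm norm_vector_smult)
    qed
    have der: "((\<lambda>t. F (p + t *s v) $ i) has_field_derivative (jac F (p + t *s v) *v v) $ i) (at t)"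
      if "p + t *s v \<in> U" for p t
    proof -
      have "((\<lambda>t. p + t *s v) has_derivative (\<lambda>t. t *s v)) (at t)"
        by (auto intro!: derivative_eq_intros bounded_linear.has_derivative[OF bounded_linear_smult_left])
      from has_derivative_compose[OF this has_derivative_jac[OF hol that]]
      have "((\<lambda>t. F (p + t *s v) $ i) has_derivative (\<lambda>h. (jac F (p + t *s v) *v (h *s v)) $ i)) (at t)"
        by (rule bounded_linear.has_derivative[OF bounded_linear_vec_nth])
      moreover have "(\<lambda>h. (jac F (p + t *s v) *v (h *s v)) $ i) = (*) ((jac F (p + t *s v) *v v) $ i)"
        by (simp add: fun_eq_iff vector_scalar_commute mult.commute)
      ultimately show ?thesis by (simp only: has_field_derivative_def)
    qed
    have dh: "(h has_field_derivative ((jac F (x + t *s v) *v v) $ i - (jac F (y + t *s v) *v v) $ i)) (at t)"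
      if "norm t \<le> r" for t
      unfolding h_def using in_ball[OF that] r(2) by (intro derivative_intros der) auto
    have "norm ((deriv ^^ 1) h 0) \<le> fact 1 * (e * r) / r ^ 1"
    proof (rule Cauchy_inequality)
      show "h holomorphic_on ball 0 r"
        unfolding holomorphic_on_open[OF open_ball]
      proof
        show "\<exists>h'. (h has_field_derivative h') (at t)" if "t \<in> ball 0 r" for t
          using dh[of t] that by auto
      qed
      show "continuous_on (cball 0 r) h"
      proof (rule continuous_at_imp_continuous_on, rule ballI)
        show "isCont h t" if "t \<in> cball 0 r" for t
          using DERIV_isCont[OF dh[of t]] that by simp
      qed
      show "norm (h t) \<le> e * r" if "norm (0 - t) = r" for t
      proof -
        have t: "norm t \<le> r" using that by simp
        have "dist (x + t *s v) (y + t *s v) < d" using x by (simp add: dist_norm)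
        hence "norm (F (x + t *s v) - F (y + t *s v)) < e * r"
          using d(2)[OF in_ball(2)[OF t] in_ball(1)[OF t]] by (simp add: dist_norm)
        moreover have "norm (h t) \<le> norm (F (x + t *s v) - F (y + t *s v))"
          unfolding h_def vector_minus_component[symmetric] by (rule Finite_Cartesian_Product.norm_nth_le)
        ultimately show ?thesis by linarith
      qed
    qed (use r in auto)
    hence "norm (deriv h 0) \<le> e" using r by simp
    moreover have "deriv h 0 = (jac F x *v v) $ i - (jac F y *v v) $ i"
      using dh[of 0] r by (intro DERIV_imp_deriv) simp
    ultimately show ?thesis by (simp add: v_def matrix_entry_eq)
  qed
  moreover have "x \<in> U" if "dist x y < min d r" for x
    using that r by (auto simp: dist_commute subset_iff)
  ultimately show ?thesis using d(1) r(1) by (intro exI[of _ "min d r"]) auto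
qed

lemma continuous_on_jac_entry:
  assumes "holomorphic_map_on F U" "open U"
  shows "continuous_on U (\<lambda>x. jac F x $ i $ j)"
  unfolding continuous_on_iff
proof (intro ballI allI impI)
  fix y and e :: real assume y: "y \<in> U" and e: "0 < e"
  obtain d where d: "0 < d" "\<And>x i j. dist x y < d \<Longrightarrow> norm ((jac F x - jac F y) $ i $ j) \<le> e / 2"
    using isCont_jac[OF assms y, of "e / 2"] e by auto
  have "dist (jac F x $ i $ j) (jac F y $ i $ j) < e" if "dist x y < d" for x
    using d(2)[OF that, of i j] e by (simp add: dist_norm)
  thus "\<exists>d>0. \<forall>x\<in>U. dist x y < d \<longrightarrow> dist (jac F x $ i $ j) (jac F y $ i $ j) < e" using d(1) by blast
qed

lemma continuous_on_jac_mult: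
  assumes "holomorphic_map_on F U" "open U"
  shows "continuous_on U (\<lambda>x. jac F x *v v)"
proof -
  have "(\<lambda>x. jac F x *v v) = (\<lambda>x. \<chi> i. \<Sum>j\<in>UNIV. jac F x $ i $ j * v $ j)"
    by (simp add: matrix_vector_mult_def fun_eq_iff)
  thus ?thesis
    by (simp only:) (intro continuous_on_vec_lambda continuous_on_sum continuous_on_mult continuous_on_const
      continuous_on_jac_entry[OF assms])
qed

lemma continuous_on_jac:
  assumes "holomorphic_map_on F U" "open U"
  shows "continuous_on U (jac F)"
proof -
  have "continuous_on U (\<lambda>x. \<chi> i j. jac F x $ i $ j)"
    by (intro continuous_on_vec_lambda continuous_on_jac_entry[OF assms])
  thus ?thesis by simp
qed

lemma continuous_on_det_jac:
  assumes "holomorphic_map_on F U" "open U"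
  shows "continuous_on U (\<lambda>x. det (jac F x))" "continuous_on U (\<lambda>x. det (jac F x - mat 1))"
  unfolding det_2 using continuous_on_jac[OF assms] by (auto intro!: continuous_intros)

text \<open>The mean value inequality for \<open>F\<close> minus its derivative at \<open>y\<close>.
  That both points vary is essential for comparing the two neighbouring orbits in a telescoping
  sum.\<close>

lemma strictly_differentiable_jac:
  assumes hol: "holomorphic_map_on F U" and U: "open U" and y: "y \<in> U" and e: "0 < e"
  shows "\<exists>d>0. ball y d \<subseteq> U \<and> (\<forall>a\<in>ball y d. \<forall>b\<in>ball y d. norm (F a - F b - jac F y *v (a - b)) \<le> e * norm (a - b))"
proof -
  obtain d where d: "0 < d" "\<And>x. dist x y < d \<Longrightarrow> x \<in> U"
    "\<And>x i j. dist x y < d \<Longrightarrow> norm ((jac F x - jac F y) $ i $ j) \<le> e / 4"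
    using isCont_jac[OF assms(1-3), of "e / 4"] e by auto
  have "norm ((\<lambda>x. F x - jac F y *v x) a - (\<lambda>x. F x - jac F y *v x) b) \<le> e * norm (a - b)"
    if "a \<in> ball y d" "b \<in> ball y d" for a b
  proof (rule differentiable_bound[of "ball y d"])
    fix x assume "x \<in> ball y d"
    hence x: "dist x y < d" by (simp add: dist_commute)
    show "((\<lambda>x. F x - jac F y *v x) has_derivative (\<lambda>v. (jac F x - jac F y) *v v)) (at x within ball y d)"
      unfolding matrix_vector_mult_diff_rdistrib
      by (rule has_derivative_at_withinI)
        (intro has_derivative_diff has_derivative_jac[OF hol d(2)[OF x]]
          bounded_linear_imp_has_derivative matrix_vector_mul_bounded_linear)
    show "onorm (\<lambda>v. (jac F x - jac F y) *v v) \<le> e"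
      using norm_matrix_vector_le[OF d(3)[OF x]] by (intro onorm_le) auto
  qed (use that in auto)
  hence "norm (F a - F b - jac F y *v (a - b)) \<le> e * norm (a - b)"
    if "a \<in> ball y d" "b \<in> ball y d" for a b
    using that by (simp add: matrix_vector_mult_diff_distrib algebra_simps)
  moreover have "ball y d \<subseteq> U" using d(2) by (auto simp: dist_commute)
  ultimately show ?thesis using d(1) by blast
qed

section \<open>Eigenvalues and eigenvectors of complex 2 x 2 matrices\<close>

lemma exists_kernel_vector:
  fixes A :: "complex^2^2"
  assumes "det A = 0"
  obtains v where "v \<noteq> 0" "A *v v = 0"
  using assms matrix_left_invertible_ker[of A] invertible_det_nz[of A] invertible_left_inverse[of A] by blast

lemma exists_eigenvector:
  fixes A :: "complex^2^2"
  assumes "det (A - mat c) = 0"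
  obtains v where "v \<noteq> 0" "A *v v = c *s v"
proof -
  obtain v where v: "v \<noteq> 0" "(A - mat c) *v v = 0" using exists_kernel_vector[OF assms] by blast
  have "mat c *v v = c *s v"
    by (simp add: vec_eq_iff matrix_vector_mult_def mat_def if_distrib[of "\<lambda>x. x * _"] cong: if_cong)
  thus ?thesis using v that by (simp add: matrix_vector_mult_diff_rdistrib)
qed

lemma det_minus_mat: "det (A - mat c) = c\<^sup>2 - (A $ 1 $ 1 + A $ 2 $ 2) * c + det (A :: complex^2^2)"
  unfolding det_2 by (simp add: mat_def algebra_simps power2_eq_square)

text \<open>Once 1 is an eigenvalue, the determinant is the other one. This is why multipliers are
  represented by determinants, which depend continuously on the point.\<close>

lemma det_minus_mat_eq_0_iff:
  assumes "det (A - mat 1) = 0"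
  shows "det (A - mat c) = 0 \<longleftrightarrow> c = 1 \<or> c = det (A :: complex^2^2)"
proof -
  have "A $ 1 $ 1 + A $ 2 $ 2 = 1 + det A" using assms by (simp add: det_minus_mat algebra_simps)
  hence "det (A - mat c) = (c - 1) * (c - det A)"
    by (simp add: det_minus_mat power2_eq_square algebra_simps)
  thus ?thesis by simp
qed

lemma Cayley_Hamilton_2:
  fixes A :: "complex^2^2"
  shows "A *v (A *v u) - (A $ 1 $ 1 + A $ 2 $ 2) *s (A *v u) + det A *s u = 0"
  unfolding vec_eq_iff forall_2
  by (simp add: matrix_vector_mult_def UNIV_2 det_2 algebra_simps)

text \<open>The factored form of the Cayley-Hamilton theorem. It allows arguments by eigenvectors
  even if \<open>A\<close> is not diagonalizable.\<close>

lemma char_poly_splits: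
  fixes A :: "complex^2^2"
  obtains c c' where "\<And>u. A *v (A *v u - c *s u) = c' *s (A *v u - c *s u)"
proof -
  define t where "t = A $ 1 $ 1 + A $ 2 $ 2"
  define s where "s = csqrt (t\<^sup>2 - 4 * det A)"
  define c where "c = (t + s) / 2"
  define c' where "c' = (t - s) / 2"
  have s2: "s * s = t * t - 4 * det A" unfolding s_def by (metis power2_csqrt power2_eq_square)
  have cc: "c + c' = t" "c * c' = det A"
    by (simp_all add: c_def c'_def field_simps s2)
  have eq: "A *v (A *v u - c *s u) = c' *s (A *v u - c *s u)" for u
  proof -
    have "A *v (A *v u) = t *s (A *v u) - det A *s u"
      using Cayley_Hamilton_2[of A u] by (simp add: t_def algebra_simps)
    thus ?thesis unfolding matrix_vector_mult_diff_distrib vector_scalar_commute cc[symmetric]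
      by (simp add: vec_eq_iff algebra_simps)
  qed
  show ?thesis by (rule that[OF eq])
qed

lemma eigenbasis:
  fixes A :: "complex^2^2"
  assumes "det (A - mat 1) = 0" "det A = \<zeta>" "\<zeta> \<noteq> 1"
  obtains v w and \<alpha> \<beta> :: "complex^2 \<Rightarrow> complex"
  where "A *v v = \<zeta> *s v" "A *v w = w" "\<And>u. u = \<alpha> u *s v + \<beta> u *s w"
    "\<And>p q. \<alpha> (p *s v + q *s w) = p" "\<And>p q. \<beta> (p *s v + q *s w) = q"
    "bounded_linear \<alpha>" "bounded_linear \<beta>"
    "\<And>c u. \<alpha> (c *s u) = c * \<alpha> u" "\<And>c u. \<beta> (c *s u) = c * \<beta> u"
proof -
  have "det (A - mat \<zeta>) = 0" using assms det_minus_mat_eq_0_iff by simp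
  then obtain v where v: "v \<noteq> 0" "A *v v = \<zeta> *s v" using exists_eigenvector by blast
  obtain w where w: "w \<noteq> 0" "A *v w = 1 *s w" using exists_eigenvector[OF assms(1)] by blast
  \<comment> \<open>A 2 x 2 determinant; \<open>\<alpha>\<close> and \<open>\<beta>\<close> are then
    the coordinates given by Cramer's rule.\<close>
  define cross where "cross = (\<lambda>(a::complex^2) (b::complex^2). a $ 1 * b $ 2 - a $ 2 * b $ 1)"
  define \<Delta> where "\<Delta> = cross v w"
  have \<Delta>: "\<Delta> \<noteq> 0"
  proof
    assume "\<Delta> = 0"
    hence c: "v $ 1 * w $ 2 = v $ 2 * w $ 1" by (simp add: \<Delta>_def cross_def)
    have "\<exists>k. v = k *s w"
    proof (cases "w $ 1 = 0")
      case True
      hence "w $ 2 \<noteq> 0" using w(1) by (auto simp: vec_eq_iff forall_2)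
      thus ?thesis using c True by (intro exI[of _ "v $ 2 / w $ 2"]) (auto simp: vec_eq_iff forall_2)
    next
      case False
      thus ?thesis using c by (intro exI[of _ "v $ 1 / w $ 1"]) (auto simp: vec_eq_iff forall_2 field_simps)
    qed
    then obtain k where k: "v = k *s w" by blast
    have "A *v v = k *s w" using w by (simp add: k vector_scalar_commute)
    hence "\<zeta> *s v = 1 *s v" using v k by simp
    hence "(\<zeta> - 1) *s v = 0" by (simp add: vec_eq_iff algebra_simps)
    thus False using v(1) assms(3) by (simp add: vec_eq_iff)
  qed
  define \<alpha> where "\<alpha> = (\<lambda>u. cross u w / \<Delta>)"
  define \<beta> where "\<beta> = (\<lambda>u. cross v u / \<Delta>)"
  have bl: "bounded_linear (\<lambda>u :: complex^2. u $ i * c)" for i c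
    by (rule bounded_linear_mult_const[OF bounded_linear_vec_nth])
  have eqs: "\<alpha> (p *s v + q *s w) = p" "\<beta> (p *s v + q *s w) = q" for p q
  proof -
    have "cross (p *s v + q *s w) w = p * \<Delta>" "cross v (p *s v + q *s w) = q * \<Delta>"
      by (simp_all add: \<Delta>_def cross_def algebra_simps)
    thus "\<alpha> (p *s v + q *s w) = p" "\<beta> (p *s v + q *s w) = q" using \<Delta> by (simp_all add: \<alpha>_def \<beta>_def)
  qed
  have decomp: "u = \<alpha> u *s v + \<beta> u *s w" for u
  proof -
    have "\<Delta> *s u = cross u w *s v + cross v u *s w"
      unfolding vec_eq_iff forall_2 by (simp add: \<Delta>_def cross_def algebra_simps)
    hence "\<Delta> * u $ i = cross u w * v $ i + cross v u * w $ i" for i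
      by (simp add: vec_eq_iff)
    hence "u $ i = (cross u w * v $ i + cross v u * w $ i) / \<Delta>" for i
      using \<Delta> by (metis nonzero_mult_div_cancel_left)
    thus ?thesis by (simp add: vec_eq_iff \<alpha>_def \<beta>_def add_divide_distrib)
  qed
  show ?thesis
  proof (rule that[of v w \<alpha> \<beta>])
    have "\<alpha> = (\<lambda>u. u $ 1 * (w $ 2 / \<Delta>) - u $ 2 * (w $ 1 / \<Delta>))"
      by (simp add: \<alpha>_def cross_def diff_divide_distrib fun_eq_iff)
    thus "bounded_linear \<alpha>" by (simp only: bounded_linear_sub[OF bl bl])
    have "\<beta> = (\<lambda>u. u $ 2 * (v $ 1 / \<Delta>) - u $ 1 * (v $ 2 / \<Delta>))"
      by (simp add: \<beta>_def cross_def diff_divide_distrib fun_eq_iff mult.commute)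
    thus "bounded_linear \<beta>" by (simp only: bounded_linear_sub[OF bl bl])
    show "\<alpha> (c *s u) = c * \<alpha> u" "\<beta> (c *s u) = c * \<beta> u" for c u
      by (simp_all add: \<alpha>_def \<beta>_def cross_def right_diff_distrib)
  qed (use v w eqs decomp in auto)
qed

section \<open>The invariant disc at a fixed point, in coordinates of an eigenbasis\<close>

lemma has_partials_coordinates:
  fixes v w y :: "complex^2" and l :: "complex^2 \<Rightarrow> complex"
  assumes h: "holomorphic_map_on h U" and U: "open U"
    and R: "\<And>a b. norm a < R \<Longrightarrow> norm b < R \<Longrightarrow> y + a *s v + b *s w \<in> U"
    and l: "bounded_linear l" "\<And>c u. l (c *s u) = c * l u"
  shows "has_partials (\<lambda>a b. l (h (y + a *s v + b *s w) - y))
    (\<lambda>a b. l (jac h (y + a *s v + b *s w) *v v)) (\<lambda>a b. l (jac h (y + a *s v + b *s w) *v w)) R"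
  unfolding has_partials_def
proof (intro conjI allI impI)
  fix a b :: complex assume ab: "norm a < R" "norm b < R"
  define p where "p = (\<lambda>x :: complex \<times> complex. y + fst x *s v + snd x *s w)"
  define L where "L = (\<lambda>x :: complex \<times> complex. fst x *s v + snd x *s w)"
  have L: "bounded_linear L" unfolding L_def
    by (intro bounded_linear_add bounded_linear_compose[OF bounded_linear_smult_left bounded_linear_fst]
        bounded_linear_compose[OF bounded_linear_smult_left bounded_linear_snd])
  have "((\<lambda>x. y + L x) has_derivative L) (at (a, b))"
    using has_derivative_add[OF has_derivative_const bounded_linear_imp_has_derivative[OF L]] by simp
  hence p: "(p has_derivative L) (at (a, b))" by (simp add: p_def L_def add.assoc)
  have "((\<lambda>x. h (p x)) has_derivative (\<lambda>u. jac h (p (a, b)) *v L u)) (at (a, b))"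
    using R[OF ab] by (intro has_derivative_compose[OF p has_derivative_jac[OF h]]) (simp add: p_def)
  hence "((\<lambda>x. h (p x) - y) has_derivative (\<lambda>u. jac h (p (a, b)) *v L u)) (at (a, b))"
    using has_derivative_diff[OF _ has_derivative_const, of "\<lambda>x. h (p x)" _ "at (a, b)" y] by simp
  from bounded_linear.has_derivative[OF l(1) this]
  have "((\<lambda>x. l (h (p x) - y)) has_derivative (\<lambda>u. l (jac h (p (a, b)) *v L u))) (at (a, b))" .
  moreover have "l (jac h (p (a, b)) *v L u)
     = l (jac h (y + a *s v + b *s w) *v v) * fst u + l (jac h (y + a *s v + b *s w) *v w) * snd u" for u
    unfolding L_def matrix_vector_right_distrib linear_add[OF bounded_linear.linear[OF l(1)]] vector_scalar_commute l(2)
    by (simp add: p_def mult.commute)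
  ultimately show "((\<lambda>(a, b). l (h (y + a *s v + b *s w) - y)) has_derivative
      (\<lambda>(p, q). l (jac h (y + a *s v + b *s w) *v v) * p + l (jac h (y + a *s v + b *s w) *v w) * q)) (at (a, b))"
    by (simp add: case_prod_unfold p_def)
next
  have c1: "continuous_on (ball 0 R \<times> ball 0 R) (\<lambda>x. y + fst x *s v + snd x *s w)"
    by (intro continuous_on_add continuous_on_const bounded_linear.continuous_on[OF bounded_linear_smult_left]
        continuous_on_fst continuous_on_snd continuous_on_id)
  have "continuous_on (ball 0 R \<times> ball 0 R) (\<lambda>x. jac h (y + fst x *s v + snd x *s w) *v w)"
    by (rule continuous_on_compose2[OF continuous_on_jac_mult[OF h U] c1]) (auto intro: R)
  hence "continuous_on (ball 0 R \<times> ball 0 R) (\<lambda>x. l (jac h (y + fst x *s v + snd x *s w) *v w))"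
    by (rule bounded_linear.continuous_on[OF l(1)])
  thus "continuous_on (ball 0 R \<times> ball 0 R) (\<lambda>(a, b). l (jac h (y + a *s v + b *s w) *v w))"
    by (simp add: case_prod_unfold)
qed

text \<open>The coordinate of the disc along the eigenvector of the multiplier has derivative 1 at
  0, so it is injective on a smaller disc, and with it \<phi>. Injectivity is what later
  distinguishes the points of an orbit on the disc.\<close>

theorem invariant_disc_at_fixed_point:
  assumes h: "holomorphic_map_on h U" and U: "open U" "y \<in> U" and y: "h y = y"
    and J: "det (jac h y - mat 1) = 0" "good_divisors (det (jac h y))" "norm (det (jac h y)) \<le> 1"
  obtains s \<phi> where "0 < s" "\<phi> 0 = y" "continuous_on (ball 0 s) \<phi>" "inj_on \<phi> (ball 0 s)"
    "\<And>z. norm z < s \<Longrightarrow> \<phi> z \<in> U \<and> h (\<phi> z) = \<phi> (det (jac h y) * z)"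
proof -
  define \<zeta> where "\<zeta> = det (jac h y)"
  have "\<zeta> \<noteq> 1" using J(2) unfolding good_divisors_def root_of_unity_def \<zeta>_def by (metis power_one_right zero_less_one)
  show ?thesis
  proof (rule eigenbasis[OF J(1) \<zeta>_def[symmetric] \<open>\<zeta> \<noteq> 1\<close>])
    fix v w and \<alpha> \<beta> :: "complex^2 \<Rightarrow> complex"
    assume e: "jac h y *v v = \<zeta> *s v" "jac h y *v w = w"
      "\<And>u. u = \<alpha> u *s v + \<beta> u *s w" "\<And>p q. \<alpha> (p *s v + q *s w) = p" "\<And>p q. \<beta> (p *s v + q *s w) = q"
      "bounded_linear \<alpha>" "bounded_linear \<beta>" "\<And>c u. \<alpha> (c *s u) = c * \<alpha> u" "\<And>c u. \<beta> (c *s u) = c * \<beta> u"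
    obtain \<rho> where \<rho>: "0 < \<rho>" "ball y \<rho> \<subseteq> U" using U open_contains_ball by blast
    define R where "R = \<rho> / (norm v + norm w + 1)"
    have nvw: "0 < norm v + norm w + 1" using norm_ge_zero[of v] norm_ge_zero[of w] by linarith
    have R0: "0 < R" using \<rho> nvw by (simp add: R_def)
    have R: "y + a *s v + b *s w \<in> U" if "norm a < R" "norm b < R" for a b
    proof -
      have "norm (a *s v + b *s w) \<le> norm a * norm v + norm b * norm w"
        by (rule norm_triangle_le) (simp add: norm_vector_smult)
      also have "\<dots> \<le> R * norm v + R * norm w" using that by (intro add_mono mult_right_mono) auto
      also have "\<dots> < R * (norm v + norm w + 1)" using R0 by (simp add: algebra_simps)
      also have "\<dots> = \<rho>" using nvw by (simp add: R_def)
      finally have "norm (a *s v + b *s w) < \<rho>" .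
      hence "y + a *s v + b *s w \<in> ball y \<rho>"
        by (metis add.assoc add_diff_cancel_left' dist_commute dist_norm mem_ball)
      thus ?thesis using \<rho>(2) by blast
    qed
    have \<alpha>\<beta>: "\<alpha> v = 1" "\<alpha> w = 0" "\<beta> v = 0" "\<beta> w = 1" "\<alpha> 0 = 0" "\<beta> 0 = 0"
      using e(4)[of 1 0] e(4)[of 0 1] e(5)[of 1 0] e(5)[of 0 1] e(4)[of 0 0] e(5)[of 0 0] by simp_all
    define G where "G = (\<lambda>a b. \<alpha> (h (y + a *s v + b *s w) - y))"
    define H where "H = (\<lambda>a b. \<beta> (h (y + a *s v + b *s w) - y))"
    define Ga where "Ga = (\<lambda>a b. \<alpha> (jac h (y + a *s v + b *s w) *v v))"
    define Gb where "Gb = (\<lambda>a b. \<alpha> (jac h (y + a *s v + b *s w) *v w))"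
    define Ha where "Ha = (\<lambda>a b. \<beta> (jac h (y + a *s v + b *s w) *v v))"
    define Hb where "Hb = (\<lambda>a b. \<beta> (jac h (y + a *s v + b *s w) *v w))"
    have PG: "has_partials G Ga Gb R" unfolding G_def Ga_def Gb_def
      using has_partials_coordinates[OF h U(1), of R y v w \<alpha>] R e(6,8) by blast
    have PH: "has_partials H Ha Hb R" unfolding H_def Ha_def Hb_def
      using has_partials_coordinates[OF h U(1), of R y v w \<beta>] R e(7,9) by blast
    have G0: "G 0 0 = 0" "Ga 0 0 = \<zeta>" "Gb 0 0 = 0" and H0: "H 0 0 = 0" "Ha 0 0 = 0" "Hb 0 0 = 1"
    proof -
      have y0: "y + 0 *s v + 0 *s w = y" by simp
      show "G 0 0 = 0" "H 0 0 = 0" unfolding G_def H_def y0 y by (simp_all only: \<alpha>\<beta> diff_self)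
      show "Ga 0 0 = \<zeta>" "Ha 0 0 = 0" unfolding Ga_def Ha_def y0 e(1) e(8,9) \<alpha>\<beta> by simp_all
      show "Gb 0 0 = 0" "Hb 0 0 = 1" unfolding Gb_def Hb_def y0 e(2) \<alpha>\<beta> by simp_all
    qed
    show ?thesis
    proof (rule invariant_disc[OF J(2,3)[folded \<zeta>_def] R0 PG G0 PH H0])
      fix s :: real and f g :: "complex \<Rightarrow> complex"
      assume fg: "0 < s" "f holomorphic_on ball 0 s" "g holomorphic_on ball 0 s"
        "f 0 = 0" "g 0 = 0" "deriv f 0 = 1"
        "\<And>z. norm z < s \<Longrightarrow> norm (f z) < R \<and> norm (g z) < R"
        "\<And>z. norm z < s \<Longrightarrow> G (f z) (g z) = f (\<zeta> * z) \<and> H (f z) (g z) = g (\<zeta> * z)"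
      have s0: "0 \<in> ball (0 :: complex) s" and df: "deriv f 0 \<noteq> 0" using fg(1,6) by simp_all
      have "\<exists>r>0. ball 0 r \<subseteq> ball (0 :: complex) s \<and> inj_on f (ball 0 r)"
        by (rule has_complex_derivative_locally_injective[OF fg(2) s0 open_ball df]) (intro exI conjI)
      then obtain r where r: "0 < r" "ball 0 r \<subseteq> ball (0 :: complex) s" "inj_on f (ball 0 r)" by (elim exE conjE)
      define \<phi> where "\<phi> = (\<lambda>z. y + f z *s v + g z *s w)"
      have rs: "norm z < s" if "norm z < r" for z :: complex using r(2) that by (auto simp: subset_iff)
      have zz: "norm (\<zeta> * z) \<le> norm z" for z
        using mult_right_mono[OF J(3) norm_ge_zero[of z]] by (simp add: \<zeta>_def norm_mult)
      show ?thesis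
      proof (rule that[of r \<phi>])
        show "0 < r" by fact
        show "\<phi> 0 = y" using fg by (simp add: \<phi>_def)
        have "continuous_on (ball 0 r) f" "continuous_on (ball 0 r) g"
          using holomorphic_on_imp_continuous_on[OF fg(2)] holomorphic_on_imp_continuous_on[OF fg(3)] r(2)
          by (auto intro: continuous_on_subset)
        thus "continuous_on (ball 0 r) \<phi>"
          unfolding \<phi>_def
          by (intro continuous_on_add continuous_on_const bounded_linear.continuous_on[OF bounded_linear_smult_left])
        have \<alpha>\<phi>: "\<alpha> (\<phi> z - y) = f z" for z :: complex using e(4)[of "f z" "g z"] by (simp add: \<phi>_def add.assoc)
        show "inj_on \<phi> (ball 0 r)"
        proof (rule inj_onI)
          fix z z' :: complex assume z: "z \<in> ball 0 r" "z' \<in> ball 0 r" "\<phi> z = \<phi> z'"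
          have "f z = f z'" using z(3) \<alpha>\<phi>[of z] \<alpha>\<phi>[of z'] by simp
          thus "z = z'" by (rule inj_onD[OF r(3) _ z(1,2)])
        qed
        fix z :: complex assume z: "norm z < r"
        have "\<phi> z \<in> U" unfolding \<phi>_def using fg(7)[OF rs[OF z]] by (intro R) auto
        moreover have "h (\<phi> z) - y = f (\<zeta> * z) *s v + g (\<zeta> * z) *s w"
        proof -
          have "\<alpha> (h (\<phi> z) - y) = f (\<zeta> * z)" "\<beta> (h (\<phi> z) - y) = g (\<zeta> * z)"
            using fg(8)[OF rs[OF z]] by (simp_all add: G_def H_def \<phi>_def)
          thus ?thesis using e(3)[of "h (\<phi> z) - y"] by simp
        qed
        hence "h (\<phi> z) = (f (\<zeta> * z) *s v + g (\<zeta> * z) *s w) + y" by (simp only: diff_eq_eq)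
        hence "h (\<phi> z) = \<phi> (\<zeta> * z)" by (simp only: \<phi>_def add_ac)
        ultimately show "\<phi> z \<in> U \<and> h (\<phi> z) = \<phi> (det (jac h y) * z)" by (simp add: \<zeta>_def)
      qed
    qed
  qed
qed

section \<open>Fixed points of iterates\<close>

lemma injective_matrix_bounded_below:
  fixes A :: "complex^2^2"
  assumes "det A \<noteq> 0"
  obtains c where "0 < c" "\<And>v. c * norm v \<le> norm (A *v v)"
proof -
  have "inj ((*v) A)" using assms by (intro inj_matrix_vector_mult) (simp add: invertible_det_nz)
  thus ?thesis
    using linear_inj_bounded_below_pos[of "(*v) A"] that
    by (metis bounded_linear.linear matrix_vector_mul_bounded_linear)
qed

lemma isolated_fixed_point:
  assumes h: "holomorphic_map_on h U" and U: "open U" "y \<in> U" and y: "h y = y"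
    and J: "det (jac h y - mat 1) \<noteq> 0"
  shows "\<exists>d>0. \<forall>x\<in>ball y d. h x = x \<longrightarrow> x = y"
proof -
  obtain c where c: "0 < c" "\<And>v. c * norm v \<le> norm ((jac h y - mat 1) *v v)"
    using injective_matrix_bounded_below[OF J] by blast
  obtain d where d: "0 < d"
    "\<And>a b. a \<in> ball y d \<Longrightarrow> b \<in> ball y d \<Longrightarrow> norm (h a - h b - jac h y *v (a - b)) \<le> c / 2 * norm (a - b)"
    using strictly_differentiable_jac[OF h U, of "c / 2"] c(1) by auto
  have "x = y" if x: "x \<in> ball y d" "h x = x" for x
  proof -
    have "c * norm (x - y) \<le> norm ((jac h y - mat 1) *v (x - y))" by (rule c(2))
    also have "\<dots> = norm (h x - h y - jac h y *v (x - y))"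
      unfolding x(2) y matrix_vector_mult_diff_rdistrib by (simp add: norm_minus_commute)
    also have "\<dots> \<le> c / 2 * norm (x - y)" using x d(1) by (intro d(2)) auto
    finally show ?thesis using c(1) by (simp add: field_simps)
  qed
  thus ?thesis using d(1) by blast
qed

text \<open>The last iterate itself may lie outside \<open>A\<close>: this is the natural domain of
  \<open>f ^^ n\<close> for a map that is controlled on \<open>A\<close> only.\<close>

definition orbit_domain :: "('a \<Rightarrow> 'a) \<Rightarrow> 'a set \<Rightarrow> nat \<Rightarrow> 'a set" where
  "orbit_domain f A n = {x. \<forall>i<n. (f ^^ i) x \<in> A}"

lemma orbit_domain_0 [simp]: "orbit_domain f A 0 = UNIV"
  by (simp add: orbit_domain_def)

lemma orbit_domain_Suc: "orbit_domain f A (Suc n) = A \<inter> f -` orbit_domain f A n"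
  by (auto simp: orbit_domain_def less_Suc_eq_0_disj funpow_swap1 simp del: funpow.simps(2))
     (auto simp: funpow_swap1)

lemma funpow_inverse:
  assumes "\<And>x. x \<in> A \<Longrightarrow> g (f x) = x" "x \<in> orbit_domain f A n"
  shows "(g ^^ n) ((f ^^ n) x) = x"
  using assms(2)
proof (induction n arbitrary: x)
  case (Suc n)
  then have "x \<in> A" "(g ^^ n) ((f ^^ n) (f x)) = f x" by (simp_all add: orbit_domain_Suc)
  thus ?case using assms(1) by (simp add: funpow_swap1)
qed simp

section \<open>Derivatives of iterates\<close>

context
  fixes f :: "complex^2 \<Rightarrow> complex^2" and A
  assumes f: "holomorphic_map_on f A" and A: "open A"
begin

lemma open_orbit_domain: "open (orbit_domain f A n)"
proof (induction n)
  case (Suc n)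
  then show ?case unfolding orbit_domain_Suc
    by (rule continuous_open_preimage[OF holomorphic_map_on_imp_continuous_on[OF f] A])
qed simp

lemma holomorphic_map_on_funpow: "holomorphic_map_on (f ^^ n) (orbit_domain f A n)"
proof (induction n)
  case 0
  show ?case by (rule holomorphic_map_onI[of _ _ "\<lambda>_. mat 1"]) (simp add: id_def)
next
  case (Suc n)
  show ?case
  proof (rule holomorphic_map_onI)
    fix x assume "x \<in> orbit_domain f A (Suc n)"
    hence x: "x \<in> A" "f x \<in> orbit_domain f A n" by (simp_all add: orbit_domain_Suc)
    show "((f ^^ Suc n) has_derivative (*v) (jac (f ^^ n) (f x) ** jac f x)) (at x)"
      using has_derivative_compose_jac[OF has_derivative_jac[OF f x(1)] has_derivative_jac[OF Suc x(2)]]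
      by (simp add: funpow_Suc_right o_def del: funpow.simps)
  qed
qed

lemma jac_funpow_add:
  assumes "x \<in> orbit_domain f A m" "(f ^^ m) x \<in> orbit_domain f A n"
  shows "jac (f ^^ (n + m)) x = jac (f ^^ n) ((f ^^ m) x) ** jac (f ^^ m) x"
  using has_derivative_compose_jac[OF has_derivative_jac[OF holomorphic_map_on_funpow assms(1)]
      has_derivative_jac[OF holomorphic_map_on_funpow assms(2)]]
  by (intro jac_eqI) (simp add: funpow_add o_def)

context
  fixes x and n :: nat
  assumes x: "\<And>i. (f ^^ i) x \<in> A" "(f ^^ n) x = x"
begin

lemma jac_funpow_Suc_mult: "jac (f ^^ (Suc l * n)) x = jac (f ^^ n) x ** jac (f ^^ (l * n)) x"
proof -
  have "(f ^^ (l * n)) x = x" by (induction l) (simp_all add: funpow_add x(2))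
  thus ?thesis using jac_funpow_add[of x "l * n" n] x(1) by (simp add: orbit_domain_def)
qed

lemma det_jac_funpow_mult: "det (jac (f ^^ (l * n)) x) = det (jac (f ^^ n) x) ^ l"
proof (induction l)
  case 0
  have "jac (f ^^ (0 * n)) x = mat 1" by (rule jac_eqI) (simp add: id_def)
  then show ?case by (simp only: det_I power_0)
next
  case (Suc l)
  then show ?case by (simp only: jac_funpow_Suc_mult det_mul power_Suc)
qed

lemma eigenvector_jac_funpow_mult:
  assumes "jac (f ^^ n) x *v u = c *s u"
  shows "jac (f ^^ (l * n)) x *v u = c ^ l *s u"
proof (induction l)
  case 0
  have "jac (f ^^ (0 * n)) x = mat 1" by (rule jac_eqI) (simp add: id_def)
  then show ?case by (simp only: matrix_vector_mul_lid power_0 vector_smult_lid)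
next
  case (Suc l)
  have "jac (f ^^ (Suc l * n)) x *v u = jac (f ^^ n) x *v (c ^ l *s u)"
    by (simp only: jac_funpow_Suc_mult matrix_vector_mul_assoc[symmetric] Suc)
  then show ?case by (simp add: vector_scalar_commute assms mult.commute)
qed

end

end

lemma det_eq_0_iff_eigenvector:
  fixes M :: "complex^2^2"
  shows "det (M - mat c) = 0 \<longleftrightarrow> (\<exists>u. u \<noteq> 0 \<and> M *v u = c *s u)"
proof
  assume "\<exists>u. u \<noteq> 0 \<and> M *v u = c *s u"
  then obtain u where u: "u \<noteq> 0" "M *v u = c *s u" by blast
  have "mat c *v u = c *s u"
    by (simp add: vec_eq_iff matrix_vector_mult_def mat_def if_distrib[of "\<lambda>x. x * _"] cong: if_cong)
  hence "(M - mat c) *v u = 0" using u(2) by (simp add: matrix_vector_mult_diff_rdistrib)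
  thus "det (M - mat c) = 0"
    using u(1) injective_matrix_bounded_below[of "M - mat c"]
    by (metis mult_le_0_iff norm_le_zero_iff norm_zero not_le)
qed (metis exists_eigenvector)

text \<open>If no eigenvalue other than \<open>1\<close> of the derivative \<open>A\<close> is an \<open>l\<close>-th root of unity, then
  \<open>1 + A + \<dots> + A\<^sup>l\<^sup>-\<^sup>1\<close> is injective. The telescoping sum \<open>h\<^sup>l x - x = (\<Sum>j<l. h\<^sup>j (h x) - h\<^sup>j x)\<close>
  is close to the image of \<open>h x - x\<close> under that map.\<close>

lemma fixed_points_of_iterate:
  assumes h: "holomorphic_map_on h U" and U: "open U" "y \<in> U" and y: "h y = y" and l: "1 \<le> l"
    and ev: "\<And>c. det (jac h y - mat c) = 0 \<Longrightarrow> c ^ l = 1 \<Longrightarrow> c = 1"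
  shows "\<exists>d>0. \<forall>x\<in>ball y d. (h ^^ l) x = x \<longrightarrow> h x = x"
proof -
  have yj: "(h ^^ j) y = y" for j by (induction j) (simp_all add: y)
  have yU: "(h ^^ j) y \<in> U" for j using yj U(2) by simp
  have yd: "y \<in> orbit_domain h U j" for j using yU by (simp add: orbit_domain_def)
  define A where "A = (\<lambda>j. jac (h ^^ j) y)"
  have A1: "A (Suc 0) = jac h y" by (simp add: A_def)
  have comm: "A j *v (jac h y *v v) = jac h y *v (A j *v v)" for j v
    using jac_funpow_add[OF h U(1) yd[of "Suc 0"], of j] jac_funpow_add[OF h U(1) yd[of j], of "Suc 0"] yd
    by (simp add: matrix_vector_mul_assoc yj A_def y)
  define S where "S = (\<lambda>v. \<Sum>j<l. A j *v v)"
  have lS: "linear S" unfolding S_def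
    by (intro linear_compose_sum ballI bounded_linear.linear matrix_vector_mul_bounded_linear)
  have no_ev: "v = 0" if "S v = 0" "jac h y *v v = c *s v" for v c
  proof (rule ccontr)
    assume v: "v \<noteq> 0"
    have "A j *v v = c ^ j *s v" for j
      using eigenvector_jac_funpow_mult[OF h U(1) yU yj[of 1], of v c j] that(2) by (simp add: A_def)
    hence "S v = (\<Sum>j<l. c ^ j) *s v" by (simp add: S_def vec_eq_iff sum_distrib_right)
    hence s0: "(\<Sum>j<l. c ^ j) = 0" using that(1) v by (auto simp: vec_eq_iff)
    moreover have "c ^ l - 1 = (c - 1) * (\<Sum>j<l. c ^ j)" by (rule power_diff_1_eq)
    moreover have "det (jac h y - mat c) = 0" using v that(2) det_eq_0_iff_eigenvector by blast
    ultimately have "c = 1" using ev by simp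
    thus False using s0 l by simp
  qed
  have injS: "inj S"
    unfolding linear_injective_0[OF lS]
  proof (intro allI impI)
    fix v assume v: "S v = 0"
    obtain c c' where c: "\<And>u. jac h y *v (jac h y *v u - c *s u) = c' *s (jac h y *v u - c *s u)"
      using char_poly_splits by metis
    \<comment> \<open>\<open>S\<close> commutes with the derivative, so \<open>w\<close> is again in
      its kernel, and it is zero or an eigenvector for \<open>c'\<close>. Hence
      \<open>w = 0\<close>, which makes \<open>v\<close> itself zero or an eigenvector.\<close>
    define w where "w = jac h y *v v - c *s v"
    have "S w = jac h y *v S v - c *s S v"
      unfolding S_def w_def matrix_vector_mult_diff_distrib vector_scalar_commute comm
        linear_sum[OF bounded_linear.linear[OF matrix_vector_mul_bounded_linear]]
      by (simp add: sum_subtractf vec_eq_iff sum_distrib_left)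
    hence "S w = 0" using v by simp
    hence "w = 0" using no_ev[of w c'] c[of v] by (simp add: w_def)
    thus "v = 0" using no_ev[OF v, of c] by (simp add: w_def)
  qed
  obtain c where c: "0 < c" "\<And>v. c * norm v \<le> norm (S v)"
    using linear_inj_bounded_below_pos[OF lS injS] by blast
  \<comment> \<open>The errors of the \<open>l\<close> terms add up to half of the lower bound
    \<open>c\<close> for \<open>S\<close>.\<close>
  define e where "e = c / (2 * l)"
  have e: "0 < e" "l * e = c / 2" using c(1) l by (auto simp: e_def)
  have "\<forall>j. \<exists>d>0. \<forall>a\<in>ball y d. \<forall>b\<in>ball y d. norm ((h ^^ j) a - (h ^^ j) b - A j *v (a - b)) \<le> e * norm (a - b)"
    using strictly_differentiable_jac[OF holomorphic_map_on_funpow[OF h U(1)] open_orbit_domain[OF h U(1)] yd e(1)]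
    unfolding A_def by blast
  then obtain D where D: "\<And>j. 0 < D j"
    "\<And>j a b. a \<in> ball y (D j) \<Longrightarrow> b \<in> ball y (D j) \<Longrightarrow> norm ((h ^^ j) a - (h ^^ j) b - A j *v (a - b)) \<le> e * norm (a - b)"
    by metis
  define d where "d = Min (D ` {..<l})"
  have d: "0 < d" "\<And>j. j < l \<Longrightarrow> d \<le> D j" using D(1) l by (auto simp: d_def Min_gr_iff lessThan_empty_iff)
  have "open (U \<inter> h -` ball y d)"
    by (rule continuous_open_preimage[OF holomorphic_map_on_imp_continuous_on[OF h] U(1) open_ball])
  moreover have "y \<in> U \<inter> h -` ball y d" using U(2) y d(1) by simp
  ultimately obtain d' where d': "0 < d'" "ball y d' \<subseteq> U \<inter> h -` ball y d" using open_contains_ball by blast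
  have "h x = x" if x: "x \<in> ball y (min d d')" "(h ^^ l) x = x" for x
  proof -
    have "x \<in> ball y d'" using x by simp
    hence "h x \<in> ball y d" using d'(2) by blast
    moreover have "x \<in> ball y d" using x by simp
    ultimately have hx: "h x \<in> ball y d" "x \<in> ball y d" .
    define u where "u = h x - x"
    have "(h ^^ l) x - x = (\<Sum>j<l. (h ^^ Suc j) x - (h ^^ j) x)"
      using sum_lessThan_telescope[of "\<lambda>j. (h ^^ j) x" l] by simp
    also have "\<dots> = (\<Sum>j<l. (h ^^ j) (h x) - (h ^^ j) x)" by (simp add: funpow_swap1)
    finally have "(\<Sum>j<l. (h ^^ j) (h x) - (h ^^ j) x) = 0" using x(2) by simp
    hence "- S u = (\<Sum>j<l. (h ^^ j) (h x) - (h ^^ j) x - A j *v u)"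
      by (simp add: S_def sum_subtractf)
    hence "norm (S u) = norm (\<Sum>j<l. (h ^^ j) (h x) - (h ^^ j) x - A j *v u)" by (metis norm_minus_cancel)
    also have "\<dots> \<le> (\<Sum>j<l. e * norm u)"
      unfolding u_def using hx d(2) by (intro order_trans[OF norm_sum] sum_mono D(2)) fastforce+
    also have "\<dots> = c / 2 * norm u" using e(2) by (simp flip: mult.assoc)
    finally have "c * norm u \<le> c / 2 * norm u" using c(2)[of u] by linarith
    hence "u = 0" using c(1) by (simp add: field_simps)
    thus ?thesis by (simp add: u_def)
  qed
  thus ?thesis using d(1) d'(1) by (intro exI[of _ "min d d'"]) auto
qed

text \<open>The derivative of the local inverse is the inverse of a complex matrix, so the real
  inverse function theorem yields a complex differentiable map.\<close>

lemma holomorphic_local_inverse: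
  assumes F: "holomorphic_map_on F U" and U: "open U" "y \<in> U" and J: "det (jac F y) \<noteq> 0"
  obtains U' V g where "open U'" "U' \<subseteq> U" "y \<in> U'" "open V" "F y \<in> V" "holomorphic_map_on g V"
    "\<And>x. x \<in> U' \<Longrightarrow> F x \<in> V \<and> g (F x) = x" "\<And>z. z \<in> V \<Longrightarrow> g z \<in> U' \<and> F (g z) = z"
proof -
  have inv: "\<exists>B. B ** A = mat 1 \<and> A ** B = mat 1" if "det A \<noteq> 0" for A :: "complex^2^2"
    using that unfolding invertible_det_nz[symmetric] invertible_def by blast
  define f' where "f' = (\<lambda>x. Blinfun ((*v) (jac F x)))"
  have f': "blinfun_apply (f' x) = (*v) (jac F x)" for x
    unfolding f'_def by (rule bounded_linear_Blinfun_apply[OF matrix_vector_mul_bounded_linear])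
  obtain B where B: "B ** jac F y = mat 1" using inv[OF J] by blast
  have c: "continuous_on U f'"
    by (rule continuous_on_blinfun_componentwise) (simp add: f' continuous_on_jac_mult[OF F U(1)])
  have d: "(F has_derivative blinfun_apply (f' x)) (at x)" if "x \<in> U" for x
    unfolding f' by (rule has_derivative_jac[OF F that])
  have i: "Blinfun ((*v) B) o\<^sub>L f' y = id_blinfun"
    by (rule blinfun_eqI)
      (simp add: f' bounded_linear_Blinfun_apply[OF matrix_vector_mul_bounded_linear] matrix_vector_mul_assoc B)
  show ?thesis
  proof (rule inverse_function_theorem[OF U(1) d c U(2) i])
    fix U' V g g'
    assume g: "open U'" "U' \<subseteq> U" "y \<in> U'" "open V" "F y \<in> V" "homeomorphism U' V F g"
      "\<And>z. z \<in> V \<Longrightarrow> (g has_derivative g' z) (at z)"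
      "\<And>z. z \<in> V \<Longrightarrow> g' z = inv (blinfun_apply (f' (g z)))" "\<And>z. z \<in> V \<Longrightarrow> bij (blinfun_apply (f' (g z)))"
    have "\<exists>B. (g has_derivative (*v) B) (at z)" if z: "z \<in> V" for z
    proof -
      have bij: "bij ((*v) (jac F (g z)))" using g(9)[OF z] by (simp only: f')
      have "det (jac F (g z)) \<noteq> 0"
      proof
        assume "det (jac F (g z)) = 0"
        then obtain u where "u \<noteq> 0" "jac F (g z) *v u = 0" by (rule exists_kernel_vector)
        thus False using injD[OF bij_is_inj[OF bij], of u 0] by simp
      qed
      then obtain B where B: "B ** jac F (g z) = mat 1" "jac F (g z) ** B = mat 1" using inv by blast
      have "inv ((*v) (jac F (g z))) = (*v) B"
        by (intro inv_unique_comp ext) (simp_all add: o_def matrix_vector_mul_assoc B)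
      thus ?thesis using g(7,8)[OF z] by (auto simp: f')
    qed
    hence "holomorphic_map_on g V" unfolding holomorphic_map_on_def using matrix_vector_mul_linear_gen by blast
    moreover have "\<And>x. x \<in> U' \<Longrightarrow> F x \<in> V \<and> g (F x) = x" "\<And>z. z \<in> V \<Longrightarrow> g z \<in> U' \<and> F (g z) = z"
      using g(6) by (auto simp: homeomorphism_def)
    ultimately show thesis using g(1-5) that[of U' V g] by blast
  qed
qed

text \<open>Split \<open>h z = z\<close> into its two coordinates. As the multiplier differs from 1,
  the map \<open>\<Phi>\<close>, made of the first coordinate of \<open>h z - z\<close> and the
  second of \<open>z - y\<close>, is locally invertible, and the first equation cuts out a disc with
  parameter \<open>t\<close>. On it there remains the holomorphic equation \<open>q t = 0\<close> in
  one variable. Its zeros accumulate at 0, so it holds identically and the disc consists of fixed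
  points.\<close>

theorem curve_of_fixed_points:
  assumes h: "holomorphic_map_on h U" and U: "open U" "y \<in> U" and y: "h y = y"
    and J: "det (jac h y - mat 1) = 0" "det (jac h y) \<noteq> 1"
    and acc: "\<And>d. 0 < d \<Longrightarrow> \<exists>x\<in>ball y d. x \<noteq> y \<and> h x = x"
  shows "\<exists>d>0. \<exists>C. connected C \<and> y \<in> C \<and> C \<subseteq> U \<and> (\<forall>x\<in>C. h x = x) \<and> {x \<in> ball y d. h x = x} \<subseteq> C"
proof (rule eigenbasis[OF J(1) refl J(2)])
  fix v w and \<alpha> \<beta> :: "complex^2 \<Rightarrow> complex"
  assume e: "jac h y *v v = det (jac h y) *s v" "jac h y *v w = w"
    "\<And>u. u = \<alpha> u *s v + \<beta> u *s w" "\<And>p q. \<alpha> (p *s v + q *s w) = p" "\<And>p q. \<beta> (p *s v + q *s w) = q"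
    "bounded_linear \<alpha>" "bounded_linear \<beta>" "\<And>c u. \<alpha> (c *s u) = c * \<alpha> u" "\<And>c u. \<beta> (c *s u) = c * \<beta> u"
  note add\<alpha> = linear_add[OF bounded_linear.linear[OF e(6)]]
  note add\<beta> = linear_add[OF bounded_linear.linear[OF e(7)]]
  have \<alpha>\<beta>0: "\<alpha> 0 = 0" "\<beta> 0 = 0" using e(4)[of 0 0] e(5)[of 0 0] by simp_all
  define \<Phi> where "\<Phi> = (\<lambda>z. \<alpha> (h z - z) *s v + \<beta> (z - y) *s w)"
  define D where "D = (\<lambda>z u. \<alpha> (jac h z *v u - u) *s v + \<beta> u *s w)"
  have D: "(\<Phi> has_derivative D z) (at z)" if "z \<in> U" for z
    unfolding \<Phi>_def D_def
    by (intro has_derivative_add bounded_linear.has_derivative[OF bounded_linear_smult_left]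
        bounded_linear.has_derivative[OF e(6)] bounded_linear.has_derivative[OF e(7)]
        has_derivative_diff has_derivative_jac[OF h that] has_derivative_ident)
       (use has_derivative_diff[OF has_derivative_ident has_derivative_const[of y]] in simp)
  have lin: "Vector_Spaces.linear (*s) (*s) (D z)" for z
  proof -
    have sc: "jac h z *v (c *s u) - c *s u = c *s (jac h z *v u - u)" for c u
      by (simp add: vector_scalar_commute vec_eq_iff algebra_simps)
    have ad: "jac h z *v (u + u') - (u + u') = (jac h z *v u - u) + (jac h z *v u' - u')" for u u'
      by (simp add: matrix_vector_right_distrib)
    show ?thesis
    proof
      show "D z (u + u') = D z u + D z u'" for u u'
        unfolding D_def ad add\<alpha> add\<beta> by (simp add: vec_eq_iff algebra_simps)
      show "D z (c *s u) = c *s D z u" for c u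
        unfolding D_def sc e(8,9) by (simp add: vec_eq_iff algebra_simps)
    qed
  qed
  have hol: "holomorphic_map_on \<Phi> U" unfolding holomorphic_map_on_def using D lin by blast
  have jD: "jac \<Phi> y *v u = D y u" for u
    using has_derivative_unique[OF has_derivative_jac[OF hol U(2)] D[OF U(2)]] by metis
  have "det (jac \<Phi> y) \<noteq> 0"
  proof
    assume "det (jac \<Phi> y) = 0"
    then obtain u where u: "u \<noteq> 0" "jac \<Phi> y *v u = 0" by (rule exists_kernel_vector)
    have "\<beta> u = 0" "\<alpha> (jac h y *v u - u) = 0"
    proof -
      have "\<beta> (D y u) = \<beta> u" "\<alpha> (D y u) = \<alpha> (jac h y *v u - u)" unfolding D_def by (rule e(5), rule e(4))
      thus "\<beta> u = 0" "\<alpha> (jac h y *v u - u) = 0" using u(2) \<alpha>\<beta>0 by (simp_all add: jD)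
    qed
    hence u': "u = \<alpha> u *s v" using e(3)[of u] by simp
    have "jac h y *v u = (det (jac h y) * \<alpha> u) *s v"
      by (subst u') (simp add: vector_scalar_commute e(1) mult.commute)
    hence "jac h y *v u - u = ((det (jac h y) - 1) * \<alpha> u) *s v + 0 *s w"
      by (subst (2) u') (simp add: vec_eq_iff algebra_simps)
    hence "(det (jac h y) - 1) * \<alpha> u = 0" using \<open>\<alpha> (jac h y *v u - u) = 0\<close> e(4) by metis
    hence "\<alpha> u = 0" using J(2) by simp
    thus False using u(1) u' by simp
  qed
  then obtain U' V g where g: "open U'" "U' \<subseteq> U" "y \<in> U'" "open V" "\<Phi> y \<in> V" "holomorphic_map_on g V"
    "\<And>x. x \<in> U' \<Longrightarrow> \<Phi> x \<in> V \<and> g (\<Phi> x) = x" "\<And>z. z \<in> V \<Longrightarrow> g z \<in> U' \<and> \<Phi> (g z) = z"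
    using holomorphic_local_inverse[OF hol U] by blast
  have \<Phi>y: "\<Phi> y = 0" by (simp add: \<Phi>_def y \<alpha>\<beta>0)
  obtain \<rho> where \<rho>: "0 < \<rho>" "ball 0 \<rho> \<subseteq> V" using g(4,5) \<Phi>y open_contains_ball by metis
  define r where "r = \<rho> / (norm w + 1)"
  have nw: "0 < norm w + 1" using norm_ge_zero[of w] by linarith
  have r: "0 < r" using \<rho>(1) nw by (simp add: r_def)
  have tw: "t *s w \<in> V" if "norm t < r" for t
  proof -
    have "norm (t *s w) \<le> r * norm w" using that by (simp add: norm_vector_smult mult_right_mono)
    also have "\<dots> < r * (norm w + 1)" using r by simp
    also have "\<dots> = \<rho>" using nw by (simp add: r_def)
    finally show ?thesis using \<rho>(2) by (auto simp: subset_iff)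
  qed
  define \<Gamma> where "\<Gamma> = (\<lambda>t. g (t *s w))"
  define q where "q = (\<lambda>t. \<beta> (h (\<Gamma> t) - \<Gamma> t))"
  have \<Gamma>: "\<Gamma> t \<in> U'" "\<Phi> (\<Gamma> t) = 0 *s v + t *s w" if "norm t < r" for t
    using g(8)[OF tw[OF that]] by (simp_all add: \<Gamma>_def)
  have \<Phi>_coord: "\<alpha> (\<Phi> z) = \<alpha> (h z - z)" "\<beta> (\<Phi> z) = \<beta> (z - y)" for z
    unfolding \<Phi>_def by (rule e(4), rule e(5))
  have \<Gamma>': "\<alpha> (h (\<Gamma> t) - \<Gamma> t) = 0" "\<beta> (\<Gamma> t - y) = t" if "norm t < r" for t
    using \<Phi>_coord[of "\<Gamma> t"] unfolding \<Gamma>(2)[OF that] e(4,5) by simp_all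
  have fix_iff: "h (\<Gamma> t) = \<Gamma> t \<longleftrightarrow> q t = 0" if "norm t < r" for t
  proof
    assume "q t = 0"
    thus "h (\<Gamma> t) = \<Gamma> t" using e(3)[of "h (\<Gamma> t) - \<Gamma> t"] \<Gamma>'(1)[OF that] by (simp add: q_def)
  qed (simp add: q_def \<alpha>\<beta>0)
  have \<Gamma>_fix: "\<Gamma> (\<beta> (x - y)) = x" if "x \<in> U'" "h x = x" for x
  proof -
    have "\<Phi> x = \<beta> (x - y) *s w" by (simp add: \<Phi>_def that \<alpha>\<beta>0)
    thus ?thesis using g(7)[OF that(1)] by (simp add: \<Gamma>_def)
  qed
  have \<Gamma>d: "(\<Gamma> has_derivative (\<lambda>s. jac g (t *s w) *v (s *s w))) (at t)" if "norm t < r" for t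
    unfolding \<Gamma>_def
    by (rule has_derivative_compose[OF bounded_linear_imp_has_derivative[OF bounded_linear_smult_left]
        has_derivative_jac[OF g(6) tw[OF that]]])
  have q: "q holomorphic_on ball 0 r"
  proof (rule holomorphic_onI)
    fix t :: complex assume "t \<in> ball 0 r"
    hence t: "norm t < r" by simp
    define u where "u = jac g (t *s w) *v w"
    have "\<Gamma> t \<in> U" using \<Gamma>(1)[OF t] g(2) by blast
    hence "(q has_derivative (\<lambda>s. \<beta> (jac h (\<Gamma> t) *v (jac g (t *s w) *v (s *s w)) - jac g (t *s w) *v (s *s w)))) (at t)"
      unfolding q_def
      by (intro bounded_linear.has_derivative[OF e(7)] has_derivative_diff \<Gamma>d[OF t]
          has_derivative_compose[OF \<Gamma>d[OF t] has_derivative_jac[OF h]])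
    moreover have "\<beta> (jac h (\<Gamma> t) *v (jac g (t *s w) *v (s *s w)) - jac g (t *s w) *v (s *s w))
        = \<beta> (jac h (\<Gamma> t) *v u - u) * s" for s
    proof -
      have "jac h (\<Gamma> t) *v (jac g (t *s w) *v (s *s w)) - jac g (t *s w) *v (s *s w) = s *s (jac h (\<Gamma> t) *v u - u)"
        by (simp add: u_def vector_scalar_commute vec_eq_iff right_diff_distrib)
      thus ?thesis by (simp only: e(9) mult.commute)
    qed
    ultimately have "(q has_field_derivative \<beta> (jac h (\<Gamma> t) *v u - u)) (at t)"
      by (simp add: has_field_derivative_def)
    thus "q field_differentiable at t within ball 0 r"
      unfolding field_differentiable_def by (blast intro: has_field_derivative_at_within)
  qed
  have cont\<Gamma>: "continuous_on (ball 0 r) \<Gamma>"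
    by (rule has_derivative_continuous_on) (rule has_derivative_at_withinI[OF \<Gamma>d], simp)
  obtain d where d: "0 < d" "ball y d \<subseteq> U'" "\<And>x. x \<in> ball y d \<Longrightarrow> norm (\<beta> (x - y)) < r"
  proof -
    obtain d1 where d1: "0 < d1" "ball y d1 \<subseteq> U'" using g(1,3) open_contains_ball by blast
    obtain K where K: "0 < K" "\<And>x. norm (\<beta> x) \<le> norm x * K" using bounded_linear.pos_bounded[OF e(7)] by blast
    have "norm (\<beta> (x - y)) < r" if "x \<in> ball y (min d1 (r / K))" for x
    proof -
      have "norm (x - y) * K < r" using that K(1) by (simp add: dist_norm norm_minus_commute field_simps)
      thus ?thesis using K(2)[of "x - y"] by linarith
    qed
    moreover have "0 < min d1 (r / K)" using d1(1) r K(1) by simp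
    moreover have "ball y (min d1 (r / K)) \<subseteq> U'" using d1(2) by auto
    ultimately show thesis using that by blast
  qed
  have q0: "q t = 0" if t: "norm t < r" for t
  proof (rule ccontr)
    assume nz: "q t \<noteq> 0"
    have q00: "q 0 = 0"
      using fix_iff[of 0] r \<Gamma>_fix[OF g(3) y] y by (simp add: \<alpha>\<beta>0)
    obtain s where s: "0 < s" "\<And>z. z \<in> ball 0 s - {0} \<Longrightarrow> q z \<noteq> 0"
      by (rule isolated_zeros[OF q open_ball connected_ball _ q00 _ nz]) (use r t in auto)
    obtain K where K: "0 < K" "\<And>x. norm (\<beta> x) \<le> norm x * K" using bounded_linear.pos_bounded[OF e(7)] by blast
    have "0 < min d (s / K)" using d(1) s(1) K(1) by simp
    then obtain x where x: "x \<in> ball y (min d (s / K))" "x \<noteq> y" "h x = x" using acc by blast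
    have xU: "x \<in> U'" using x(1) d(2) by auto
    have "norm (x - y) * K < s" using x(1) K(1) by (simp add: dist_norm norm_minus_commute field_simps)
    hence n: "norm (\<beta> (x - y)) < s" using K(2)[of "x - y"] by linarith
    have "\<beta> (x - y) \<noteq> 0" using \<Gamma>_fix[OF xU x(3)] \<Gamma>_fix[OF g(3) y] x(2) by (auto simp: \<alpha>\<beta>0)
    hence "q (\<beta> (x - y)) \<noteq> 0" using n by (intro s(2)) simp
    moreover have "q (\<beta> (x - y)) = 0"
      using fix_iff[of "\<beta> (x - y)"] d(3)[of x] x \<Gamma>_fix[OF xU x(3)] by simp
    ultimately show False by simp
  qed
  show ?thesis
  proof (intro exI conjI)
    show "0 < d" by (rule d(1))
    show "connected (\<Gamma> ` ball 0 r)" by (rule connected_continuous_image[OF cont\<Gamma> connected_ball])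
    show "y \<in> \<Gamma> ` ball 0 r" using \<Gamma>_fix[OF g(3) y] r by (intro image_eqI[of _ _ 0]) (simp_all add: \<alpha>\<beta>0)
    show "\<Gamma> ` ball 0 r \<subseteq> U" using \<Gamma>(1) g(2) by auto
    show "\<forall>x\<in>\<Gamma> ` ball 0 r. h x = x" using q0 fix_iff by auto
    show "{x \<in> ball y d. h x = x} \<subseteq> \<Gamma> ` ball 0 r"
    proof
      fix x assume "x \<in> {x \<in> ball y d. h x = x}"
      hence x: "x \<in> ball y d" "h x = x" by simp_all
      have "\<Gamma> (\<beta> (x - y)) = x" using x d(2) by (intro \<Gamma>_fix) auto
      thus "x \<in> \<Gamma> ` ball 0 r" using d(3)[OF x(1)] by (metis image_eqI mem_ball_0)
    qed
  qed
qed

section \<open>Countable closed covers of continua\<close>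

text \<open>By Lindelof's theorem countably many of the balls cover \<open>X\<close>, and their
  centres already give all values.\<close>

lemma countable_image_if_locally_constant:
  fixes X :: "'a :: {metric_space, second_countable_topology} set"
  assumes "\<And>x. x \<in> X \<Longrightarrow> \<exists>d>0. \<forall>y\<in>X \<inter> ball x d. \<phi> y = \<phi> x"
  shows "countable (\<phi> ` X)"
proof -
  from assms have "\<forall>x\<in>X. \<exists>d. 0 < d \<and> (\<forall>y\<in>X \<inter> ball x d. \<phi> y = \<phi> x)" by (rule ballI)
  from bchoice[OF this] obtain d where d': "\<forall>x\<in>X. 0 < d x \<and> (\<forall>y\<in>X \<inter> ball x (d x). \<phi> y = \<phi> x)" ..
  have d: "0 < d x" "\<And>y. y \<in> X \<Longrightarrow> y \<in> ball x (d x) \<Longrightarrow> \<phi> y = \<phi> x" if "x \<in> X" for x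
    using bspec[OF d' that] by (simp, blast)
  define B where "B = (\<lambda>x. ball x (d x))"
  have "open S" if "S \<in> B ` X" for S using that unfolding B_def by (metis imageE open_ball)
  then obtain \<F> where \<F>: "\<F> \<subseteq> B ` X" "countable \<F>" "\<Union>\<F> = \<Union>(B ` X)"
    by (rule Lindelof)
  from \<F>(1,2) have "\<exists>X'. countable X' \<and> X' \<subseteq> X \<and> \<F> = B ` X'"
    by (simp only: countable_subset_image[symmetric])
  then obtain X' where X': "countable X'" "X' \<subseteq> X" "\<F> = B ` X'" by (elim exE conjE)
  have "\<phi> ` X \<subseteq> \<phi> ` X'"
  proof (rule image_subsetI)
    fix y assume y: "y \<in> X"
    have "y \<in> B y" using d(1)[OF y] by (simp add: B_def)
    hence "y \<in> \<Union>\<F>" unfolding \<F>(3) using y by (rule UN_I[rotated])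
    then obtain x where x: "x \<in> X'" "y \<in> B x" unfolding X'(3) by (rule UN_E)
    hence "\<phi> y = \<phi> x" using d(2)[OF subsetD[OF X'(2) x(1)] y] by (simp only: B_def)
    thus "\<phi> y \<in> \<phi> ` X'" using x(1) by simp
  qed
  thus ?thesis using countable_image[OF X'(1)] by (rule countable_subset)
qed

lemma countable_non_limit_points:
  fixes S :: "'a :: {metric_space, second_countable_topology} set"
  shows "countable {x \<in> S. \<not> x islimpt S}"
proof -
  have "countable ((\<lambda>x. x) ` {x \<in> S. \<not> x islimpt S})"
  proof (rule countable_image_if_locally_constant)
    fix x assume x: "x \<in> {x \<in> S. \<not> x islimpt S}"
    then obtain d where "0 < d" "\<forall>y\<in>S. y \<noteq> x \<longrightarrow> \<not> dist y x < d"
      by (auto simp: islimpt_approachable)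
    thus "\<exists>d>0. \<forall>y\<in>{x \<in> S. \<not> x islimpt S} \<inter> ball x d. y = x"
      by (intro exI[of _ d]) (auto simp: dist_commute)
  qed
  thus ?thesis by simp
qed

text \<open>Boundary bumping: a proper subcontinuum can be enlarged within any
  neighbourhood.\<close>

lemma bigger_subcontinuum:
  fixes C :: "'a :: euclidean_space set"
  assumes C: "compact C" "connected C" and Q: "compact Q" "connected Q" "Q \<noteq> {}" "Q \<subset> C" and V: "open V" "Q \<subseteq> V"
  obtains D where "compact D" "connected D" "Q \<subset> D" "D \<subseteq> C" "D \<subseteq> V"
proof -
  have "compactin (top_of_set C) Q" "connectedin (top_of_set C) Q"
    using Q by (auto simp: compactin_subtopology connectedin_subtopology)
  moreover have "connected_space (top_of_set C)" using C(2) by (simp add: connectedin_def flip: connectedin_iff_connected)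
  moreover have "locally_compact_space (top_of_set C)"
    using C(1) by (intro compact_imp_locally_compact_space) (simp add: compact_space_subtopology)
  moreover have "Hausdorff_space (top_of_set C)" by (intro Hausdorff_space_subtopology Hausdorff_space_euclidean)
  moreover have "Q \<noteq> topspace (top_of_set C)" using Q(4) by auto
  moreover have "openin (top_of_set C) (C \<inter> V)" using V(1) by blast
  moreover have "Q \<subseteq> C \<inter> V" using Q(4) V(2) by blast
  ultimately obtain D where "compactin (top_of_set C) D" "connectedin (top_of_set C) D" "Q \<subset> D" "D \<subset> C \<inter> V"
    using Q(3) intermediate_continuum_exists[of "top_of_set C" Q "C \<inter> V"] by metis
  thus ?thesis using that[of D] by (auto simp: compactin_subtopology connectedin_subtopology)
qed

text \<open>For pairwise disjoint sets this is a theorem of Sierpinski: a continuum is not the union of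
  countably many, and at least two, disjoint nonempty closed subsets.\<close>

theorem continuum_subset_of_countable_closed_cover:
  fixes K :: "'a :: euclidean_space set"
  assumes K: "compact K" "connected K" "K \<noteq> {}"
    and F: "countable \<F>" "K \<subseteq> \<Union>\<F>" "\<And>R. R \<in> \<F> \<Longrightarrow> closed R"
    and inc: "\<And>R S D. R \<in> \<F> \<Longrightarrow> S \<in> \<F> \<Longrightarrow> connected D \<Longrightarrow> D \<subseteq> R \<Longrightarrow> D \<inter> S \<noteq> {} \<Longrightarrow> D \<subseteq> S"
  shows "\<exists>R\<in>\<F>. K \<subseteq> R"
proof (rule ccontr)
  assume "\<not> (\<exists>R\<in>\<F>. K \<subseteq> R)"
  define good where "good C \<longleftrightarrow> compact C \<and> connected C \<and> C \<noteq> {} \<and> C \<subseteq> K \<and> (\<forall>R\<in>\<F>. \<not> C \<subseteq> R)" for C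
  have gK: "good K" using K \<open>\<not> (\<exists>R\<in>\<F>. K \<subseteq> R)\<close> by (simp add: good_def)
  have step: "\<exists>C'. good C' \<and> C' \<subseteq> C \<and> C' \<inter> S = {}" if C: "good C" and S: "S \<in> \<F>" for C S
  proof -
    obtain x where x: "x \<in> C" "x \<notin> S" using C S unfolding good_def by blast
    then obtain R where R: "R \<in> \<F>" "x \<in> R" using C F(2) unfolding good_def by blast
    \<comment> \<open>\<open>Q\<close> is a maximal connected part of \<open>C\<close> inside a
      member of the cover. A slightly larger continuum can still avoid \<open>S\<close>, but will
      not fit into any member.\<close>
    define Q where "Q = connected_component_set (C \<inter> R) x"
    have cCR: "compact (C \<inter> R)" using C F(3)[OF R(1)] by (auto simp: good_def intro: compact_Int_closed)
    have xQ: "x \<in> Q" using x R by (simp add: Q_def)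
    have Q: "connected Q" "Q \<subseteq> C \<inter> R"
      unfolding Q_def by (rule connected_connected_component, rule connected_component_subset)
    have "closed Q" unfolding Q_def by (rule closed_connected_component[OF compact_imp_closed[OF cCR]])
    hence cQ: "compact Q" using cCR
      by (metis Q(2) cCR compact_Int_closed inf.absorb_iff2)
    have QR: "Q \<subseteq> R" using Q(2) by blast
    \<comment> \<open>If \<open>Q\<close> met \<open>S\<close>, then \<open>inc\<close> would put
      all of \<open>Q\<close> into \<open>S\<close>, including \<open>x\<close>.\<close>
    have "Q \<subseteq> - S" using inc[OF R(1) S Q(1) QR] xQ x(2) by blast
    moreover have "\<not> C \<subseteq> R" "compact C" "connected C" using C R(1) unfolding good_def by simp_all
    moreover have "Q \<noteq> {}" using xQ by blast
    moreover have "Q \<subset> C" using Q(2) \<open>\<not> C \<subseteq> R\<close> by blast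
    moreover have "open (- S)" by (rule open_Compl[OF F(3)[OF S]])
    ultimately obtain D where D: "compact D" "connected D" "Q \<subset> D" "D \<subseteq> C" "D \<subseteq> - S"
      using bigger_subcontinuum[of C Q "- S"] cQ Q(1) by metis
    \<comment> \<open>\<open>D\<close> meets \<open>R\<close> in \<open>x\<close>, so
      \<open>inc\<close> would move it from \<open>T\<close> into \<open>R\<close>, against the
      maximality of \<open>Q\<close>.\<close>
    have "\<not> D \<subseteq> T" if T: "T \<in> \<F>" for T
    proof
      assume "D \<subseteq> T"
      moreover have xD: "x \<in> D" using xQ D(3) by blast
      ultimately have "D \<subseteq> R" using inc[OF T R(1) D(2)] R(2) by blast
      hence "D \<subseteq> C \<inter> R" using D(4) by blast
      hence "D \<subseteq> Q" unfolding Q_def by (rule connected_component_maximal[OF xD D(2)])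
      thus False using D(3) by blast
    qed
    moreover have "D \<noteq> {}" "D \<subseteq> K" "D \<inter> S = {}" using D(3-5) C unfolding good_def by auto
    ultimately have "good D \<and> D \<subseteq> C \<and> D \<inter> S = {}" using D(1,2,4) unfolding good_def by simp
    thus ?thesis by (rule exI)
  qed
  have ne: "\<F> \<noteq> {}" using K(3) F(2) by blast
  \<comment> \<open>These nested continua dodge the members of the cover one after the other, so a
    common point of all of them is covered by none.\<close>
  have "\<exists>c. \<forall>n. good (c n) \<and> c (Suc n) \<subseteq> c n \<and> c (Suc n) \<inter> from_nat_into \<F> n = {}"
  proof (rule dependent_nat_choice)
    show "\<exists>C. good C" using gK by blast
    show "\<exists>C'. good C' \<and> C' \<subseteq> C \<and> C' \<inter> from_nat_into \<F> n = {}" if "good C" for C n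
      by (rule step[OF that from_nat_into[OF ne]])
  qed
  then obtain c where c': "\<forall>n. good (c n) \<and> c (Suc n) \<subseteq> c n \<and> c (Suc n) \<inter> from_nat_into \<F> n = {}" ..
  have c: "compact (c n)" "c n \<noteq> {}" "c n \<subseteq> K" "c (Suc n) \<subseteq> c n" "c (Suc n) \<inter> from_nat_into \<F> n = {}" for n
    using c'[rule_format, of n] unfolding good_def by simp_all
  have mono: "c n \<subseteq> c m" if "m \<le> n" for m n using c(4) that by (rule lift_Suc_antimono_le)
  have "\<Inter>(range c) \<noteq> {}" using c(1,2) mono by (rule compact_nest)
  then obtain x where x': "x \<in> \<Inter>(range c)" by blast
  have x: "x \<in> c n" for n using x' by simp
  have "x \<in> K" using x[of 0] c(3)[of 0] by blast
  then obtain R where R: "R \<in> \<F>" "x \<in> R" using F(2) by blast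
  obtain n where "from_nat_into \<F> n = R" using from_nat_into_surj[OF F(1) R(1)] ..
  thus False using x[of "Suc n"] c(5)[of n] R(2) by blast
qed

section \<open>Maps with finite orbits\<close>

text \<open>The assumptions are symmetric in \<open>f\<close> and \<open>g\<close>, so that
  \<open>swap\<close> transfers every result to the inverse map. Both are total functions with
  arbitrary values off \<open>A\<close>, hence the inverse laws are restricted to
  \<open>A\<close>.\<close>

locale finite_orbit_pair =
  fixes f g :: "complex^2 \<Rightarrow> complex^2" and A :: "(complex^2) set"
  assumes open_A: "open A" and zero_A: "0 \<in> A"
    and holomorphic: "holomorphic_map_on f A" "holomorphic_map_on g A"
    and inverse: "\<And>x. x \<in> A \<Longrightarrow> g (f x) = x" "\<And>x. x \<in> A \<Longrightarrow> f (g x) = x"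
    and fixes_0: "f 0 = 0" "g 0 = 0"
    and finite_orbits: "\<And>x. x \<in> A \<Longrightarrow> finite (pos_orbit f A x)" "\<And>x. x \<in> A \<Longrightarrow> finite (pos_orbit g A x)"
begin

lemma swap: "finite_orbit_pair g f A"
  by unfold_locales (use open_A zero_A holomorphic inverse fixes_0 finite_orbits in auto)

lemma funpow_0: "(f ^^ i) 0 = 0"
  by (induction i) (simp_all add: fixes_0)

text \<open>Finiteness makes two iterates coincide, and \<open>g\<close> cancels the common initial
  steps because the whole orbit lies in \<open>A\<close>.\<close>

lemma trapped_imp_periodic:
  assumes "\<And>i. (f ^^ i) x \<in> A"
  shows "\<exists>m>0. (f ^^ m) x = x"
proof -
  have "pos_orbit f A x = range (\<lambda>i. (f ^^ i) x)" using assms by (auto simp: pos_orbit_def)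
  hence "finite (range (\<lambda>i. (f ^^ i) x))" using finite_orbits(1)[of x] assms[of 0] by simp
  hence "\<not> inj (\<lambda>i. (f ^^ i) x)" using finite_imageD infinite_UNIV_nat by blast
  then obtain i j where "i < j" "(f ^^ i) x = (f ^^ j) x"
    unfolding inj_def by (metis linorder_neqE_nat)
  then obtain m where m: "0 < m" "j = i + m" by (metis less_imp_add_positive)
  have "(f ^^ i) ((f ^^ m) x) = (f ^^ i) x"
    using \<open>(f ^^ i) x = (f ^^ j) x\<close> by (simp add: m funpow_add)
  moreover have "x \<in> orbit_domain f A i" "(f ^^ m) x \<in> orbit_domain f A i"
    using assms by (auto simp: orbit_domain_def simp flip: funpow_add[THEN fun_cong, unfolded o_apply])
  ultimately have "(f ^^ m) x = x" using funpow_inverse[of A g f, OF inverse(1)] by metis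
  thus ?thesis using m(1) by blast
qed

lemma periodic_in_A:
  assumes "(f ^^ n) x = x" "x \<in> orbit_domain f A n" "0 < n"
  shows "(f ^^ i) x \<in> A"
proof -
  have "(f ^^ (i mod n)) x \<in> A" using assms by (simp add: orbit_domain_def)
  thus ?thesis using funpow_mod_eq[OF assms(1), of i] by simp
qed

text \<open>Multiplication by a number of modulus at most 1 preserves the disc, so its points are
  trapped and hence periodic. Injectivity of the disc then makes the multiplier a root of
  unity.\<close>

lemma no_good_divisors_multiplier:
  assumes y: "\<And>i. (f ^^ i) y \<in> A" "(f ^^ n) y = y" "0 < n"
    and J: "det (jac (f ^^ n) y - mat 1) = 0" "good_divisors (det (jac (f ^^ n) y))"
  shows "1 < norm (det (jac (f ^^ n) y))"
proof (rule ccontr)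
  assume "\<not> 1 < norm (det (jac (f ^^ n) y))"
  define \<zeta> where "\<zeta> = det (jac (f ^^ n) y)"
  have le: "norm \<zeta> \<le> 1" using \<open>\<not> 1 < _\<close> by (simp add: \<zeta>_def)
  have yd: "y \<in> orbit_domain f A n" using y(1) by (simp add: orbit_domain_def)
  obtain s \<phi> where \<phi>: "0 < s" "inj_on \<phi> (ball 0 s)"
    "\<And>z. norm z < s \<Longrightarrow> \<phi> z \<in> orbit_domain f A n \<and> (f ^^ n) (\<phi> z) = \<phi> (\<zeta> * z)"
    using invariant_disc_at_fixed_point[OF holomorphic_map_on_funpow[OF holomorphic(1) open_A]
        open_orbit_domain[OF holomorphic(1) open_A] yd y(2) J le[unfolded \<zeta>_def]] \<zeta>_def by metis
  define z where "z = complex_of_real (s / 2)"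
  have z: "norm (\<zeta> ^ j * z) < s" for j
  proof -
    have "norm (\<zeta> ^ j * z) \<le> 1 * norm z"
      unfolding norm_mult norm_power using le by (intro mult_right_mono power_le_one) auto
    thus ?thesis using \<phi>(1) by (simp add: z_def)
  qed
  have orb: "(f ^^ (n * j)) (\<phi> z) = \<phi> (\<zeta> ^ j * z)" for j
  proof (induction j)
    case (Suc j)
    then show ?case using \<phi>(3)[OF z[of j]] by (simp add: funpow_add mult.assoc)
  qed simp
  have "(f ^^ i) (\<phi> z) \<in> A" for i
  proof -
    \<comment> \<open>At multiples of \<open>n\<close> the orbit is on the disc, and the fewer than
      \<open>n\<close> remaining steps stay in \<open>A\<close> by
      \<open>orbit_domain f A n\<close>.\<close>
    have "(f ^^ i) (\<phi> z) = (f ^^ (i mod n)) ((f ^^ (n * (i div n))) (\<phi> z))"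
      by (metis funpow_add mod_mult_div_eq o_apply)
    moreover have "\<phi> (\<zeta> ^ (i div n) * z) \<in> orbit_domain f A n" using \<phi>(3)[OF z] by blast
    ultimately show ?thesis using orb y(3) by (simp add: orbit_domain_def)
  qed
  then obtain m where m: "0 < m" "(f ^^ m) (\<phi> z) = \<phi> z" using trapped_imp_periodic by blast
  have "(f ^^ (n * m)) (\<phi> z) = \<phi> z"
    by (metis m(2) funpow_mod_eq funpow_0 mod_mult_self2_is_0 funpow.simps(1) id_apply)
  hence "\<phi> (\<zeta> ^ m * z) = \<phi> (\<zeta> ^ 0 * z)" using orb[of m] by simp
  hence "\<zeta> ^ m * z = \<zeta> ^ 0 * z" using inj_onD[OF \<phi>(2), of "\<zeta> ^ m * z" "\<zeta> ^ 0 * z"] z[of m] z[of 0] by (simp only: mem_ball_0)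
  hence "\<zeta> ^ m = 1" using \<phi>(1) by (simp add: z_def)
  thus False using J(2) m(1) unfolding good_divisors_def root_of_unity_def \<zeta>_def by blast
qed

lemma jac_inverse:
  assumes y: "\<And>i. (f ^^ i) y \<in> A" "(f ^^ n) y = y"
  shows "\<And>i. (g ^^ i) y \<in> A" "(g ^^ n) y = y" "jac (g ^^ n) y ** jac (f ^^ n) y = mat 1"
proof -
  obtain m where m: "0 < m" "(f ^^ m) y = y" using trapped_imp_periodic[OF y(1)] by blast
  have yd: "(f ^^ j) y \<in> orbit_domain f A i" for i j
    using y(1) by (simp add: orbit_domain_def flip: funpow_add[THEN fun_cong, unfolded o_apply])
  have gf: "x \<in> orbit_domain f A i \<Longrightarrow> (g ^^ i) ((f ^^ i) x) = x" for i x
    by (rule funpow_inverse[of A g f, OF inverse(1)])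
  show gA: "(g ^^ i) y \<in> A" for i
  proof -
    have "(f ^^ (i * m)) y = y" by (metis m(2) funpow_mod_eq mod_mult_self2_is_0 mult.commute funpow.simps(1) id_apply)
    \<comment> \<open>On a cycle of length \<open>m\<close>, going back \<open>i\<close> steps is
      the same as going forward \<open>i * (m - 1)\<close> steps, so the backward orbit stays in
      \<open>A\<close> as well.\<close>
    moreover have "i * m = i + i * (m - 1)" using m(1) by (cases m) simp_all
    ultimately have "(f ^^ i) ((f ^^ (i * (m - 1))) y) = y" by (simp add: funpow_add)
    hence "(g ^^ i) y = (f ^^ (i * (m - 1))) y" using gf[OF yd] by metis
    thus ?thesis using y(1) by simp
  qed
  show "(g ^^ n) y = y" using gf[OF yd[of 0], of n] y(2) by simp
  have y0: "y \<in> orbit_domain f A n" "y \<in> orbit_domain g A n" using y(1) gA by (simp_all add: orbit_domain_def)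
  have "((\<lambda>x. (g ^^ n) ((f ^^ n) x)) has_derivative (*v) (jac (g ^^ n) y ** jac (f ^^ n) y)) (at y)"
    using has_derivative_compose_jac[OF has_derivative_jac[OF holomorphic_map_on_funpow[OF holomorphic(1) open_A] y0(1)]
        has_derivative_jac[OF holomorphic_map_on_funpow[OF holomorphic(2) open_A]], of n] y0(2) y(2) by simp
  hence "((\<lambda>x. x) has_derivative (*v) (jac (g ^^ n) y ** jac (f ^^ n) y)) (at y)"
    by (rule has_derivative_transform_within_open[OF _ open_orbit_domain[OF holomorphic(1) open_A] y0(1) gf])
  moreover have "((\<lambda>x. x) has_derivative (\<lambda>v. mat 1 *v v)) (at y)" by simp
  ultimately show "jac (g ^^ n) y ** jac (f ^^ n) y = mat 1" using jac_eqI by metis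
qed

lemma multiplier_is_bad:
  assumes y: "\<And>i. (f ^^ i) y \<in> A" "(f ^^ n) y = y" "0 < n"
    and J: "det (jac (f ^^ n) y - mat 1) = 0"
  shows "root_of_unity (det (jac (f ^^ n) y)) \<or>
    norm (det (jac (f ^^ n) y)) = 1 \<and> \<not> good_divisors (det (jac (f ^^ n) y))"
proof (rule ccontr)
  interpret inv: finite_orbit_pair g f A by (rule swap)
  define \<zeta> where "\<zeta> = det (jac (f ^^ n) y)"
  assume "\<not> ?thesis"
  hence nr: "\<not> root_of_unity \<zeta>" and ng: "norm \<zeta> = 1 \<Longrightarrow> good_divisors \<zeta>" by (auto simp: \<zeta>_def)
  note gy = jac_inverse[OF y(1,2)]
  have det1: "det (jac (g ^^ n) y) * \<zeta> = 1" using arg_cong[OF gy(3), of det] by (simp add: det_mul \<zeta>_def)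
  hence \<zeta>0: "\<zeta> \<noteq> 0" by auto
  have dg: "det (jac (g ^^ n) y) = inverse \<zeta>" using det1 \<zeta>0 by (simp add: field_simps)
  obtain u where u: "u \<noteq> 0" "jac (f ^^ n) y *v u = 1 *s u" using J det_eq_0_iff_eigenvector by blast
  have "jac (g ^^ n) y *v u = jac (g ^^ n) y *v (jac (f ^^ n) y *v u)" using u(2) by simp
  also have "\<dots> = 1 *s u" by (simp add: matrix_vector_mul_assoc gy(3))
  finally have Jg: "det (jac (g ^^ n) y - mat 1) = 0" using u(1) det_eq_0_iff_eigenvector by blast
  show False
  proof (cases "norm \<zeta> \<le> 1")
    case True
    hence "good_divisors \<zeta>" using ng good_divisors_if_norm_less_1[OF _ \<zeta>0] by fastforce
    thus False using no_good_divisors_multiplier[OF y J] True by (simp add: \<zeta>_def)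
  next
    case False
    hence n: "norm (inverse \<zeta>) < 1" by (simp add: norm_inverse field_simps \<zeta>0 inverse_eq_divide norm_divide)
    hence "good_divisors (inverse \<zeta>)" using good_divisors_if_norm_less_1 \<zeta>0 by simp
    thus False using inv.no_good_divisors_multiplier[OF gy(1,2) y(3) Jg] n by (simp add: dg)
  qed
qed

end

section \<open>Continua of points that never leave the domain\<close>

lemma orbit_domain_mono: "B \<subseteq> A \<Longrightarrow> m \<le> n \<Longrightarrow> orbit_domain f B n \<subseteq> orbit_domain f A m"
  by (auto simp: orbit_domain_def)

context finite_orbit_pair
begin

text \<open>The successor matters: \<open>orbit_domain f B 0\<close> is the whole space.\<close>

lemma compact_orbit_domain:
  assumes B: "compact B" "B \<subseteq> A"
  shows "compact (orbit_domain f B (Suc n))"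
proof (induction n)
  case 0
  show ?case unfolding orbit_domain_Suc using B(1) by simp
next
  case (Suc n)
  have "continuous_on B f"
    using holomorphic_map_on_imp_continuous_on[OF holomorphic(1)] B(2) by (rule continuous_on_subset)
  hence "closed (B \<inter> f -` orbit_domain f B (Suc n))"
    using B(1) Suc by (intro continuous_closed_preimage compact_imp_closed)
  hence "compact (B \<inter> (B \<inter> f -` orbit_domain f B (Suc n)))" by (rule compact_Int_closed[OF B(1)])
  thus ?case unfolding orbit_domain_Suc[of f B "Suc n"] by (simp add: Int_assoc[symmetric])
qed

text \<open>Otherwise the component lies in the open set \<open>V\<close> of points whose orbits
  stay in the open ball, and the Sura-Bura theorem puts a compact set \<open>K\<close>, relatively
  open in \<open>S\<close>, between the two. Being contained in \<open>V\<close>, it is open in the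
  whole space; but a nonempty compact set cannot be open there.\<close>

lemma component_reaches_sphere:
  assumes R: "0 < R" "cball 0 R \<subseteq> A"
  shows "\<exists>x\<in>connected_component_set (orbit_domain f (cball 0 R) (Suc n)) 0. \<exists>j\<le>n. norm ((f ^^ j) x) = R"
proof (rule ccontr)
  define S where "S = orbit_domain f (cball 0 R) (Suc n)"
  define C where "C = connected_component_set S 0"
  define V where "V = orbit_domain f (ball 0 R) (Suc n)"
  assume "\<not> ?thesis"
  hence no: "norm ((f ^^ j) x) \<noteq> R" if "x \<in> C" "j \<le> n" for x j using that by (auto simp: C_def S_def)
  have cS: "compact S" unfolding S_def by (rule compact_orbit_domain[OF compact_cball R(2)])
  have "0 \<in> S" using R(1) by (simp add: S_def orbit_domain_def funpow_0)
  hence C: "C \<in> components S" "0 \<in> C" by (auto simp: C_def componentsI)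
  have CS: "C \<subseteq> S" unfolding C_def by (rule connected_component_subset)
  have "closed C" unfolding C_def by (rule closed_connected_component[OF compact_imp_closed[OF cS]])
  hence "compact (S \<inter> C)" by (rule compact_Int_closed[OF cS])
  hence cC: "compact C" using CS by (simp add: inf.absorb2)
  have "ball 0 R \<subseteq> A" using R(2) by auto
  hence oV: "open V" unfolding V_def
    by (intro open_orbit_domain[OF holomorphic_map_on_subset[OF holomorphic(1)]] open_ball)
  have CV: "C \<subseteq> V"
  proof
    fix x assume x: "x \<in> C"
    have "norm ((f ^^ j) x) < R" if "j < Suc n" for j
      using subsetD[OF CS x] that no[OF x, of j] by (force simp: S_def orbit_domain_def)
    thus "x \<in> V" by (simp add: V_def orbit_domain_def)
  qed
  obtain K where K: "openin (top_of_set S) K" "compact K" "C \<subseteq> K" "K \<subseteq> V"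
    by (rule Sura_Bura_clopen_subset[OF closed_imp_locally_compact[OF compact_imp_closed[OF cS]] C(1) cC oV CV]) blast
  obtain T where T: "open T" "K = S \<inter> T" using K(1) openin_open by metis
  have "V \<subseteq> S" unfolding V_def S_def by (rule orbit_domain_mono) auto
  hence "K = V \<inter> T" using T(2) K(4) by blast
  hence "open K" using oV T(1) by (simp add: open_Int)
  hence "K = {} \<or> K = UNIV" using clopen compact_imp_closed[OF K(2)] by blast
  hence "K = UNIV" using C(2) K(3) by blast
  thus False using K(2) compact_imp_bounded not_bounded_UNIV by blast
qed

text \<open>Run the component for \<open>2 * n\<close> steps and move it along to the time
  \<open>j\<close> at which one of its points is on the sphere. At least \<open>n\<close> steps are
  left after \<open>j\<close>, or at least \<open>n\<close> steps lie before it, so the moved set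
  survives \<open>n\<close> steps forward or backward.\<close>

lemma long_excursion:
  assumes R: "0 < R" "cball 0 R \<subseteq> A"
  obtains D where "connected D" "0 \<in> D" "\<exists>z\<in>D. norm z = R"
    "D \<subseteq> orbit_domain f (cball 0 R) n \<or> D \<subseteq> orbit_domain g (cball 0 R) n"
proof -
  define S where "S = orbit_domain f (cball 0 R) (Suc (2 * n))"
  define C where "C = connected_component_set S 0"
  obtain x j where x: "x \<in> C" "j \<le> 2 * n" "norm ((f ^^ j) x) = R"
    using component_reaches_sphere[OF R, of "2 * n"] unfolding C_def S_def by blast
  have CS: "C \<subseteq> S" unfolding C_def by (rule connected_component_subset)
  have SA: "S \<subseteq> orbit_domain f A j" unfolding S_def using R(2) x(2) by (intro orbit_domain_mono) auto
  have "continuous_on C (f ^^ j)"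
    using holomorphic_map_on_imp_continuous_on[OF holomorphic_map_on_funpow[OF holomorphic(1) open_A]] CS SA
    by (meson continuous_on_subset)
  hence "connected ((f ^^ j) ` C)"
    by (rule connected_continuous_image) (simp add: C_def)
  moreover have "0 \<in> (f ^^ j) ` C"
  proof -
    have "0 \<in> S" using R(1) by (simp add: S_def orbit_domain_def funpow_0)
    hence "0 \<in> C" by (simp add: C_def)
    thus ?thesis using funpow_0 by (metis image_eqI)
  qed
  moreover have "\<exists>z\<in>(f ^^ j) ` C. norm z = R" using x by blast
  moreover have "(f ^^ j) ` C \<subseteq> orbit_domain f (cball 0 R) n \<or> (f ^^ j) ` C \<subseteq> orbit_domain g (cball 0 R) n"
  proof (cases "j \<le> n")
    case True
    have "(f ^^ i) ((f ^^ j) z) \<in> cball 0 R" if "z \<in> C" "i < n" for z i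
    proof -
      have "i + j < Suc (2 * n)" using True that(2) by simp
      hence "(f ^^ (i + j)) z \<in> cball 0 R" using CS that(1) unfolding S_def orbit_domain_def by blast
      thus ?thesis by (simp add: funpow_add)
    qed
    thus ?thesis by (auto simp: orbit_domain_def)
  next
    case False
    have "(g ^^ i) ((f ^^ j) z) \<in> cball 0 R" if "z \<in> C" "i < n" for z i
    proof -
      have z: "(f ^^ k) z \<in> cball 0 R" if "k < Suc (2 * n)" for k
        using CS \<open>z \<in> C\<close> that unfolding S_def orbit_domain_def by blast
      have "(f ^^ k) ((f ^^ (j - i)) z) \<in> A" if "k < i" for k
      proof -
        have "k + (j - i) < Suc (2 * n)" using that False \<open>i < n\<close> x(2) by simp
        thus ?thesis using z R(2) by (auto simp flip: funpow_add[THEN fun_cong, unfolded o_apply])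
      qed
      hence "(g ^^ i) ((f ^^ i) ((f ^^ (j - i)) z)) = (f ^^ (j - i)) z"
        by (intro funpow_inverse[of A g f, OF inverse(1)]) (simp_all add: orbit_domain_def)
      moreover have "(f ^^ i) ((f ^^ (j - i)) z) = (f ^^ j) z"
        using False that(2) by (simp flip: funpow_add[THEN fun_cong, unfolded o_apply])
      ultimately show ?thesis using z[of "j - i"] x(2) by simp
    qed
    thus ?thesis by (auto simp: orbit_domain_def)
  qed
  ultimately show ?thesis using that by blast
qed

definition trapped_continuum :: "(complex^2) set \<Rightarrow> bool" where
  "trapped_continuum K \<longleftrightarrow> compact K \<and> connected K \<and> 0 \<in> K \<and> K \<noteq> {0} \<and> (\<forall>x\<in>K. \<forall>i. (f ^^ i) x \<in> A)"

text \<open>The components of 0 decrease with \<open>n\<close>, and each meets the sphere. By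
  compactness so does their intersection, which is a continuum and therefore not just the
  origin.\<close>

lemma trapped_continuum_if_long_excursions:
  assumes R: "0 < R" "cball 0 R \<subseteq> A"
    and D: "\<And>n. \<exists>D. connected D \<and> 0 \<in> D \<and> (\<exists>z\<in>D. norm z = R) \<and> D \<subseteq> orbit_domain f (cball 0 R) n"
  shows "\<exists>K. trapped_continuum K"
proof -
  define S where "S = (\<lambda>n. orbit_domain f (cball 0 R) (Suc n))"
  define C where "C = (\<lambda>n. connected_component_set (S n) 0)"
  have cS: "compact (S n)" for n unfolding S_def by (rule compact_orbit_domain[OF compact_cball R(2)])
  have CS: "C n \<subseteq> S n" for n unfolding C_def by (rule connected_component_subset)
  have "closed (C n)" for n unfolding C_def by (rule closed_connected_component[OF compact_imp_closed[OF cS]])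
  hence "compact (S n \<inter> C n)" for n by (rule compact_Int_closed[OF cS])
  hence cC: "compact (C n)" for n using inf.absorb2[OF CS[of n]] by metis
  have mono: "C n \<subseteq> C m" if "m \<le> n" for m n
    unfolding C_def S_def using that by (intro connected_component_mono orbit_domain_mono) auto
  have "\<Inter>(range (\<lambda>n. C n \<inter> sphere 0 R)) \<noteq> {}"
  proof (rule compact_nest)
    show "compact (C n \<inter> sphere 0 R)" for n using cC by (simp add: compact_Int)
    show "C n \<inter> sphere 0 R \<subseteq> C m \<inter> sphere 0 R" if "m \<le> n" for m n using mono[OF that] by blast
    show "C n \<inter> sphere 0 R \<noteq> {}" for n
    proof -
      obtain D z where D: "connected D" "0 \<in> D" "z \<in> D" "norm z = R" "D \<subseteq> S n"
        using D[of "Suc n"] unfolding S_def by blast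
      hence "D \<subseteq> C n" unfolding C_def by (intro connected_component_maximal)
      thus ?thesis using D(3,4) by (auto simp: sphere_def)
    qed
  qed
  then obtain z where z: "z \<in> \<Inter>(range (\<lambda>n. C n \<inter> sphere 0 R))" by blast
  define K where "K = \<Inter>(range C)"
  have "connected (C n)" for n unfolding C_def by (rule connected_connected_component)
  hence "connected K" unfolding K_def using cC mono by (intro connected_nest)
  moreover have "compact K" unfolding K_def using cC by (intro compact_Inter) auto
  moreover have "0 \<in> K" using R(1) by (simp add: K_def C_def S_def orbit_domain_def funpow_0)
  moreover have "z \<in> K" "z \<noteq> 0" using z R(1) by (auto simp: K_def)
  moreover have "(f ^^ i) x \<in> A" if "x \<in> K" for x i
  proof -
    have "x \<in> S i" using that CS[of i] by (auto simp: K_def)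
    thus ?thesis using R(2) unfolding S_def orbit_domain_def by blast
  qed
  ultimately have "trapped_continuum K" unfolding trapped_continuum_def by blast
  thus ?thesis by blast
qed

text \<open>Long excursions can be shortened. So if for every length one of the two directions
  works, then one direction works for all lengths.\<close>

theorem exists_trapped_continuum:
  "(\<exists>K. trapped_continuum K) \<or> (\<exists>K. finite_orbit_pair.trapped_continuum g A K)"
proof -
  interpret inv: finite_orbit_pair g f A by (rule swap)
  obtain R where R: "0 < R" "cball 0 R \<subseteq> A" using open_A zero_A open_contains_cball by blast
  define P where "P h n \<longleftrightarrow> (\<exists>D. connected D \<and> 0 \<in> D \<and> (\<exists>z\<in>D. norm z = R) \<and> D \<subseteq> orbit_domain h (cball 0 R) n)"
    for h :: "complex^2 \<Rightarrow> complex^2" and n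
  have mono: "P h m" if "P h n" "m \<le> n" for h m n
  proof -
    have "orbit_domain h (cball 0 R) n \<subseteq> orbit_domain h (cball 0 R) m"
      using that(2) by (intro orbit_domain_mono order_refl)
    thus ?thesis using that(1) unfolding P_def by (meson order_trans)
  qed
  have or: "P f n \<or> P g n" for n using long_excursion[OF R, of n] unfolding P_def by metis
  have "(\<forall>n. P f n) \<or> (\<forall>n. P g n)"
  proof (rule ccontr)
    assume "\<not> ((\<forall>n. P f n) \<or> (\<forall>n. P g n))"
    then obtain m n where "\<not> P f m" "\<not> P g n" by blast
    thus False using or[of "max m n"] mono[of f "max m n" m] mono[of g "max m n" n] by auto
  qed
  thus ?thesis
  proof
    assume "\<forall>n. P f n"
    thus ?thesis using trapped_continuum_if_long_excursions[OF R] unfolding P_def by simp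
  next
    assume "\<forall>n. P g n"
    thus ?thesis using inv.trapped_continuum_if_long_excursions[OF R] unfolding P_def by simp
  qed
qed

end

section \<open>Multipliers on a trapped continuum and its cover by closed sets\<close>

lemma funpow_fixed_point: "(f ^^ n) x = x \<Longrightarrow> (f ^^ (l * n)) x = x"
  by (induction l) (simp_all add: funpow_add)

context finite_orbit_pair
begin

lemma det_jac_at_limit_of_fixed_points:
  assumes "x \<in> orbit_domain f A n" "(f ^^ n) x = x" "x islimpt {z. (f ^^ n) z = z}"
  shows "det (jac (f ^^ n) x - mat 1) = 0"
proof (rule ccontr)
  assume "det (jac (f ^^ n) x - mat 1) \<noteq> 0"
  then obtain d where "0 < d" "\<forall>z\<in>ball x d. (f ^^ n) z = z \<longrightarrow> z = x"
    using isolated_fixed_point[OF holomorphic_map_on_funpow[OF holomorphic(1) open_A]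
        open_orbit_domain[OF holomorphic(1) open_A] assms(1,2)] by blast
  thus False using assms(3) unfolding islimpt_approachable by (auto simp: dist_commute)
qed

context
  fixes lam
  assumes lam: "Bruno_number lam" "\<not> root_of_unity lam"
begin

text \<open>In a nondegenerate connected set every point is a limit of fixed points, so the
  eigenvalue 1 occurs everywhere and all multipliers are bad. They form a connected set, which
  \<open>connected_bad_multipliers\<close> reduces to a point.\<close>

lemma multiplier_constant:
  assumes D: "connected D" "D \<subseteq> orbit_domain f A n" "\<And>x. x \<in> D \<Longrightarrow> (f ^^ n) x = x" and n: "0 < n"
    and xy: "x \<in> D" "y \<in> D"
  shows "det (jac (f ^^ n) x) = det (jac (f ^^ n) y)"
proof (cases "D = {x}")
  case True
  thus ?thesis using xy(2) by simp
next
  case False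
  have "connected ((\<lambda>x. det (jac (f ^^ n) x)) ` D)"
    using D(1,2) continuous_on_det_jac(1)[OF holomorphic_map_on_funpow[OF holomorphic(1) open_A]
        open_orbit_domain[OF holomorphic(1) open_A]]
    by (intro connected_continuous_image) (rule continuous_on_subset)
  moreover have "root_of_unity z \<or> norm z = 1 \<and> \<not> good_divisors z"
    if z: "z \<in> (\<lambda>x. det (jac (f ^^ n) x)) ` D" for z
  proof -
    obtain p where p: "p \<in> D" "z = det (jac (f ^^ n) p)" using z by blast
    have pd: "p \<in> orbit_domain f A n" using D(2) p(1) by blast
    have "D \<noteq> {q}" for q using False xy(1) by blast
    hence "p islimpt D" by (rule connected_imp_perfect[OF D(1) p(1)])
    hence "p islimpt {z. (f ^^ n) z = z}" by (rule islimpt_subset) (use D(3) in blast)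
    thus ?thesis
      using multiplier_is_bad[OF periodic_in_A[OF D(3)[OF p(1)] pd n] D(3)[OF p(1)] n
          det_jac_at_limit_of_fixed_points[OF pd D(3)[OF p(1)]]] p(2) by blast
  qed
  ultimately show ?thesis using xy by (intro connected_bad_multipliers[OF lam]) blast+
qed

context
  fixes K
  assumes K: "trapped_continuum K"
begin

text \<open>Factorials let the sets increase with \<open>k\<close> and exhaust \<open>K\<close>,
  because every period divides some factorial.\<close>

definition P :: "nat \<Rightarrow> (complex^2) set" where
  "P k = {x \<in> K. (f ^^ fact k) x = x}"

definition M :: "nat \<Rightarrow> complex \<Rightarrow> (complex^2) set" where
  "M k \<zeta> = {x \<in> P k. det (jac (f ^^ fact k) x - mat 1) = 0 \<and> det (jac (f ^^ fact k) x) = \<zeta>}"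

lemma in_A: "x \<in> K \<Longrightarrow> (f ^^ i) x \<in> A"
  using K by (simp add: trapped_continuum_def)

lemma K_subset_orbit_domain: "K \<subseteq> orbit_domain f A n"
  using in_A by (auto simp: orbit_domain_def)

lemma P_memD:
  assumes "x \<in> P k"
  shows "x \<in> K" "(f ^^ fact k) x = x" "x \<in> orbit_domain f A n"
  using assms K_subset_orbit_domain[of n] by (auto simp: P_def)

lemmas holomorphic_iterate = holomorphic_map_on_funpow[OF holomorphic(1) open_A]
lemmas open_domain = open_orbit_domain[OF holomorphic(1) open_A]

lemma P_mono: "k \<le> m \<Longrightarrow> P k \<subseteq> P m"
proof
  fix x assume "k \<le> m" "x \<in> P k"
  obtain l :: nat where "fact m = l * fact k" using fact_dvd[OF \<open>k \<le> m\<close>, where 'a = nat] by (metis dvdE mult.commute)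
  thus "x \<in> P m" using \<open>x \<in> P k\<close> by (simp add: P_def funpow_fixed_point)
qed

lemma in_some_P:
  assumes "x \<in> K"
  obtains k where "x \<in> P k"
proof -
  obtain m where m: "0 < m" "(f ^^ m) x = x" using trapped_imp_periodic in_A[OF assms] by blast
  obtain l :: nat where "fact m = l * m" using dvd_fact[of m m] m(1) by (metis dvdE le_refl mult.commute Suc_leI One_nat_def)
  hence "(f ^^ fact m) x = x" using funpow_fixed_point[OF m(2)] by simp
  thus ?thesis using that assms by (simp add: P_def)
qed

lemma closed_P: "closed (P k)"
proof -
  have "continuous_on K (\<lambda>x. (f ^^ fact k) x - x)"
    using holomorphic_map_on_imp_continuous_on[OF holomorphic_iterate] K_subset_orbit_domain
    by (intro continuous_on_diff continuous_on_id) (rule continuous_on_subset)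
  moreover have "closed K" using K by (simp add: trapped_continuum_def compact_imp_closed)
  ultimately have "closed {x \<in> K. (f ^^ fact k) x - x = 0}" by (rule continuous_closed_preimage_constant)
  thus ?thesis by (simp add: P_def)
qed

lemma closed_M: "closed (M k \<zeta>)"
proof -
  have "P k \<subseteq> orbit_domain f A (fact k)" using P_memD(3) by blast
  note c = continuous_on_det_jac[OF holomorphic_iterate open_domain, THEN continuous_on_subset, OF this]
  have "closed {x \<in> P k. det (jac (f ^^ fact k) x - mat 1) = 0}"
    by (rule continuous_closed_preimage_constant[OF c(2) closed_P])
  moreover have "closed {x \<in> P k. det (jac (f ^^ fact k) x) = \<zeta>}"
    by (rule continuous_closed_preimage_constant[OF c(1) closed_P])
  moreover have "M k \<zeta> = {x \<in> P k. det (jac (f ^^ fact k) x - mat 1) = 0} \<inter> {x \<in> P k. det (jac (f ^^ fact k) x) = \<zeta>}"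
    by (auto simp: M_def)
  ultimately show ?thesis by (simp add: closed_Int)
qed

lemma det_jac_at_limit_point:
  assumes "x \<in> P k" "x islimpt P k"
  shows "det (jac (f ^^ fact k) x - mat 1) = 0"
  using P_memD[OF assms(1)] islimpt_subset[OF assms(2), of "{z. (f ^^ fact k) z = z}"]
  by (intro det_jac_at_limit_of_fixed_points) (auto simp: P_def)

lemma countable_limit_multipliers:
  "countable ((\<lambda>x. det (jac (f ^^ fact k) x)) ` {x \<in> P k. x islimpt P k \<and> det (jac (f ^^ fact k) x) \<noteq> 1})"
proof (rule countable_image_if_locally_constant)
  let ?X = "{x \<in> P k. x islimpt P k \<and> det (jac (f ^^ fact k) x) \<noteq> 1}"
  fix x assume "x \<in> ?X"
  hence x: "x \<in> P k" "x islimpt P k" "det (jac (f ^^ fact k) x) \<noteq> 1" by simp_all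
  have acc: "\<exists>z\<in>ball x d. z \<noteq> x \<and> (f ^^ fact k) z = z" if "0 < d" for d
    using x(2) that unfolding islimpt_approachable by (metis P_memD(2) dist_commute mem_ball)
  obtain d C where C: "0 < d" "connected C" "x \<in> C" "C \<subseteq> orbit_domain f A (fact k)"
    "\<forall>z\<in>C. (f ^^ fact k) z = z" "{z \<in> ball x d. (f ^^ fact k) z = z} \<subseteq> C"
    using curve_of_fixed_points[OF holomorphic_iterate open_domain P_memD(3,2)[OF x(1)]
        det_jac_at_limit_point[OF x(1,2)] x(3) acc] by blast
  have "det (jac (f ^^ fact k) y) = det (jac (f ^^ fact k) x)" if y: "y \<in> ?X \<inter> ball x d" for y
  proof (rule multiplier_constant[OF C(2,4) _ _ _ C(3)])
    show "y \<in> C" using C(6) y P_memD(2) by blast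
  qed (use C(5) in simp_all)
  thus "\<exists>d>0. \<forall>y\<in>?X \<inter> ball x d. det (jac (f ^^ fact k) y) = det (jac (f ^^ fact k) x)"
    using C(1) by blast
qed

text \<open>The multiplier of \<open>f\<^bsup>fact k\<^esup>\<close> is constant on \<open>D\<close> and an \<open>l\<close>-th power of that of \<open>f\<^bsup>fact m\<^esup>\<close> on \<open>P m\<close>,
  which therefore takes only finitely many values there.\<close>

lemma connected_subset_M:
  assumes D: "connected D" "D \<subseteq> P k" "m \<le> k" "D \<inter> M m \<zeta> \<noteq> {}" and \<zeta>: "\<zeta> = 1 \<or> \<not> root_of_unity \<zeta>"
  shows "D \<subseteq> M m \<zeta>"
proof (cases "\<exists>x. D = {x}")
  case True
  thus ?thesis using D(4) by blast
next
  case False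
  let ?h = "f ^^ fact m" and ?U = "orbit_domain f A (fact m)"
  obtain l :: nat where l: "fact k = l * fact m" using fact_dvd[OF D(3), where 'a = nat] by (metis dvdE mult.commute)
  have l0: "0 < l" using l by (metis fact_nonzero mult_0 gr0I)
  hence l1: "1 \<le> l" by simp
  have pow: "det (jac ?h x) ^ l = det (jac (f ^^ fact k) x)" if "x \<in> P m" for x
    using det_jac_funpow_mult[OF holomorphic(1) open_A in_A[OF P_memD(1)[OF that]] P_memD(2)[OF that], of l]
    by (simp add: l)
  have const: "det (jac (f ^^ fact k) x) = det (jac (f ^^ fact k) y)" if "x \<in> D" "y \<in> D" for x y
    using that D(1,2) P_memD by (intro multiplier_constant[of D]) auto
  have "openin (top_of_set D) (D \<inter> M m \<zeta>)"
    unfolding openin_euclidean_subtopology_iff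
  proof (intro conjI ballI)
    fix y assume "y \<in> D \<inter> M m \<zeta>"
    hence y: "y \<in> D" "y \<in> P m" "det (jac ?h y - mat 1) = 0" "det (jac ?h y) = \<zeta>" by (simp_all add: M_def)
    have yU: "y \<in> ?U" by (rule P_memD(3)[OF y(2)])
    \<comment> \<open>The eigenvalues at \<open>y\<close> are 1 and \<zeta>. As \<zeta> is 1 or no
      root of unity, the \<open>l\<close>-th iterate of \<open>?h\<close> has no new fixed points
      near \<open>y\<close>, and therefore \<open>D\<close> lies in \<open>P m\<close>
      there.\<close>
    have ev: "c = 1" if "det (jac ?h y - mat c) = 0" "c ^ l = 1" for c
    proof -
      have "c = 1 \<or> c = \<zeta>" using that(1) det_minus_mat_eq_0_iff[OF y(3)] y(4) by simp
      moreover have "root_of_unity c" unfolding root_of_unity_def using that(2) l0 by blast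
      ultimately show ?thesis using \<zeta> by blast
    qed
    obtain d1 where d1: "0 < d1" "\<forall>x\<in>ball y d1. (?h ^^ l) x = x \<longrightarrow> ?h x = x"
      using fixed_points_of_iterate[OF holomorphic_iterate open_domain yU P_memD(2)[OF y(2)] l1 ev] by blast
    have DP: "x \<in> P m" if "x \<in> D" "x \<in> ball y d1" for x
    proof -
      have "x \<in> P k" using D(2) that(1) by blast
      hence "(f ^^ fact k) x = x" by (rule P_memD(2))
      hence "(?h ^^ l) x = x" by (simp add: funpow_mult l mult.commute)
      hence "?h x = x" using d1(2) that(2) by blast
      thus ?thesis using P_memD(1)[OF \<open>x \<in> P k\<close>] by (simp add: P_def)
    qed
    \<comment> \<open>The multiplier of \<open>?h\<close> on \<open>D\<close> near \<open>y\<close>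
      is an \<open>l\<close>-th root of \<zeta>^l. By continuity it avoids all the other roots, so
      it equals \<zeta>.\<close>
    define W where "W = {w. w ^ l = \<zeta> ^ l} - {\<zeta>}"
    have "finite W" using finite_nth_roots[OF l0] by (simp add: W_def)
    hence "open (?U \<inter> (\<lambda>x. det (jac ?h x)) -` (- W))"
      by (intro continuous_open_preimage continuous_on_det_jac holomorphic_iterate open_domain open_Compl finite_imp_closed)
    moreover have "y \<in> ?U \<inter> (\<lambda>x. det (jac ?h x)) -` (- W)" using yU y(4) by (simp add: W_def)
    ultimately obtain d2 where d2: "0 < d2" "ball y d2 \<subseteq> ?U \<inter> (\<lambda>x. det (jac ?h x)) -` (- W)"
      using open_contains_ball by blast
    have "x \<in> M m \<zeta>" if x: "x \<in> D" "x \<in> ball y (min d1 d2)" for x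
    proof -
      have x12: "x \<in> ball y d1" "x \<in> ball y d2" using x(2) by simp_all
      have xP: "x \<in> P m" by (rule DP[OF x(1) x12(1)])
      have "x islimpt P m" unfolding islimpt_approachable
      proof (intro allI impI)
        fix e :: real assume "0 < e"
        \<comment> \<open>The approximating points have to stay in the ball of radius
          \<open>d1\<close> around \<open>y\<close>, where points of \<open>D\<close> are known to
          be in \<open>P m\<close>.\<close>
        hence "0 < min e (d1 - dist y x)" using x12(1) by simp
        moreover have "x islimpt D" using connected_imp_perfect[OF D(1) x(1)] False by blast
        ultimately obtain x' where x': "x' \<in> D" "x' \<noteq> x" "dist x' x < min e (d1 - dist y x)"
          unfolding islimpt_approachable by blast
        hence "dist y x' < d1" using dist_triangle[of y x' x] by (simp add: dist_commute)
        thus "\<exists>x'\<in>P m. x' \<noteq> x \<and> dist x' x < e" using DP[OF x'(1)] x' by auto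
      qed
      hence "det (jac ?h x - mat 1) = 0" by (rule det_jac_at_limit_point[OF xP])
      moreover have "det (jac ?h x) ^ l = \<zeta> ^ l" using pow[OF xP] pow[OF y(2)] const[OF x(1) y(1)] y(4) by simp
      hence "det (jac ?h x) = \<zeta>" using d2(2) x12(2) unfolding W_def by blast
      ultimately show ?thesis using xP by (simp add: M_def)
    qed
    thus "\<exists>d>0. \<forall>x'\<in>D. dist x' y < d \<longrightarrow> x' \<in> D \<inter> M m \<zeta>"
      using d1(1) d2(1) by (intro exI[of _ "min d1 d2"]) (auto simp: dist_commute)
  qed blast
  moreover have "closedin (top_of_set D) (D \<inter> M m \<zeta>)"
    using closed_M by (simp add: closedin_closed_Int)
  ultimately have "D \<inter> M m \<zeta> = {} \<or> D \<inter> M m \<zeta> = D" using D(1) unfolding connected_clopen by blast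
  thus ?thesis using D(4) by blast
qed

theorem trapped_continuum_resonant: "\<exists>n>0. det (jac (f ^^ n) 0 - mat 1) = 0"
proof -
  \<comment> \<open>Roots of unity other than 1 are left out, as \<open>connected_subset_M\<close>
    does not apply to them. The value 1 is always present and takes over their points at a later
    stage.\<close>
  define Z where "Z = (\<lambda>k. insert 1 {\<zeta> \<in> (\<lambda>x. det (jac (f ^^ fact k) x)) `
     {x \<in> P k. x islimpt P k \<and> det (jac (f ^^ fact k) x) \<noteq> 1}. \<not> root_of_unity \<zeta>})"
  \<comment> \<open>Isolation is demanded at all later stages, so that no nondegenerate connected
    subset of some later \<open>P k\<close> passes through the point. This gives the inclusion
    condition for the singletons.\<close>
  define I where "I = (\<lambda>m. {x \<in> P m. \<forall>k\<ge>m. \<not> x islimpt P k})"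
  define \<F> where "\<F> = (\<Union>k. M k ` Z k) \<union> (\<lambda>x. {x}) ` (\<Union>m. I m)"
  have cZ: "countable (Z k)" for k
    unfolding Z_def using countable_limit_multipliers[of k] by (auto intro: countable_subset[rotated])
  have cI: "countable (I m)" for m
    by (rule countable_subset[OF _ countable_non_limit_points[of "P m"]]) (auto simp: I_def)
  have Z: "\<zeta> = 1 \<or> \<not> root_of_unity \<zeta>" if "\<zeta> \<in> Z k" for \<zeta> k using that by (auto simp: Z_def)
  have cover: "\<exists>R\<in>\<F>. x \<in> R" if x: "x \<in> K" for x
  proof -
    obtain m where m: "x \<in> P m" using in_some_P[OF x] .
    show ?thesis
    proof (cases "\<forall>k\<ge>m. \<not> x islimpt P k")
      case True
      hence "x \<in> I m" using m by (simp add: I_def)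
      hence "{x} \<in> \<F>" unfolding \<F>_def by blast
      thus ?thesis by blast
    next
      case False
      then obtain k where k: "m \<le> k" "x islimpt P k" by blast
      have xk: "x \<in> P k" using P_mono[OF k(1)] m by blast
      define \<zeta> where "\<zeta> = det (jac (f ^^ fact k) x)"
      show ?thesis
      proof (cases "root_of_unity \<zeta>")
        case False
        hence "\<zeta> \<noteq> 1" by (metis root_of_unity_def power_one zero_less_one)
        hence "\<zeta> \<in> Z k" unfolding Z_def \<zeta>_def using False xk k(2) \<zeta>_def by blast
        moreover have "x \<in> M k \<zeta>" using det_jac_at_limit_point[OF xk k(2)] xk by (simp add: M_def \<zeta>_def)
        ultimately show ?thesis unfolding \<F>_def by blast
      next
        case True
        then obtain n where n: "0 < n" "\<zeta> ^ n = 1" unfolding root_of_unity_def by blast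
        \<comment> \<open>\<open>n * fact k\<close> divides \<open>fact (k + n)\<close>, so at stage
          \<open>k + n\<close> the multiplier is a power of \<open>\<zeta> ^ n\<close>, that is
          1.\<close>
        obtain l where l: "fact (k + n) = (l * n) * fact k"
        proof -
          have "n dvd fact n" using n(1) by (simp add: dvd_fact)
          moreover have "fact k * fact n dvd (fact (k + n) :: nat)" by (rule fact_fact_dvd_fact)
          ultimately have "n * fact k dvd fact (k + n)"
            by (metis dvd_trans mult.commute mult_dvd_mono dvd_refl)
          thus thesis using that by (metis dvdE mult.assoc mult.commute)
        qed
        have "det (jac (f ^^ fact (k + n)) x) = \<zeta> ^ (l * n)"
          using det_jac_funpow_mult[OF holomorphic(1) open_A in_A[OF P_memD(1)[OF xk]] P_memD(2)[OF xk], of "l * n"]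
          by (simp only: l \<zeta>_def)
        also have "\<dots> = 1" by (metis mult.commute n(2) power_mult power_one)
        finally have "det (jac (f ^^ fact (k + n)) x) = 1" .
        moreover have sub: "P k \<subseteq> P (k + n)" by (rule P_mono) simp
        moreover have "x islimpt P (k + n)" using islimpt_subset[OF k(2) sub] .
        ultimately have "x \<in> M (k + n) 1" using det_jac_at_limit_point[of x "k + n"] xk by (auto simp: M_def)
        thus ?thesis unfolding \<F>_def Z_def by blast
      qed
    qed
  qed
  \<comment> \<open>As the sets \<open>P\<close> increase, each member of the cover can be viewed at
    a stage beyond that of any other member, which \<open>connected_subset_M\<close>
    presupposes.\<close>
  have sub: "\<exists>k\<ge>m. R \<subseteq> P k" if "R \<in> \<F>" for R m
  proof -
    have "\<exists>k. R \<subseteq> P k" using that by (auto simp: \<F>_def M_def I_def)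
    then obtain k where "R \<subseteq> P k" ..
    thus ?thesis using P_mono[of k "max k m"] by (intro exI[of _ "max k m"]) auto
  qed
  have "\<exists>R\<in>\<F>. K \<subseteq> R"
  proof (rule continuum_subset_of_countable_closed_cover)
    show "compact K" "connected K" "K \<noteq> {}" using K by (auto simp: trapped_continuum_def)
    show "countable \<F>" unfolding \<F>_def using cZ cI by auto
    show "K \<subseteq> \<Union>\<F>" using cover by blast
    show "closed R" if "R \<in> \<F>" for R using that closed_M by (auto simp: \<F>_def)
    show "D \<subseteq> S" if R: "R \<in> \<F>" and S: "S \<in> \<F>" and D: "connected D" "D \<subseteq> R" "D \<inter> S \<noteq> {}" for R S D
      using S unfolding \<F>_def
    proof
      assume "S \<in> (\<Union>k. M k ` Z k)"
      then obtain m \<zeta> where S: "S = M m \<zeta>" "\<zeta> \<in> Z m" by blast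
      obtain k where "m \<le> k" "R \<subseteq> P k" using sub[OF R] by blast
      thus ?thesis using connected_subset_M[OF D(1) _ _ _ Z[OF S(2)]] D(2,3) S(1) by blast
    next
      assume "S \<in> (\<lambda>x. {x}) ` (\<Union>m. I m)"
      then obtain m x where S: "S = {x}" "x \<in> I m" by blast
      obtain k where k: "m \<le> k" "R \<subseteq> P k" using sub[OF R] by blast
      show ?thesis
      proof (cases "D = {x}")
        case False
        have "x \<in> D" using D(3) S(1) by blast
        moreover from this have "D \<noteq> {y}" for y using False by blast
        ultimately have "x islimpt D" using connected_imp_perfect[OF D(1)] by blast
        hence "x islimpt P k" by (rule islimpt_subset) (use D(2) k(2) in blast)
        thus ?thesis using S(2) k(1) unfolding I_def by blast
      qed (simp add: S(1))
    qed
  qed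
  then obtain R where R: "R \<in> \<F>" "K \<subseteq> R" by blast
  have K0: "0 \<in> K" "K \<noteq> {0}" using K by (auto simp: trapped_continuum_def)
  hence "\<not> (\<exists>x. R = {x})" using R(2) by blast
  then obtain k \<zeta> where "R = M k \<zeta>" using R(1) unfolding \<F>_def by blast
  hence "0 \<in> M k \<zeta>" using R(2) K0(1) by blast
  thus ?thesis by (intro exI[of _ "fact k"]) (simp add: M_def)
qed

end

end

lemma resonant_fixed_point:
  assumes "Bruno_number lam" "\<not> root_of_unity lam"
  shows "\<exists>n>0. det (jac (f ^^ n) 0 - mat 1) = 0"
proof -
  interpret inv: finite_orbit_pair g f A by (rule swap)
  from exists_trapped_continuum show ?thesis
  proof
    assume "\<exists>K. trapped_continuum K"
    thus ?thesis using trapped_continuum_resonant[OF assms] by blast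
  next
    assume "\<exists>K. inv.trapped_continuum K"
    then obtain n where n: "0 < n" "det (jac (g ^^ n) 0 - mat 1) = 0"
      using inv.trapped_continuum_resonant[OF assms] by blast
    \<comment> \<open>A vector fixed by the derivative of \<open>g ^^ n\<close> is also fixed by
      that of \<open>f ^^ n\<close>, since these matrices are inverse to each other.\<close>
    obtain u where u: "u \<noteq> 0" "jac (g ^^ n) 0 *v u = 1 *s u" using n(2) det_eq_0_iff_eigenvector by blast
    have "jac (f ^^ n) 0 *v u = jac (f ^^ n) 0 *v (jac (g ^^ n) 0 *v u)" using u(2) by simp
    also have "\<dots> = 1 *s u"
      using inv.jac_inverse(3)[of 0 n] zero_A inv.funpow_0 by (simp add: matrix_vector_mul_assoc)
    finally show ?thesis using n(1) u(1) det_eq_0_iff_eigenvector by blast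
  qed
qed

theorem not_Bruno_number_eigenvalue:
  assumes lam: "det (jac f 0 - mat lam) = 0" "\<not> root_of_unity lam"
  shows "\<not> Bruno_number lam"
proof
  assume B: "Bruno_number lam"
  obtain n where n: "0 < n" "det (jac (f ^^ n) 0 - mat 1) = 0" using resonant_fixed_point[OF B lam(2)] by blast
  have A0: "(f ^^ i) 0 \<in> A" for i using zero_A by (simp add: funpow_0)
  have f1: "(f ^^ 1) 0 = 0" by (rule funpow_0)
  have eig: "jac (f ^^ n) 0 *v u = c ^ n *s u" if "jac f 0 *v u = c *s u" for u c
    using eigenvector_jac_funpow_mult[OF holomorphic(1) open_A A0 f1, of u c n] that by simp
  obtain v where v: "v \<noteq> 0" "jac f 0 *v v = lam *s v" using lam(1) det_eq_0_iff_eigenvector by blast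
  have nn: "\<not> root_of_unity (lam ^ n)" using lam(2) root_of_unity_power_iff[OF n(1)] by simp
  hence "lam ^ n \<noteq> 1" by (metis root_of_unity_def power_one zero_less_one)
  moreover have "det (jac (f ^^ n) 0 - mat (lam ^ n)) = 0"
    using eig[OF v(2)] v(1) det_eq_0_iff_eigenvector by blast
  ultimately have d: "det (jac (f ^^ n) 0) = lam ^ n" using det_minus_mat_eq_0_iff[OF n(2)] by metis
  have "good_divisors (lam ^ n)" by (rule Bruno_number_power_good_divisors[OF B lam(2) n(1)])
  hence "1 < norm (lam ^ n)"
    using no_good_divisors_multiplier[OF A0 funpow_0 n] d by simp
  thus False using B by (simp add: Bruno_number_def norm_power)
qed

end

section \<open>From germs to a pair of inverse maps with finite orbits\<close>

lemma linear_part_eq_jac: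
  assumes "same_germ F G" "holomorphic_map_on G U" "0 \<in> U"
  shows "linear_part F = (*v) (jac G 0)"
proof -
  obtain S where S: "open S" "0 \<in> S" "\<And>z. z \<in> S \<Longrightarrow> F z = G z"
    using assms(1) unfolding same_germ_def eventually_nhds by blast
  have "(F has_derivative (*v) (jac G 0)) (at 0)"
    by (rule has_derivative_transform_within_open[OF has_derivative_jac[OF assms(2,3)] S(1,2)]) (simp add: S(3))
  thus ?thesis unfolding linear_part_def by (rule frechet_derivative_at[symmetric])
qed

theorem proposition1:
  fixes F :: "complex^2 \<Rightarrow> complex^2" and lam :: complex
  assumes "F \<in> Diff0"
    and "finite_orbits_property F"
    and "\<not> finite_orbits_property (linear_part F)"
    and "eigenvalue (linear_part F) lam"
    and "\<not> root_of_unity lam"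
  shows "\<not> Bruno_number lam"
proof -
  obtain G U V A where G: "same_germ F G" "local_diffeo G U V" "0 \<in> interior A" "A \<subseteq> U \<inter> V"
    "finite_orbits_in G U A"
    using assms(2) unfolding finite_orbits_property_def by blast
  have bih: "open U" "open V" "bij_betw G U V" "holomorphic_map_on G U" "holomorphic_map_on (inv_into U G) V"
    and at0: "0 \<in> U" "G 0 = 0"
    using G(2) by (simp_all add: local_diffeo_def biholomorphism_def)
  have sub: "interior A \<subseteq> A" "interior A \<subseteq> U" "interior A \<subseteq> V" using interior_subset[of A] G(4) by auto
  have inj: "inj_on G U" and img: "G ` U = V" using bih(3) by (simp_all add: bij_betw_def)
  \<comment> \<open>A smaller set only shortens orbits, so finiteness passes to the interior of
    \<open>A\<close>, which is open as the locale requires.\<close>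
  have fin: "finite (pos_orbit h (interior A) x)" if "finite (pos_orbit h A x)" for h :: "complex^2 \<Rightarrow> complex^2" and x
    by (rule finite_subset[OF _ that]) (use sub(1) in \<open>auto simp: pos_orbit_def\<close>)
  interpret finite_orbit_pair G "inv_into U G" "interior A"
  proof
    fix x assume x: "x \<in> interior A"
    have "finite (local_orbit G U A x)" using G(5) x sub(1) by (auto simp: finite_orbits_in_def)
    thus "finite (pos_orbit G (interior A) x)" "finite (pos_orbit (inv_into U G) (interior A) x)"
      by (auto intro: fin simp: local_orbit_def)
    show "inv_into U G (G x) = x" using x sub(2) by (intro inv_into_f_f[OF inj]) blast
    show "G (inv_into U G x) = x" using x sub(3) img by (intro f_inv_into_f) blast
  next
    show "inv_into U G 0 = 0" using inv_into_f_f[OF inj at0(1)] at0(2) by simp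
  qed (use G(3) at0 bih holomorphic_map_on_subset sub in auto)
  have "det (jac G 0 - mat lam) = 0"
    using assms(4) unfolding eigenvalue_def linear_part_eq_jac[OF G(1) bih(4) at0(1)] det_eq_0_iff_eigenvector .
  thus ?thesis using assms(5) by (rule not_Bruno_number_eigenvalue)
qed

end
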